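(* Let $H_a, H_b$ be distinct graphs in $\{H_2,H_3,H_4\}$. Then every $(2K_2,K_4,H_a,H_b)$-free graph is recolorable.
   Context: All graphs are finite and simple. For graphs $F_1,\dots,F_t$, a graph $G$ is $(F_1,\dots,F_t)$-free if no induced subgraph of $G$ is isomorphic to any $F_j$. $2K_2$ is the disjoint union of two copies of $K_2$, and $K_4$ is the complete graph on four vertices. The graphs $H_2,H_3,H_4$ are each obtained from a $5$-cycle with vertices $1,2,3,4,5$ in cyclic order by adding one new vertex $u$, where (indices modulo $5$), for some fixed $i$: in $H_2$, $u$ is adjacent to exactly $i-1,i+1$; in $H_3$, $u$ is adjacent to exactly $i,i-2,i+2$; in $H_4$, $u$ is adjacent to exactly the four cycle vertices other than $i$. An $\ell$-coloring of $G$ is a map $V(G)\to\{1,\dots,\ell\}$ giving adjacent vertices distinct colors (not all colors need be used); $\chi(G)$ is the least $\ell$ for which an $\ell$-coloring exists. The reconfiguration graph $\mathcal{R}_\ell(G)$ has the $\ell$-colorings of $G$ as vertices, with two colorings adjacent whenever they differ on exactly one vertex of $G$. The graph $G$ is recolorable if $\mathcal{R}_\ell(G)$ is connected for every $\ell>\chi(G)$. *)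

theory Defs
  imports "Graph_Theory.Graph_Theory" "HOL-Library.FuncSet"
begin

text \<open>
  Finite simple graphs are the symmetric digraphs of locale \<^locale>\<open>pair_graph\<close>: an edge
  \<open>uv\<close> is represented by the two arcs \<open>(u,v)\<close> and \<open>(v,u)\<close>.  The null graph is allowed.
\<close>

definition graph_of :: "'a set \<Rightarrow> ('a \<times> 'a) set \<Rightarrow> 'a pair_pre_digraph" where
  "graph_of V E = \<lparr> pverts = V, parcs = E \<union> E\<inverse> \<rparr>"

definition two_K2 :: "nat pair_pre_digraph" where
  "two_K2 = graph_of {1..4} {(1,2), (3,4)}"

definition K4 :: "nat pair_pre_digraph" where
  "K4 = graph_of {1..4} {(1,2), (1,3), (1,4), (2,3), (2,4), (3,4)}"

text \<open>The 5-cycle \<open>1,2,3,4,5\<close> plus a new vertex \<open>u = 6\<close> whose neighbourhood is \<open>S\<close>.\<close>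

definition C5_plus :: "nat set \<Rightarrow> nat pair_pre_digraph" where
  "C5_plus S = graph_of {1..6} ({(1,2), (2,3), (3,4), (4,5), (5,1)} \<union> {6} \<times> S)"

text \<open>
  The neighbourhoods of \<open>u\<close> are \<open>{i-1, i+1}\<close>, \<open>{i, i-2, i+2}\<close> and \<open>{1,...,5} - {i}\<close>
  (modulo 5), taken at \<open>i = 1\<close>; rotating the cycle shows that, up to isomorphism, the choice
  of \<open>i\<close> does not matter.
\<close>

definition H2 :: "nat pair_pre_digraph" where
  "H2 = C5_plus {5, 2}"

definition H3 :: "nat pair_pre_digraph" where
  "H3 = C5_plus {1, 4, 3}"

definition H4 :: "nat pair_pre_digraph" where
  "H4 = C5_plus {2, 3, 4, 5}"

definition free_of :: "'b pair_pre_digraph set \<Rightarrow> 'a pair_pre_digraph \<Rightarrow> bool" where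
  "free_of Fs G \<longleftrightarrow>
     (\<forall>F\<in>Fs. \<not> (\<exists>H :: 'a pair_pre_digraph.
        induced_subgraph (with_proj H) (with_proj G) \<and> digraph_iso (with_proj H) (with_proj F)))"

text \<open>
  Colorings are extensional functions (undefined outside the vertex set), so that two colorings
  that agree on all vertices are equal.
\<close>

definition colorings :: "'a pair_pre_digraph \<Rightarrow> nat \<Rightarrow> ('a \<Rightarrow> nat) set" where
  "colorings G l = {c \<in> pverts G \<rightarrow>\<^sub>E {1..l}. \<forall>(u,v)\<in>parcs G. c u \<noteq> c v}"

definition chromatic_number :: "'a pair_pre_digraph \<Rightarrow> nat" where
  "chromatic_number G = (LEAST l. colorings G l \<noteq> {})"

definition reconf_graph :: "'a pair_pre_digraph \<Rightarrow> nat \<Rightarrow> ('a \<Rightarrow> nat) pair_pre_digraph" where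
  "reconf_graph G l =
     \<lparr> pverts = colorings G l,
       parcs = {(c,d). c \<in> colorings G l \<and> d \<in> colorings G l \<and> (\<exists>!v. v \<in> pverts G \<and> c v \<noteq> d v)} \<rparr>"

definition recolorable :: "'a pair_pre_digraph \<Rightarrow> bool" where
  "recolorable G \<longleftrightarrow>
     (\<forall>l > chromatic_number G. Digraph_Component.connected (with_proj (reconf_graph G l)))"

lemma pair_graph_graph_of:
  assumes "finite V" "E \<subseteq> V \<times> V" "\<And>v. (v,v) \<notin> E"
  shows "pair_graph (graph_of V E)"
proof -
  have "finite E"
    using assms(1,2) by (meson finite_SigmaI finite_subset)
  then show ?thesis
    using assms
    by unfold_locales (auto simp: graph_of_def symmetric_def sym_def arcs_ends_def arc_to_ends_def)
qed

lemma pair_graph_patterns: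
  "pair_graph two_K2" "pair_graph K4" "pair_graph H2" "pair_graph H3" "pair_graph H4"
  unfolding two_K2_def K4_def H2_def H3_def H4_def C5_plus_def
  by (rule pair_graph_graph_of; auto)+

lemma complete_K4: "complete_digraph 4 (with_proj K4)"
  unfolding complete_digraph_pair_def
proof (intro conjI)
  have "{1..4} = {1, 2, 3, 4::nat}" by auto
  then show "parcs K4 = {(u, v). (u, v) \<in> pverts K4 \<times> pverts K4 \<and> u \<noteq> v}"
    by (auto simp: K4_def graph_of_def)
qed (auto simp: K4_def graph_of_def)

lemma chromatic_number_attained:
  assumes "pair_graph G"
  shows "colorings G (chromatic_number G) \<noteq> {}"
proof -
  interpret pair_graph G by fact
  have "finite (pverts G)" using finite_verts by simp
  then obtain f where f: "bij_betw f (pverts G) {1..card (pverts G)}"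
    using finite_same_card_bij[of "pverts G" "{1..card (pverts G)}"] by auto
  have "f u \<noteq> f v" if "(u,v) \<in> parcs G" for u v
  proof -
    have "u \<in> pverts G" "v \<in> pverts G" using that in_arcsD1 in_arcsD2 by blast+
    moreover have "u \<noteq> v" using that no_loops' by blast
    ultimately show ?thesis using f by (auto simp: bij_betw_def inj_on_def)
  qed
  then have "restrict f (pverts G) \<in> colorings G (card (pverts G))"
    using f in_arcsD1 in_arcsD2 by (fastforce simp: colorings_def bij_betw_def)
  then have "colorings G (card (pverts G)) \<noteq> {}" by blast
  then show ?thesis unfolding chromatic_number_def by (rule LeastI)
qed

end

theory Submission
  imports Defs
begin

text \<open>
  Two facts drive the proof.  If the neighbourhood of \<open>u\<close> is contained in that of another vertex
  \<open>v\<close>, then \<open>u\<close> can imitate \<open>v\<close>, so \<open>u\<close> may be deleted; hence a minimal counterexample has no such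
  comparable pair.  And if \<open>S\<close> is a maximal independent set with \<open>\<chi>(G - S) < \<chi>(G)\<close>, then all
  \<open>l\<close>-colorings in which \<open>S\<close> is monochromatic lie in one component, which contains any coloring with
  fewer than \<open>l\<close> colors (recolor \<open>S\<close> with the spare color).  As every color class can be enlarged to
  a maximal independent set, it suffices to steer each coloring to one with such a class \<open>S\<close>.

  If there is an induced 5-cycle, \<open>2K\<^sub>2\<close>-freeness makes every other vertex see the cycle as \<open>u\<close> does in
  \<open>H\<^sub>2\<close>, \<open>H\<^sub>3\<close> or \<open>H\<^sub>4\<close>, or completely, or not at all, and only one of the first three kinds
  occurs.  Otherwise growing an induced path in the complement of an incomparable graph closes up to
  an induced 6-cycle or 7-cycle of the complement.  Without a 7-cycle the graph is the complement of
  the 6-cycle; and every maximal independent set meets every 7-cycle of the complement, so that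
  removing it leaves a 3-colorable graph, whereas the complement of the 7-cycle needs four colors.
\<close>

section \<open>Periodic sequences\<close>

text \<open>The obstacle is that enlarging a color class need not give a set \<open>S\<close> whose
  removal lowers the chromatic number. Mostly a single vertex settles this: if every maximal
  independent set through it is good, its color class serves in any coloring. Such a vertex is one
  complete to a 5-cycle, failing that one attached as in \<open>H4\<close>, and, if the complement
  has an induced 7-cycle, any vertex. With attachments as in \<open>H3\<close> only and no vertex
  complete to a 5-cycle, the argument relies instead on classes containing two cycle vertices at
  distance two, and a coloring that shows five colors on the cycle has to be changed until two such
  vertices agree. The values 2 and 3 of \<open>n\<close> (colors sufficient after the removal of
  \<open>S\<close>) match the lower bounds: a triangle or an odd cycle needs three colors, while a
  vertex complete to a 5-cycle, or an induced 7-cycle of the complement, forces four. Forbidding two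
  of the three graphs matters because a single type of attachment remains, up to rotation; then
  \<open>2K_2\<close>- and \<open>K_4\<close>-freeness control the adjacencies between its
  rotations.\<close>

lemma period_index:
  fixes f :: "nat \<Rightarrow> 'b"
  assumes "\<And>i. f (i + n) = f i" "0 < n"
  obtains j where "j < n" "f k = f (i + j)"
proof -
  have m: "f (r + n * t) = f r" for r t
  proof (induction t)
    case (Suc t)
    have "r + n * Suc t = (r + n * t) + n" by simp
    with Suc assms(1)[of "r + n * t"] show ?case by metis
  qed simp
  \<comment> \<open>On natural numbers \<open>(n - 1) * i\<close> replaces \<open>- i\<close> modulo
    \<open>n\<close>, so \<open>j\<close> is \<open>k - i\<close> reduced modulo
    \<open>n\<close>.\<close>
  define j where "j = (k + (n - 1) * i) mod n"
  have "(i + j) mod n = (i + (k + (n - 1) * i)) mod n" unfolding j_def by (rule mod_add_right_eq)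
  also have "i + (k + (n - 1) * i) = k + n * i" using assms(2) by (cases n) simp_all
  finally have j: "(i + j) mod n = k mod n" by simp
  have "f x = f (x mod n)" for x
    using m[of "x mod n" "x div n"] by simp
  then have "f k = f (i + j)" using j by metis
  moreover have "j < n" unfolding j_def using assms(2) by simp
  ultimately show thesis using that by blast
qed

text \<open>Rewrite rules for rotating a statement: its instance at \<open>i + a\<close> mentions
  indices \<open>i + a + b\<close>, and each is brought back to one of \<open>i, ..., i + 4\<close>.
  With \<open>i\<close> symbolic, one proof serves all rotations. The variants for 6 and 7 do the
  same.\<close>

lemma period5_wrap:
  fixes f :: "nat \<Rightarrow> 'b"
  assumes "\<And>i. f (i + 5) = f i"
  shows
  "f (i + 1 + 4) = f i" "f (i + 2 + 3) = f i" "f (i + 3 + 2) = f i" "f (i + 4 + 1) = f i"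
  "f (i + 2 + 4) = f (i + 1)" "f (i + 3 + 3) = f (i + 1)" "f (i + 4 + 2) = f (i + 1)"
  "f (i + 3 + 4) = f (i + 2)" "f (i + 4 + 3) = f (i + 2)" "f (i + 4 + 4) = f (i + 3)"
  "f (i + 1 + 1) = f (i + 2)" "f (i + 1 + 2) = f (i + 3)" "f (i + 1 + 3) = f (i + 4)"
  "f (i + 2 + 1) = f (i + 3)" "f (i + 2 + 2) = f (i + 4)" "f (i + 3 + 1) = f (i + 4)"
  using assms[of i] assms[of "i + 1"] assms[of "i + 2"] assms[of "i + 3"]
  by (simp_all add: numeral_eq_Suc)

lemma period6_wrap:
  fixes f :: "nat \<Rightarrow> 'b"
  assumes "\<And>i. f (i + 6) = f i"
  shows
  "f (i + 1 + 1) = f (i + 2)" "f (i + 1 + 2) = f (i + 3)" "f (i + 1 + 3) = f (i + 4)"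
  "f (i + 1 + 4) = f (i + 5)" "f (i + 1 + 5) = f i" "f (i + 2 + 1) = f (i + 3)"
  "f (i + 2 + 2) = f (i + 4)" "f (i + 2 + 3) = f (i + 5)" "f (i + 2 + 4) = f i"
  "f (i + 2 + 5) = f (i + 1)" "f (i + 3 + 1) = f (i + 4)" "f (i + 3 + 2) = f (i + 5)"
  "f (i + 3 + 3) = f i" "f (i + 3 + 4) = f (i + 1)" "f (i + 3 + 5) = f (i + 2)"
  "f (i + 4 + 1) = f (i + 5)" "f (i + 4 + 2) = f i" "f (i + 4 + 3) = f (i + 1)"
  "f (i + 4 + 4) = f (i + 2)" "f (i + 4 + 5) = f (i + 3)" "f (i + 5 + 1) = f i"
  "f (i + 5 + 2) = f (i + 1)" "f (i + 5 + 3) = f (i + 2)" "f (i + 5 + 4) = f (i + 3)"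
  "f (i + 5 + 5) = f (i + 4)"
  using assms[of i] assms[of "i + 1"] assms[of "i + 2"] assms[of "i + 3"] assms[of "i + 4"]
  by (simp_all add: numeral_eq_Suc)

lemma period7_wrap:
  fixes f :: "nat \<Rightarrow> 'b"
  assumes "\<And>i. f (i + 7) = f i"
  shows
  "f (i + 1 + 1) = f (i + 2)" "f (i + 1 + 2) = f (i + 3)" "f (i + 1 + 3) = f (i + 4)"
  "f (i + 1 + 4) = f (i + 5)" "f (i + 1 + 5) = f (i + 6)" "f (i + 1 + 6) = f i"
  "f (i + 2 + 1) = f (i + 3)" "f (i + 2 + 2) = f (i + 4)" "f (i + 2 + 3) = f (i + 5)"
  "f (i + 2 + 4) = f (i + 6)" "f (i + 2 + 5) = f i" "f (i + 2 + 6) = f (i + 1)"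
  "f (i + 3 + 1) = f (i + 4)" "f (i + 3 + 2) = f (i + 5)" "f (i + 3 + 3) = f (i + 6)"
  "f (i + 3 + 4) = f i" "f (i + 3 + 5) = f (i + 1)" "f (i + 3 + 6) = f (i + 2)"
  "f (i + 4 + 1) = f (i + 5)" "f (i + 4 + 2) = f (i + 6)" "f (i + 4 + 3) = f i"
  "f (i + 4 + 4) = f (i + 1)" "f (i + 4 + 5) = f (i + 2)" "f (i + 4 + 6) = f (i + 3)"
  "f (i + 5 + 1) = f (i + 6)" "f (i + 5 + 2) = f i" "f (i + 5 + 3) = f (i + 1)"
  "f (i + 5 + 4) = f (i + 2)" "f (i + 5 + 5) = f (i + 3)" "f (i + 5 + 6) = f (i + 4)"
  "f (i + 6 + 1) = f i" "f (i + 6 + 2) = f (i + 1)" "f (i + 6 + 3) = f (i + 2)"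
  "f (i + 6 + 4) = f (i + 3)" "f (i + 6 + 5) = f (i + 4)" "f (i + 6 + 6) = f (i + 5)"
  using assms[of i] assms[of "i + 1"] assms[of "i + 2"] assms[of "i + 3"] assms[of "i + 4"] assms[of "i + 5"]
  by (simp_all add: numeral_eq_Suc)

lemma period5_index:
  fixes f :: "nat \<Rightarrow> 'b"
  assumes "\<And>i. f (i + 5) = f i"
  shows "f k = f i \<or> f k = f (i + 1) \<or> f k = f (i + 2) \<or> f k = f (i + 3) \<or> f k = f (i + 4)"
proof -
  obtain j where j: "j < 5" "f k = f (i + j)" using period_index[of f 5 k i] assms by auto
  then have "j = 0 \<or> j = 1 \<or> j = 2 \<or> j = 3 \<or> j = 4" by linarith
  with j(2) show ?thesis by auto
qed

lemma period6_index:
  fixes f :: "nat \<Rightarrow> 'b"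
  assumes "\<And>i. f (i + 6) = f i"
  shows "f k = f i \<or> f k = f (i + 1) \<or> f k = f (i + 2) \<or> f k = f (i + 3) \<or> f k = f (i + 4) \<or> f k = f (i + 5)"
proof -
  obtain j where j: "j < 6" "f k = f (i + j)" using period_index[of f 6 k i] assms by auto
  then have "j = 0 \<or> j = 1 \<or> j = 2 \<or> j = 3 \<or> j = 4 \<or> j = 5" by linarith
  with j(2) show ?thesis by auto
qed

lemma period7_index:
  fixes f :: "nat \<Rightarrow> 'b"
  assumes "\<And>i. f (i + 7) = f i"
  shows "f k = f i \<or> f k = f (i + 1) \<or> f k = f (i + 2) \<or> f k = f (i + 3) \<or> f k = f (i + 4) \<or> f k = f (i + 5) \<or> f k = f (i + 6)"
proof -
  obtain j where j: "j < 7" "f k = f (i + j)" using period_index[of f 7 k i] assms by auto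
  then have "j = 0 \<or> j = 1 \<or> j = 2 \<or> j = 3 \<or> j = 4 \<or> j = 5 \<or> j = 6" by linarith
  with j(2) show ?thesis by auto
qed

section \<open>Recoloring\<close>

text \<open>Adjacency is fixed on the whole type and a graph is a vertex set \<open>V\<close>, so
  that induced subgraphs are subsets and the induction over smaller graphs runs over
  subsets.\<close>

locale sgraph =
  fixes E :: "'a \<Rightarrow> 'a \<Rightarrow> bool"
  assumes sym: "E u v \<Longrightarrow> E v u"
    and irrefl: "\<not> E u u"
begin

lemma sym_iff: "E u v \<longleftrightarrow> E v u"
  using sym by blast

text \<open>The colors form an arbitrary set \<open>K\<close> instead of an interval because the
  arguments below delete colors from it.\<close>

definition proper :: "'a set \<Rightarrow> nat set \<Rightarrow> ('a \<Rightarrow> nat) \<Rightarrow> bool" where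
  "proper V K f \<longleftrightarrow> (\<forall>v\<in>V. f v \<in> K) \<and> (\<forall>u\<in>V. \<forall>v\<in>V. E u v \<longrightarrow> f u \<noteq> f v)"

text \<open>Colorings are not extensional here, so a step may also change values outside \<open>V\<close>.\<close>

definition step :: "'a set \<Rightarrow> nat set \<Rightarrow> ('a \<Rightarrow> nat) \<Rightarrow> ('a \<Rightarrow> nat) \<Rightarrow> bool" where
  "step V K f g \<longleftrightarrow> proper V K f \<and> proper V K g \<and> (\<exists>v. \<forall>u\<in>V - {v}. f u = g u)"

abbreviation reach :: "'a set \<Rightarrow> nat set \<Rightarrow> ('a \<Rightarrow> nat) \<Rightarrow> ('a \<Rightarrow> nat) \<Rightarrow> bool" where
  "reach V K \<equiv> (step V K)\<^sup>*\<^sup>*"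

definition mixing :: "'a set \<Rightarrow> nat set \<Rightarrow> bool" where
  "mixing V K \<longleftrightarrow> (\<forall>f g. proper V K f \<longrightarrow> proper V K g \<longrightarrow> reach V K f g)"

definition colorable :: "'a set \<Rightarrow> nat \<Rightarrow> bool" where
  "colorable V n \<longleftrightarrow> (\<exists>f. proper V {..<n} f)"

text \<open>Any \<open>n\<close> with \<open>colorable V n\<close> stands in for the chromatic
  number: the least such \<open>n\<close> gives the usual condition, and that implies the condition
  for the others.\<close>

definition recolorable_on :: "'a set \<Rightarrow> bool" where
  "recolorable_on V \<longleftrightarrow> (\<forall>n K. colorable V n \<longrightarrow> finite K \<longrightarrow> n < card K \<longrightarrow> mixing V K)"

definition maxind :: "'a set \<Rightarrow> 'a set \<Rightarrow> bool" where
  "maxind V S \<longleftrightarrow> S \<subseteq> V \<and> (\<forall>u\<in>S. \<forall>v\<in>S. \<not> E u v) \<and> (\<forall>v\<in>V - S. \<exists>s\<in>S. E s v)"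

definition incomparable :: "'a set \<Rightarrow> bool" where
  "incomparable V \<longleftrightarrow> (\<forall>u\<in>V. \<forall>v\<in>V. u \<noteq> v \<longrightarrow> (\<exists>x\<in>V. E u x \<and> \<not> E v x))"

lemma step_sym: "step V K f g \<Longrightarrow> step V K g f"
  unfolding step_def by metis

lemma reach_sym: "reach V K f g \<Longrightarrow> reach V K g f"
  by (induction rule: rtranclp_induct) (auto intro: converse_rtranclp_into_rtranclp dest: step_sym)

lemma reach_proper: "reach V K f g \<Longrightarrow> proper V K f \<Longrightarrow> proper V K g"
  by (induction rule: rtranclp_induct) (auto simp: step_def)

lemma proper_mono: "proper V K f \<Longrightarrow> U \<subseteq> V \<Longrightarrow> K \<subseteq> L \<Longrightarrow> proper U L f"
  unfolding proper_def by blast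

lemma proper_cong: "proper V K f \<Longrightarrow> (\<And>v. v \<in> V \<Longrightarrow> f v = g v) \<Longrightarrow> proper V K g"
  unfolding proper_def by force

lemma colorable_mono: "colorable V m \<Longrightarrow> U \<subseteq> V \<Longrightarrow> m \<le> n \<Longrightarrow> colorable U n"
  unfolding colorable_def by (meson lessThan_subset_iff proper_mono)

lemma proper_comp:
  assumes "proper V K f" "inj_on h K" "h ` K \<subseteq> L"
  shows "proper V L (h \<circ> f)"
  using assms unfolding proper_def by (auto dest: inj_onD)

lemma colorable_proper:
  assumes "colorable V n" "finite K" "n \<le> card K"
  obtains f where "proper V K f"
proof -
  obtain f where f: "proper V {..<n} f" using assms(1) colorable_def by blast
  obtain h where "inj_on h {..<n}" "h ` {..<n} \<subseteq> K"
    using card_le_inj[of "{..<n}" K] assms(2,3) by auto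
  with f that show thesis using proper_comp by blast
qed

lemma proper_colorable:
  assumes "proper V K f" "finite K" "card K \<le> n"
  shows "colorable V n"
proof -
  obtain h where "inj_on h K" "h ` K \<subseteq> {..<n}"
    using card_le_inj[of K "{..<n}"] assms(2,3) by auto
  with proper_comp[OF assms(1)] show ?thesis unfolding colorable_def by meson
qed

section \<open>Changing one vertex and deleting a dominated vertex\<close>

lemma proper_update:
  assumes "proper (V - {u}) K f" "z \<in> K" "\<And>x. x \<in> V \<Longrightarrow> E u x \<Longrightarrow> f x \<noteq> z"
  shows "proper V K (f(u := z))"
proof -
  have "(f(u := z)) a \<noteq> (f(u := z)) b" if "a \<in> V" "b \<in> V" "E a b" for a b
  proof -
    have "a \<noteq> b" using that irrefl by blast
    with that assms(1) assms(3)[of a] assms(3)[of b] sym[of a b] show ?thesis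
      unfolding proper_def by auto
  qed
  with assms show ?thesis unfolding proper_def by auto
qed

lemma proper_comparable:
  assumes "u \<in> V" "v \<in> V" "u \<noteq> v" "\<And>x. x \<in> V \<Longrightarrow> E u x \<Longrightarrow> E v x" "proper (V - {u}) K f"
  shows "proper V K (f(u := f v))"
proof (rule proper_update[OF assms(5)])
  show "f v \<in> K" using assms unfolding proper_def by auto
  fix x assume x: "x \<in> V" "E u x"
  then have "x \<noteq> u" "E v x" using assms(4) irrefl by blast+
  with x show "f x \<noteq> f v"
    using assms(2,3,5) unfolding proper_def by (metis DiffI empty_iff insert_iff)
qed

text \<open>A coloring of \<open>V - {u}\<close> lifts by letting \<open>u\<close> copy
  \<open>v\<close>, and every coloring of \<open>V\<close> is one step away from the lift of its
  restriction. A path between the restrictions therefore lifts, a move of \<open>v\<close> turning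
  into two moves.\<close>

lemma recol_comparable:
  assumes "u \<in> V" "v \<in> V" "u \<noteq> v" "\<And>x. x \<in> V \<Longrightarrow> E u x \<Longrightarrow> E v x" "recolorable_on (V - {u})"
  shows "recolorable_on V"
  unfolding recolorable_on_def
proof (intro allI impI)
  fix n K assume "colorable V n" "finite (K::nat set)" "n < card K"
  then have m: "mixing (V - {u}) K"
    using assms(5) colorable_mono[of V n "V - {u}" n] unfolding recolorable_on_def by auto
  have nu: "x \<noteq> u" "x \<noteq> v" if "E u x" "x \<in> V" for x
    using that assms(2,4) irrefl by blast+
  have lift: "proper V K (f(u := f v))" if "proper (V - {u}) K f" for f
    using proper_comparable[OF assms(1-3) _ that] assms(4) by blast
  have lift_step: "reach V K (f(u := f v)) (g(u := g v))" if fg: "step (V - {u}) K f g" for f g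
  proof -
    from fg obtain w where w: "\<forall>x\<in>V - {u} - {w}. f x = g x"
      and p: "proper (V - {u}) K f" "proper (V - {u}) K g"
      unfolding step_def by blast
    \<comment> \<open>Here \<open>u\<close> moves first. If \<open>v\<close> is the vertex that
      changes, the neighbours of \<open>u\<close> are neighbours of \<open>v\<close>, hence
      unchanged by the step, and properness of \<open>g\<close> keeps them away from
      \<open>g v\<close>.\<close>
    have mid: "proper V K (f(u := g v))"
    proof (cases "w = v")
      case True
      show ?thesis
      proof (rule proper_update[OF p(1)])
        show "g v \<in> K" using p(2) assms(2,3) unfolding proper_def by auto
        fix x assume x: "x \<in> V" "E u x"
        then have "f x = g x" using w True nu by auto
        with x nu[of x] p(2) assms(2-4) show "f x \<noteq> g v"
          unfolding proper_def by (metis DiffI empty_iff insert_iff)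
      qed
    next
      case False
      then have "f v = g v" using w assms(2,3) by auto
      then show ?thesis using lift[OF p(1)] by simp
    qed
    have "step V K (f(u := f v)) (f(u := g v))"
      using lift[OF p(1)] mid unfolding step_def by auto
    moreover have "step V K (f(u := g v)) (g(u := g v))"
      using lift[OF p(2)] mid w unfolding step_def by auto
    ultimately show ?thesis by simp
  qed
  have lift_reach: "reach V K (f(u := f v)) (g(u := g v))" if "reach (V - {u}) K f g" for f g
    using that
  proof (induction rule: rtranclp_induct)
    case (step g h)
    then show ?case using lift_step[of g h] rtranclp_trans[of "step V K"] by blast
  qed simp
  have to_lift: "step V K f (f(u := f v))" if "proper V K f" for f
    using that lift[of f] proper_mono[of V K f "V - {u}" K] unfolding step_def by auto
  show "mixing V K" unfolding mixing_def
  proof (intro allI impI)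
    fix f g assume f: "proper V K f" and g: "proper V K g"
    then have "reach (V - {u}) K f g"
      using m proper_mono[of V K _ "V - {u}" K] unfolding mixing_def by blast
    then show "reach V K f g"
      using lift_reach to_lift[OF f] step_sym[OF to_lift[OF g]]
      by (meson converse_rtranclp_into_rtranclp rtranclp.rtrancl_into_rtrancl)
  qed
qed

text \<open>The vertices of \<open>S\<close> take the color \<open>z\<close> one at a time. No
  neighbour of \<open>S\<close> lies in \<open>S\<close> or has color \<open>z\<close>, so every
  intermediate coloring is proper.\<close>

lemma reach_recolor_set:
  assumes "finite S" "proper V K f" "z \<in> K"
    and "\<And>u v. u \<in> S \<Longrightarrow> v \<in> V \<Longrightarrow> E u v \<Longrightarrow> v \<notin> S \<and> f v \<noteq> z"
  shows "reach V K f (\<lambda>v. if v \<in> S then z else f v)"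
  using assms(1,4)
proof (induction S rule: finite_induct)
  case (insert x T)
  let ?g = "\<lambda>v. if v \<in> T then z else f v"
  have r: "reach V K f ?g" using insert by blast
  have g: "proper V K ?g" using reach_proper[OF r assms(2)] .
  have "proper V K (?g(x := z))"
  proof (rule proper_update[OF _ assms(3)])
    show "proper (V - {x}) K ?g" using proper_mono[OF g] by blast
    show "?g y \<noteq> z" if "y \<in> V" "E x y" for y
      using insert.prems[of x y] that by auto
  qed
  moreover have "?g(x := z) = (\<lambda>v. if v \<in> insert x T then z else f v)" by auto
  ultimately have "step V K ?g (\<lambda>v. if v \<in> insert x T then z else f v)"
    using g unfolding step_def by auto
  with r show ?case by simp
next
  case empty
  have "(\<lambda>v. if v \<in> {} then z else f v) = f" by auto
  then show ?case by (metis rtranclp.rtrancl_refl)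
qed


section \<open>Maximal independent sets as color classes\<close>

lemma maxind_extend:
  assumes "finite V" "T \<subseteq> V" "\<And>u v. u \<in> T \<Longrightarrow> v \<in> T \<Longrightarrow> \<not> E u v"
  obtains S where "maxind V S" "T \<subseteq> S"
proof -
  define A where "A = {S. T \<subseteq> S \<and> S \<subseteq> V \<and> (\<forall>u\<in>S. \<forall>v\<in>S. \<not> E u v)}"
  have fin: "finite A" unfolding A_def using assms(1) by (auto intro: finite_subset[of _ "Pow V"])
  have T: "T \<in> A" unfolding A_def using assms by auto
  obtain S where SA: "S \<in> A" and max: "\<And>R. R \<in> A \<Longrightarrow> S \<subseteq> R \<Longrightarrow> S = R"
    using finite_has_maximal2[OF fin T] by metis
  have S: "T \<subseteq> S" "S \<subseteq> V" "\<forall>u\<in>S. \<forall>v\<in>S. \<not> E u v" using SA unfolding A_def by blast+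
  have "\<exists>s\<in>S. E s v" if v: "v \<in> V - S" for v
  proof (rule ccontr)
    assume "\<not> (\<exists>s\<in>S. E s v)"
    then have "insert v S \<in> A" unfolding A_def using S v irrefl sym by blast
    then show False using max v by blast
  qed
  with S have "maxind V S" unfolding maxind_def by blast
  with S that show thesis by blast
qed

text \<open>\<open>S\<close> contains every vertex colored \<open>f v\<close>, so no neighbour of
  \<open>S\<close> carries that color and \<open>S\<close> can be recolored vertex by
  vertex.\<close>

lemma extend_class:
  assumes "finite V" "proper V K f" "v \<in> V"
  obtains g S where "reach V K f g" "maxind V S" "{u \<in> V. f u = f v} \<subseteq> S" "\<And>s. s \<in> S \<Longrightarrow> g s = f v"
proof -
  let ?T = "{u \<in> V. f u = f v}"
  have "\<not> E a b" if "a \<in> ?T" "b \<in> ?T" for a b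
    using that assms(2) unfolding proper_def by force
  then obtain S where S: "maxind V S" "?T \<subseteq> S"
    using maxind_extend[of V ?T] assms(1) by blast
  have "reach V K f (\<lambda>u. if u \<in> S then f v else f u)"
  proof (rule reach_recolor_set[OF _ assms(2)])
    show "finite S" using S(1) assms(1) finite_subset unfolding maxind_def by blast
    show "f v \<in> K" using assms(2,3) unfolding proper_def by blast
    show "w \<notin> S \<and> f w \<noteq> f v" if "u \<in> S" "w \<in> V" "E u w" for u w
      using that S unfolding maxind_def by blast
  qed
  from that[OF this S] show thesis by simp
qed

lemma reach_join:
  assumes "maxind V S" "reach (V - S) (K - {x}) f g" "x \<in> K" "proper (V - S) (K - {x}) f"
  shows "reach V K (\<lambda>v. if v \<in> S then x else f v) (\<lambda>v. if v \<in> S then x else g v)"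
proof -
  have lift: "proper V K (\<lambda>v. if v \<in> S then x else h v)" if "proper (V - S) (K - {x}) h" for h
    using that assms(1,3) unfolding proper_def maxind_def by auto
  from assms(2) show ?thesis
  proof (induction rule: rtranclp_induct)
    case (step g h)
    then have "proper (V - S) (K - {x}) g" "proper (V - S) (K - {x}) h"
      and "\<exists>v. \<forall>u\<in>V - S - {v}. g u = h u" unfolding step_def by blast+
    then have "step V K (\<lambda>v. if v \<in> S then x else g v) (\<lambda>v. if v \<in> S then x else h v)"
      using lift[of g] lift[of h] unfolding step_def by auto
    with step.IH show ?case by simp
  qed simp
qed

text \<open>Both colorings are led to one coloring \<open>e\<close> of \<open>V - S\<close> that
  avoids \<open>x\<close> and \<open>y\<close>; at least \<open>n\<close> colors are left for it.
  While \<open>S\<close> stays frozen in its color, the rest moves with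
  \<open>card K - 1 > n\<close> colors, where recolorability of \<open>V - S\<close> applies.
  Finally \<open>S\<close> switches from \<open>x\<close> to \<open>y\<close>, which
  \<open>e\<close> leaves free.\<close>

lemma reach_mono_class:
  assumes "finite V" "maxind V S" "S \<noteq> {}" "recolorable_on (V - S)" "colorable (V - S) n"
    and "finite K" "n + 2 \<le> card K" "proper V K f" "proper V K g"
    and "\<And>s. s \<in> S \<Longrightarrow> f s = x" "\<And>s. s \<in> S \<Longrightarrow> g s = y"
  shows "reach V K f g"
proof -
  have xy: "x \<in> K" "y \<in> K"
    using assms(2,3,8-11) unfolding maxind_def proper_def by (metis ex_in_conv subsetD)+
  have "card K \<le> card (K - {x, y}) + card {x, y}"
    using assms(6) by (metis card_Un_le diff_card_le_card_Diff finite.emptyI finite_insert le_diff_conv)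
  moreover have "card {x, y} \<le> 2" by (simp add: card_insert_if)
  ultimately have "n \<le> card (K - {x, y})" using assms(7) by linarith
  then obtain e where e: "proper (V - S) (K - {x, y}) e"
    using colorable_proper[OF assms(5), of "K - {x, y}"] assms(6) by auto
  have main: "reach V K h (\<lambda>v. if v \<in> S then z else e v)"
    if h: "proper V K h" "\<And>s. s \<in> S \<Longrightarrow> h s = z" and z: "z \<in> {x, y}" for h z
  proof -
    have z: "z \<in> K" "K - {x, y} \<subseteq> K - {z}" using z xy by auto
    have "n < card (K - {z})" using z assms(6,7) by (simp add: card_Diff_singleton)
    then have "mixing (V - S) (K - {z})"
      using assms(4-6) unfolding recolorable_on_def by blast
    moreover have pe: "proper (V - S) (K - {z}) e" using proper_mono[OF e _ z(2)] by blast
    \<comment> \<open>By maximality every vertex outside \<open>S\<close> has a neighbour in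
      \<open>S\<close>, so \<open>h\<close> avoids the color \<open>z\<close> there.\<close>
    moreover have ph: "proper (V - S) (K - {z}) h"
      unfolding proper_def
    proof (intro conjI ballI impI)
      fix v assume v: "v \<in> V - S"
      then obtain s where "s \<in> S" "E s v" using assms(2) unfolding maxind_def by blast
      then show "h v \<in> K - {z}"
        using h v assms(2) unfolding proper_def maxind_def by (metis DiffD1 DiffI singletonD subsetD)
    qed (use h in \<open>auto simp: proper_def\<close>)
    ultimately have "reach (V - S) (K - {z}) h e" unfolding mixing_def by blast
    from reach_join[OF assms(2) this z(1) ph]
    have "reach V K (\<lambda>v. if v \<in> S then z else h v) (\<lambda>v. if v \<in> S then z else e v)" .
    moreover have "(\<lambda>v. if v \<in> S then z else h v) = h" using h(2) by auto
    ultimately show ?thesis by simp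
  qed
  let ?e = "\<lambda>z v. if v \<in> S then z else e v"
  have f: "reach V K f (?e x)" and g: "reach V K g (?e y)"
    using main[of f x] main[of g y] assms(8-11) by auto
  have "reach V K (?e x) (\<lambda>v. if v \<in> S then y else ?e x v)"
  proof (rule reach_recolor_set)
    show "finite S" using assms(1,2) finite_subset unfolding maxind_def by blast
    show "proper V K (?e x)" using reach_proper[OF f assms(8)] .
    show "y \<in> K" by (fact xy)
    show "w \<notin> S \<and> ?e x w \<noteq> y" if "u \<in> S" "w \<in> V" "E u w" for u w
      using that assms(2) e unfolding maxind_def proper_def by auto
  qed
  moreover have "(\<lambda>v. if v \<in> S then y else ?e x v) = ?e y" by auto
  ultimately have "reach V K (?e x) (?e y)" by simp
  with f reach_sym[OF g] show ?thesis by (meson rtranclp_trans)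
qed

text \<open>One target \<open>h\<close>, omitting a color \<open>z\<close>, serves all colorings
  although \<open>S\<close> depends on \<open>f\<close>: whichever \<open>S\<close> turns up,
  \<open>h\<close> can repaint it with \<open>z\<close> and is then joined to \<open>g\<close> by
  \<open>reach_mono_class\<close>. The bound \<open>n + 2 \<le> card K\<close> expresses that
  \<open>K\<close> has more colors than the chromatic number, which itself exceeds
  \<open>n\<close>.\<close>

lemma recol_if_good_class:
  assumes "finite V" "\<And>U. U \<subset> V \<Longrightarrow> recolorable_on U" "\<not> colorable V n"
    and "\<And>K f. finite K \<Longrightarrow> n + 2 \<le> card K \<Longrightarrow> proper V K f \<Longrightarrow>
      \<exists>g S x. reach V K f g \<and> maxind V S \<and> S \<noteq> {} \<and> (\<forall>s\<in>S. g s = x) \<and> colorable (V - S) (card K - 2)"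
  shows "recolorable_on V"
  unfolding recolorable_on_def
proof (intro allI impI)
  fix m and K :: "nat set" assume m: "colorable V m" "m < card K" and K: "finite K"
  have "n < m" using m(1) assms(3) colorable_mono[of V m V n] by (meson leI order_refl)
  then have nK: "n + 2 \<le> card K" using m by simp
  obtain z where z: "z \<in> K" using m by (metis card.empty ex_in_conv less_zeroE)
  then obtain h where h: "proper V (K - {z}) h"
    using colorable_proper[OF m(1), of "K - {z}"] K m(2) z
    by (metis card_Diff_singleton finite_Diff less_imp_Suc_add diff_Suc_1 le_add1)
  have hK: "proper V K h" using proper_mono[OF h] by auto
  have "reach V K f h" if f: "proper V K f" for f
  proof -
    obtain g S x where g: "reach V K f g" "maxind V S" "S \<noteq> {}" "\<And>s. s \<in> S \<Longrightarrow> g s = x"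
      and c: "colorable (V - S) (card K - 2)"
      using assms(4)[OF K nK f] by blast
    let ?h = "\<lambda>v. if v \<in> S then z else h v"
    have r: "reach V K h ?h"
    proof (rule reach_recolor_set[OF _ hK z])
      show "finite S" using assms(1) g(2) finite_subset unfolding maxind_def by blast
      show "w \<notin> S \<and> h w \<noteq> z" if "u \<in> S" "w \<in> V" "E u w" for u w
        using that g(2) h unfolding maxind_def proper_def by auto
    qed
    have "recolorable_on (V - S)" using assms(2) g(2,3) unfolding maxind_def by blast
    then have "reach V K g ?h"
      using reach_mono_class[OF assms(1) g(2,3) _ c K _ reach_proper[OF g(1) f] reach_proper[OF r hK] g(4), of z] nK
      by auto
    with g(1) reach_sym[OF r] show ?thesis by (meson rtranclp_trans)
  qed
  then show "mixing V K" unfolding mixing_def by (meson reach_sym rtranclp_trans)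
qed

text \<open>The color class of \<open>v\<close> grows to some maximal independent set through
  \<open>v\<close>. As all of these are good, the coloring needs no preparation.\<close>

lemma recol_if_good_vertex:
  assumes "finite V" "\<And>U. U \<subset> V \<Longrightarrow> recolorable_on U" "\<not> colorable V n" "v \<in> V"
    and "\<And>S. maxind V S \<Longrightarrow> v \<in> S \<Longrightarrow> colorable (V - S) n"
  shows "recolorable_on V"
proof (rule recol_if_good_class[OF assms(1-3)])
  fix K f assume K: "finite K" "n + 2 \<le> card K" and f: "proper V K f"
  obtain g S where g: "reach V K f g" "maxind V S" "{u \<in> V. f u = f v} \<subseteq> S" "\<And>s. s \<in> S \<Longrightarrow> g s = f v"
    using extend_class[OF assms(1) f assms(4)] by blast
  then have "v \<in> S" using assms(4) by auto
  moreover have "colorable (V - S) (card K - 2)"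
    using colorable_mono[OF assms(5)[OF g(2) \<open>v \<in> S\<close>], of "V - S"] K(2) by auto
  ultimately show "\<exists>g S x. reach V K f g \<and> maxind V S \<and> S \<noteq> {} \<and> (\<forall>s\<in>S. g s = x) \<and>
      colorable (V - S) (card K - 2)"
    using g by blast
qed

end

section \<open>Graphs containing an induced 5-cycle\<close>

context sgraph begin

definition indep :: "'a set \<Rightarrow> bool" where
  "indep S \<longleftrightarrow> (\<forall>u\<in>S. \<forall>v\<in>S. \<not> E u v)"

text \<open>Two edges with a common end satisfy the conclusion by symmetry, so only disjoint edges
  are constrained.\<close>

definition two_K2_free :: "'a set \<Rightarrow> bool" where
  "two_K2_free V \<longleftrightarrow>
     (\<forall>a\<in>V. \<forall>b\<in>V. \<forall>c\<in>V. \<forall>d\<in>V. E a b \<longrightarrow> E c d \<longrightarrow> E a c \<or> E a d \<or> E b c \<or> E b d)"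

definition K4_free :: "'a set \<Rightarrow> bool" where
  "K4_free V \<longleftrightarrow>
     (\<forall>a\<in>V. \<forall>b\<in>V. \<forall>c\<in>V. \<forall>d\<in>V. \<not> (E a b \<and> E a c \<and> E a d \<and> E b c \<and> E b d \<and> E c d))"

text \<open>Cycles are functions of period 5, so that indices need not be reduced.\<close>

definition C5 :: "'a set \<Rightarrow> (nat \<Rightarrow> 'a) \<Rightarrow> bool" where
  "C5 V c \<longleftrightarrow> (\<forall>i. c i \<in> V \<and> c (i + 5) = c i \<and> E (c i) (c (i + 1)) \<and> \<not> E (c i) (c (i + 2)))"

text \<open>The cycle vertex \<open>c 0\<close> itself sees exactly \<open>c 1\<close> and
  \<open>c 4\<close>, so \<open>u\<close> is kept off the cycle explicitly. The patterns in the next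
  two definitions cannot be those of a cycle vertex.\<close>

definition H2_free :: "'a set \<Rightarrow> bool" where
  "H2_free V \<longleftrightarrow> (\<forall>c u. C5 V c \<longrightarrow> u \<in> V \<longrightarrow> u \<notin> range c \<longrightarrow>
     \<not> (\<not> E u (c 0) \<and> E u (c 1) \<and> \<not> E u (c 2) \<and> \<not> E u (c 3) \<and> E u (c 4)))"

definition H3_free :: "'a set \<Rightarrow> bool" where
  "H3_free V \<longleftrightarrow> (\<forall>c u. C5 V c \<longrightarrow> u \<in> V \<longrightarrow>
     \<not> (E u (c 0) \<and> \<not> E u (c 1) \<and> E u (c 2) \<and> E u (c 3) \<and> \<not> E u (c 4)))"

definition H4_free :: "'a set \<Rightarrow> bool" where
  "H4_free V \<longleftrightarrow> (\<forall>c u. C5 V c \<longrightarrow> u \<in> V \<longrightarrow>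
     \<not> (\<not> E u (c 0) \<and> E u (c 1) \<and> E u (c 2) \<and> E u (c 3) \<and> E u (c 4)))"

lemma two_K2D:
  "two_K2_free V \<Longrightarrow> a \<in> V \<Longrightarrow> b \<in> V \<Longrightarrow> c \<in> V \<Longrightarrow> d \<in> V \<Longrightarrow> E a b \<Longrightarrow> E c d \<Longrightarrow>
   E a c \<or> E a d \<or> E b c \<or> E b d"
  unfolding two_K2_free_def by blast

lemma K4D:
  "K4_free V \<Longrightarrow> a \<in> V \<Longrightarrow> b \<in> V \<Longrightarrow> c \<in> V \<Longrightarrow> d \<in> V \<Longrightarrow>
   E a b \<Longrightarrow> E a c \<Longrightarrow> E a d \<Longrightarrow> E b c \<Longrightarrow> E b d \<Longrightarrow> E c d \<Longrightarrow> False"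
  unfolding K4_free_def by blast

lemma H2D:
  "H2_free V \<Longrightarrow> C5 V c \<Longrightarrow> u \<in> V \<Longrightarrow> u \<notin> range c \<Longrightarrow>
     \<not> (\<not> E u (c 0) \<and> E u (c 1) \<and> \<not> E u (c 2) \<and> \<not> E u (c 3) \<and> E u (c 4))"
  unfolding H2_free_def by blast

lemma H3D:
  "H3_free V \<Longrightarrow> C5 V c \<Longrightarrow> u \<in> V \<Longrightarrow>
     \<not> (E u (c 0) \<and> \<not> E u (c 1) \<and> E u (c 2) \<and> E u (c 3) \<and> \<not> E u (c 4))"
  unfolding H3_free_def by blast

lemma H4D:
  "H4_free V \<Longrightarrow> C5 V c \<Longrightarrow> u \<in> V \<Longrightarrow>
     \<not> (\<not> E u (c 0) \<and> E u (c 1) \<and> E u (c 2) \<and> E u (c 3) \<and> E u (c 4))"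
  unfolding H4_free_def by blast

lemma C5_shift:
  assumes "C5 V c" shows "C5 V (\<lambda>n. c (i + n))"
proof -
  have "c (i + (n + 5)) = c (i + n)" "E (c (i + n)) (c (i + (n + 1)))"
    "\<not> E (c (i + n)) (c (i + (n + 2)))" "c (i + n) \<in> V" for n
    using assms unfolding C5_def by (metis add.assoc)+
  then show ?thesis unfolding C5_def by blast
qed

lemma C5I:
  assumes "{a, b, c, d, e} \<subseteq> V" "E a b" "E b c" "E c d" "E d e" "E e a"
    and "\<not> E a c" "\<not> E b d" "\<not> E c e" "\<not> E d a" "\<not> E e b"
  obtains f where "C5 V f" "f 0 = a" "f 1 = b" "f 2 = c" "f 3 = d" "f 4 = e"
proof
  let ?f = "\<lambda>n::nat. if n mod 5 = 0 then a else if n mod 5 = 1 then b else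
    if n mod 5 = 2 then c else if n mod 5 = 3 then d else e"
  show "C5 V ?f" unfolding C5_def
  proof
    fix i :: nat
    have "(i + 1) mod 5 = (if i mod 5 = 4 then 0 else i mod 5 + 1)"
      "(i + 2) mod 5 = (if i mod 5 = 4 then 1 else if i mod 5 = 3 then 0 else i mod 5 + 2)"
      "(i + 5) mod 5 = i mod 5" by presburger+
    note * = this
    have "i mod 5 = 0 \<or> i mod 5 = 1 \<or> i mod 5 = 2 \<or> i mod 5 = 3 \<or> i mod 5 = 4" by presburger
    then show "?f i \<in> V \<and> ?f (i + 5) = ?f i \<and> E (?f i) (?f (i + 1)) \<and> \<not> E (?f i) (?f (i + 2))"
      unfolding * using assms by (elim disjE) simp_all
  qed
qed simp_all

lemma incomparableD:
  "incomparable V \<Longrightarrow> u \<in> V \<Longrightarrow> v \<in> V \<Longrightarrow> u \<noteq> v \<Longrightarrow> \<exists>x\<in>V. E u x \<and> \<not> E v x"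
  unfolding incomparable_def by blast

lemma colorable_3I:
  assumes "V \<subseteq> X \<union> Y \<union> Z" "indep X" "indep Y" "indep Z"
  shows "colorable V 3"
proof -
  let ?f = "\<lambda>v. if v \<in> X then 0 else if v \<in> Y then 1 else 2 :: nat"
  have "?f u \<noteq> ?f v" if "u \<in> V" "v \<in> V" "E u v" for u v
  proof -
    have "u \<in> X \<or> u \<in> Y \<or> u \<in> Z" "v \<in> X \<or> v \<in> Y \<or> v \<in> Z" using that assms(1) by blast+
    moreover have "\<not> (u \<in> X \<and> v \<in> X)" "\<not> (u \<in> Y \<and> v \<in> Y)" "\<not> (u \<in> Z \<and> v \<in> Z)"
      using that assms(2-4) unfolding indep_def by blast+
    ultimately show ?thesis by auto
  qed
  then have "proper V {..<3} ?f" unfolding proper_def by simp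
  then show ?thesis unfolding colorable_def by blast
qed

lemma colorable_2I:
  assumes "V \<subseteq> X \<union> Y" "indep X" "indep Y"
  shows "colorable V 2"
proof -
  let ?f = "\<lambda>v. if v \<in> X then 0 else 1 :: nat"
  have "?f u \<noteq> ?f v" if "u \<in> V" "v \<in> V" "E u v" for u v
  proof -
    have "u \<in> X \<or> u \<in> Y" "v \<in> X \<or> v \<in> Y" using that assms(1) by blast+
    moreover have "\<not> (u \<in> X \<and> v \<in> X)" "\<not> (u \<in> Y \<and> v \<in> Y)"
      using that assms(2-3) unfolding indep_def by blast+
    ultimately show ?thesis by auto
  qed
  then have "proper V {..<2} ?f" unfolding proper_def by simp
  then show ?thesis unfolding colorable_def by blast
qed

end

section \<open>How a vertex attaches to an induced 5-cycle\<close>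

locale induced_C5 = sgraph +
  fixes V :: "'a set" and c :: "nat \<Rightarrow> 'a"
  assumes C5: "C5 V c"
begin

lemma cV [simp]: "c i \<in> V"
  using C5 unfolding C5_def by blast

lemma c_period: "c (i + 5) = c i"
  using C5 unfolding C5_def by blast

lemmas c_wrap = period5_wrap[of c, OF c_period]

lemma c_adj:
  "E (c i) (c (i + 1))" "E (c (i + 1)) (c (i + 2))" "E (c (i + 2)) (c (i + 3))"
  "E (c (i + 3)) (c (i + 4))" "E (c (i + 4)) (c i)"
  "E (c (i + 1)) (c i)" "E (c (i + 2)) (c (i + 1))" "E (c (i + 3)) (c (i + 2))"
  "E (c (i + 4)) (c (i + 3))" "E (c i) (c (i + 4))"
  and c_nonadj:
  "\<not> E (c i) (c (i + 2))" "\<not> E (c (i + 1)) (c (i + 3))" "\<not> E (c (i + 2)) (c (i + 4))"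
  "\<not> E (c (i + 3)) (c i)" "\<not> E (c (i + 4)) (c (i + 1))"
  "\<not> E (c (i + 2)) (c i)" "\<not> E (c (i + 3)) (c (i + 1))" "\<not> E (c (i + 4)) (c (i + 2))"
  "\<not> E (c i) (c (i + 3))" "\<not> E (c (i + 1)) (c (i + 4))"
proof -
  have "E (c j) (c (j + 1))" "\<not> E (c j) (c (j + 2))" for j
    using C5 unfolding C5_def by blast+
  note * = this[of i] this[of "i + 1"] this[of "i + 2"] this[of "i + 3"] this[of "i + 4"]
  show "E (c i) (c (i + 1))" "E (c (i + 1)) (c (i + 2))" "E (c (i + 2)) (c (i + 3))"
    "E (c (i + 3)) (c (i + 4))" "E (c (i + 4)) (c i)"
    "E (c (i + 1)) (c i)" "E (c (i + 2)) (c (i + 1))" "E (c (i + 3)) (c (i + 2))"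
    "E (c (i + 4)) (c (i + 3))" "E (c i) (c (i + 4))"
    "\<not> E (c i) (c (i + 2))" "\<not> E (c (i + 1)) (c (i + 3))" "\<not> E (c (i + 2)) (c (i + 4))"
    "\<not> E (c (i + 3)) (c i)" "\<not> E (c (i + 4)) (c (i + 1))"
    "\<not> E (c (i + 2)) (c i)" "\<not> E (c (i + 3)) (c (i + 1))" "\<not> E (c (i + 4)) (c (i + 2))"
    "\<not> E (c i) (c (i + 3))" "\<not> E (c (i + 1)) (c (i + 4))"
    using *[unfolded c_wrap] by (blast intro: sym dest: sym)+
qed

lemma c_index: "c k \<in> {c i, c (i + 1), c (i + 2), c (i + 3), c (i + 4)}"
  using period5_index[of c k i, OF c_period] by blast

lemma c_cases: "v \<in> range c \<longleftrightarrow> v = c i \<or> v = c (i + 1) \<or> v = c (i + 2) \<or> v = c (i + 3) \<or> v = c (i + 4)"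
  using c_index[of _ i] by auto

end

locale C5_graph = induced_C5 +
  assumes finV: "finite V" and two_K2: "two_K2_free V" and K4: "K4_free V"
    and incomp: "incomparable V" and IH: "\<And>U. U \<subset> V \<Longrightarrow> recolorable_on U"
begin

text \<open>The edge from \<open>c (i + 2)\<close> to \<open>c (i + 3)\<close> lies opposite to
  \<open>c i\<close>, which sees neither end. By \<open>2K_2\<close>-freeness it must be joined to
  the edge \<open>v c i\<close>, and this can happen only at \<open>v\<close>.\<close>

lemma edge_hit:
  assumes "v \<in> V" "E v (c i)"
  shows "E v (c (i + 2)) \<or> E v (c (i + 3))"
  using two_K2D[OF two_K2 assms(1) cV cV cV assms(2) c_adj(3)[of i]] c_nonadj[of i] by blast

lemma shift_free:
  shows "H2_free V \<Longrightarrow> u \<in> V \<Longrightarrow> u \<notin> range c \<Longrightarrow>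
     \<not> (\<not> E u (c i) \<and> E u (c (i + 1)) \<and> \<not> E u (c (i + 2)) \<and> \<not> E u (c (i + 3)) \<and> E u (c (i + 4)))"
    and "H3_free V \<Longrightarrow> u \<in> V \<Longrightarrow>
     \<not> (E u (c i) \<and> \<not> E u (c (i + 1)) \<and> E u (c (i + 2)) \<and> E u (c (i + 3)) \<and> \<not> E u (c (i + 4)))"
    and "H4_free V \<Longrightarrow> u \<in> V \<Longrightarrow>
     \<not> (\<not> E u (c i) \<and> E u (c (i + 1)) \<and> E u (c (i + 2)) \<and> E u (c (i + 3)) \<and> E u (c (i + 4)))"
proof -
  have r: "range (\<lambda>n. c (i + n)) \<subseteq> range c" by auto
  note sh = C5_shift[OF C5, of i]
  show "H2_free V \<Longrightarrow> u \<in> V \<Longrightarrow> u \<notin> range c \<Longrightarrow>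
     \<not> (\<not> E u (c i) \<and> E u (c (i + 1)) \<and> \<not> E u (c (i + 2)) \<and> \<not> E u (c (i + 3)) \<and> E u (c (i + 4)))"
    using H2D[OF _ sh, of u] r unfolding Nat.add_0_right by blast
  show "H3_free V \<Longrightarrow> u \<in> V \<Longrightarrow>
     \<not> (E u (c i) \<and> \<not> E u (c (i + 1)) \<and> E u (c (i + 2)) \<and> E u (c (i + 3)) \<and> \<not> E u (c (i + 4)))"
    using H3D[OF _ sh, of u] unfolding Nat.add_0_right by blast
  show "H4_free V \<Longrightarrow> u \<in> V \<Longrightarrow>
     \<not> (\<not> E u (c i) \<and> E u (c (i + 1)) \<and> E u (c (i + 2)) \<and> E u (c (i + 3)) \<and> E u (c (i + 4)))"
    using H4D[OF _ sh, of u] unfolding Nat.add_0_right by blast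
qed

definition A :: "'a set" where
  "A = {v \<in> V. \<not> E v (c 0) \<and> \<not> E v (c 1) \<and> \<not> E v (c 2) \<and> \<not> E v (c 3) \<and> \<not> E v (c 4)}"

definition W :: "'a set" where
  "W = {v \<in> V. E v (c 0) \<and> E v (c 1) \<and> E v (c 2) \<and> E v (c 3) \<and> E v (c 4)}"

lemma A_iff: "v \<in> A \<longleftrightarrow> v \<in> V \<and> (\<forall>i. \<not> E v (c i))"
proof -
  have "(\<forall>i. \<not> E v (c i)) \<longleftrightarrow> \<not> E v (c 0) \<and> \<not> E v (c 1) \<and> \<not> E v (c 2) \<and> \<not> E v (c 3) \<and> \<not> E v (c 4)"
    using c_index[of _ 0] unfolding add_0 by (metis insertE singletonD)
  then show ?thesis unfolding A_def by blast
qed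

lemma W_iff: "v \<in> W \<longleftrightarrow> v \<in> V \<and> (\<forall>i. E v (c i))"
proof -
  have "(\<forall>i. E v (c i)) \<longleftrightarrow> E v (c 0) \<and> E v (c 1) \<and> E v (c 2) \<and> E v (c 3) \<and> E v (c 4)"
    using c_index[of _ 0] unfolding add_0 by (metis insertE singletonD)
  then show ?thesis unfolding W_def by blast
qed

end

context C5_graph begin

text \<open>
  \<open>B2 i\<close>, \<open>B3 i\<close>, \<open>B4 i\<close> consist of the vertices attached to the cycle like \<open>u\<close> in \<open>H\<^sub>2\<close>, \<open>H\<^sub>3\<close>, \<open>H\<^sub>4\<close>
  for this \<open>i\<close>.  The cycle vertex \<open>c i\<close> itself has to be excluded from \<open>B2 i\<close> only.
\<close>

definition B2 :: "nat \<Rightarrow> 'a set" where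
  "B2 i = {v \<in> V. v \<noteq> c i \<and> \<not> E v (c i) \<and> E v (c (i + 1)) \<and> \<not> E v (c (i + 2)) \<and>
     \<not> E v (c (i + 3)) \<and> E v (c (i + 4))}"

definition B3 :: "nat \<Rightarrow> 'a set" where
  "B3 i = {v \<in> V. E v (c i) \<and> \<not> E v (c (i + 1)) \<and> E v (c (i + 2)) \<and>
     E v (c (i + 3)) \<and> \<not> E v (c (i + 4))}"

definition B4 :: "nat \<Rightarrow> 'a set" where
  "B4 i = {v \<in> V. \<not> E v (c i) \<and> E v (c (i + 1)) \<and> E v (c (i + 2)) \<and>
     E v (c (i + 3)) \<and> E v (c (i + 4))}"

lemma B_period: "B2 (i + 5) = B2 i" "B3 (i + 5) = B3 i" "B4 (i + 5) = B4 i"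
proof -
  have "c (i + 5 + k) = c (i + k)" for k
  proof -
    have "i + 5 + k = i + k + 5" by simp
    then show ?thesis using c_period[of "i + k"] by metis
  qed
  then show "B2 (i + 5) = B2 i" "B3 (i + 5) = B3 i" "B4 (i + 5) = B4 i"
    unfolding B2_def B3_def B4_def by (simp_all only: c_period)
qed

lemmas B3_wrap = period5_wrap[of B3, OF B_period(2)]
lemmas B4_wrap = period5_wrap[of B4, OF B_period(3)]
lemmas B2_index = period5_index[of B2, OF B_period(1)]
lemmas B3_index = period5_index[of B3, OF B_period(2)]
lemmas B4_index = period5_index[of B4, OF B_period(3)]

text \<open>\<open>edge_hit\<close> requires every neighbour on the cycle to have another one at
  distance two. This excludes a single neighbour, two consecutive and three consecutive ones; of the
  32 patterns exactly the listed types are left.\<close>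

lemma neighbourhood_types:
  assumes "v \<in> V" "v \<notin> range c"
  shows "v \<in> A \<or> v \<in> W \<or> (\<exists>i. v \<in> B2 i) \<or> (\<exists>i. v \<in> B3 i) \<or> (\<exists>i. v \<in> B4 i)"
proof -
  have hit: "E v (c i) \<longrightarrow> E v (c (i + 2)) \<or> E v (c (i + 3))" for i
    using edge_hit[OF assms(1)] by blast
  \<comment> \<open>Writing \<open>0 + k\<close> lets \<open>c_wrap\<close> match at
    \<open>i = 0\<close>; \<open>add_0\<close> removes the zeros afterwards.\<close>
  note hit' = hit[of 0] hit[of "0 + 1"] hit[of "0 + 2"] hit[of "0 + 3"] hit[of "0 + 4"]
  note defs = B2_def[of 0] B2_def[of "0 + 1"] B2_def[of "0 + 2"] B2_def[of "0 + 3"] B2_def[of "0 + 4"]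
    B3_def[of 0] B3_def[of "0 + 1"] B3_def[of "0 + 2"] B3_def[of "0 + 3"] B3_def[of "0 + 4"]
    B4_def[of 0] B4_def[of "0 + 1"] B4_def[of "0 + 2"] B4_def[of "0 + 3"] B4_def[of "0 + 4"]
  have ne: "v \<noteq> c 0" "v \<noteq> c 1" "v \<noteq> c 2" "v \<noteq> c 3" "v \<noteq> c 4" using assms(2) by blast+
  have "v \<in> A \<or> v \<in> W \<or>
      (v \<in> B2 0 \<or> v \<in> B2 1 \<or> v \<in> B2 2 \<or> v \<in> B2 3 \<or> v \<in> B2 4) \<or>
      (v \<in> B3 0 \<or> v \<in> B3 1 \<or> v \<in> B3 2 \<or> v \<in> B3 3 \<or> v \<in> B3 4) \<or>
      (v \<in> B4 0 \<or> v \<in> B4 1 \<or> v \<in> B4 2 \<or> v \<in> B4 3 \<or> v \<in> B4 4)"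
    unfolding A_def W_def defs[unfolded c_wrap, unfolded add_0] mem_Collect_eq
    using hit'[unfolded c_wrap, unfolded add_0] assms(1) ne by argo
  then show ?thesis by blast
qed

lemma B2_empty: "H2_free V \<Longrightarrow> B2 i = {}"
proof -
  assume H2: "H2_free V"
  have "v \<notin> range c" if "v \<in> B2 i" for v
    using that c_nonadj[of i] irrefl unfolding B2_def c_cases[of v i] by blast
  then show ?thesis using shift_free(1)[OF H2, of _ i] unfolding B2_def by blast
qed

lemma B3_empty: "H3_free V \<Longrightarrow> B3 i = {}"
  using shift_free(2)[of _ i] unfolding B3_def by blast

lemma B4_empty: "H4_free V \<Longrightarrow> B4 i = {}"
  using shift_free(3)[of _ i] unfolding B4_def by blast

lemma B_notin_C: "v \<in> B2 i \<or> v \<in> B3 i \<or> v \<in> B4 i \<or> v \<in> A \<or> v \<in> W \<Longrightarrow> v \<notin> range c"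
  using c_nonadj[of i] c_adj[of i] irrefl
  unfolding B2_def B3_def B4_def A_iff W_iff c_cases[of v i] by blast

lemma W_indep: "u \<in> W \<Longrightarrow> v \<in> W \<Longrightarrow> \<not> E u v"
  using K4D[OF K4 _ _ cV cV, of u v 0 1] c_adj(1)[of 0] unfolding W_iff by auto

lemma A_indep: "u \<in> A \<Longrightarrow> v \<in> A \<Longrightarrow> \<not> E u v"
  using two_K2D[OF two_K2 _ _ cV cV _ c_adj(1)[of 0], of u v] unfolding A_iff by auto

lemma three_colors:
  fixes x y z w :: nat
  assumes "x < 3" "y < 3" "z < 3" "w < 3" "w \<noteq> x" "w \<noteq> y" "w \<noteq> z" "x \<noteq> y" "y \<noteq> z"
  shows "x = z"
  using assms by linarith

text \<open>The color of \<open>w\<close> is lost for the cycle, so the two others would have to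
  alternate around an odd cycle.\<close>

lemma not_3_colorable_if_W:
  assumes "w \<in> W"
  shows "\<not> colorable V 3"
proof
  assume "colorable V 3"
  then obtain f where f: "proper V {..<3} f" unfolding colorable_def by blast
  have w: "w \<in> V" "E w (c i)" for i using assms unfolding W_iff by auto
  have lt: "f v < 3" if "v \<in> V" for v using f that unfolding proper_def by auto
  have ne: "f u \<noteq> f v" if "u \<in> V" "v \<in> V" "E u v" for u v using f that unfolding proper_def by auto
  have eq: "f (c i) = f (c (i + 2))" for i
    using three_colors[of "f (c i)" "f (c (i + 1))" "f (c (i + 2))" "f w"] lt[OF cV] lt[OF w(1)]
      ne[OF w(1) cV w(2)] ne[OF cV cV c_adj(1)[of i]] ne[OF cV cV c_adj(2)[of i]] by blast
  have "f (c 0) = f (c 4)" using trans[OF eq[of 0] eq[of "0 + 2"]] unfolding c_wrap by (simp only: add_0)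
  then show False using ne[OF cV cV c_adj(5)[of 0]] by (simp only: add_0)
qed

lemma not_2_colorable: "\<not> colorable V 2"
proof
  assume "colorable V 2"
  then obtain f where f: "proper V {..<2} f" unfolding colorable_def by blast
  have lt: "f v < 2" if "v \<in> V" for v using f that unfolding proper_def by auto
  have ne: "f u \<noteq> f v" if "u \<in> V" "v \<in> V" "E u v" for u v using f that unfolding proper_def by auto
  have eq: "f (c i) = f (c (i + 2))" for i
    using lt[OF cV, of i] lt[OF cV, of "i + 1"] lt[OF cV, of "i + 2"]
      ne[OF cV cV c_adj(1)[of i]] ne[OF cV cV c_adj(2)[of i]] by linarith
  have "f (c 0) = f (c 4)" using trans[OF eq[of 0] eq[of "0 + 2"]] unfolding c_wrap by (simp only: add_0)
  then show False using ne[OF cV cV c_adj(5)[of 0]] by (simp only: add_0)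
qed

lemma colorable_range_c: "U \<subseteq> range c \<Longrightarrow> colorable U 3"
proof (rule colorable_3I)
  assume "U \<subseteq> range c"
  then show "U \<subseteq> {c 0} \<union> {c 1, c 3} \<union> {c 2, c 4}"
    using c_cases[of _ 0] unfolding add_0 by blast
  show "indep {c 0}" "indep {c 1, c 3}" "indep {c 2, c 4}"
    using irrefl c_nonadj[of 0] unfolding indep_def add_0 by blast+
qed

lemma maxindD:
  assumes "maxind V S"
  shows "S \<subseteq> V" "\<And>u v. u \<in> S \<Longrightarrow> v \<in> S \<Longrightarrow> \<not> E u v"
    "\<And>v. v \<in> V \<Longrightarrow> (\<And>s. s \<in> S \<Longrightarrow> \<not> E s v) \<Longrightarrow> v \<in> S"
  using assms unfolding maxind_def by blast+

text \<open>A maximal independent set of a 5-cycle is a pair at distance two, and removing it leaves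
  an edge and an isolated vertex, which two colors suffice for.\<close>

lemma recol_if_cycle:
  assumes "V \<subseteq> range c"
  shows "recolorable_on V"
proof (rule recol_if_good_vertex[OF finV IH not_2_colorable cV[of 0]])
  fix S assume S: "maxind V S" "c 0 \<in> S"
  note adj = c_adj[of 0, unfolded add_0] and nonadj = c_nonadj[of 0, unfolded add_0]
  have C: "v = c 0 \<or> v = c 1 \<or> v = c 2 \<or> v = c 3 \<or> v = c 4" if "v \<in> V" for v
    using that assms c_cases[of v 0] unfolding add_0 by blast
  have *: "s = c 0 \<or> s = c 2 \<or> s = c 3" if "s \<in> S" for s
    using C[of s] maxindD(1)[OF S(1)] maxindD(2)[OF S(1) S(2) that] that adj by blast
  have "c 2 \<in> S \<or> c 3 \<in> S"
  proof (rule ccontr)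
    assume n: "\<not> (c 2 \<in> S \<or> c 3 \<in> S)"
    then have "\<not> E s (c 2)" if "s \<in> S" for s using *[OF that] that nonadj by blast
    then show False using maxindD(3)[OF S(1) cV, of 2] n by blast
  qed
  then show "colorable (V - S) 2"
  proof
    assume "c 2 \<in> S"
    then have "V - S \<subseteq> {c 1, c 3} \<union> {c 4}" using C S(2) by blast
    then show ?thesis by (rule colorable_2I) (use nonadj irrefl in \<open>simp_all add: indep_def\<close>)
  next
    assume "c 3 \<in> S"
    then have "V - S \<subseteq> {c 1, c 4} \<union> {c 2}" using C S(2) by blast
    then show ?thesis by (rule colorable_2I) (use nonadj irrefl in \<open>simp_all add: indep_def\<close>)
  qed
qed

end

section \<open>Only attachments of type \<open>H2\<close>\<close>

context sgraph begin
lemma H3_freeD: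
  assumes "H3_free V" "{a, b, c, d, e} \<subseteq> V" "E a b" "E b c" "E c d" "E d e" "E e a"
    and "\<not> E a c" "\<not> E b d" "\<not> E c e" "\<not> E d a" "\<not> E e b"
    and "u \<in> V" "E u a" "\<not> E u b" "E u c" "E u d" "\<not> E u e"
  shows False
proof -
  obtain f where f: "C5 V f" "f 0 = a" "f 1 = b" "f 2 = c" "f 3 = d" "f 4 = e"
    using C5I[OF assms(2-12)] by metis
  show False using H3D[OF assms(1) f(1) assms(13)] assms(14-) unfolding f(2-) by blast
qed
end

context C5_graph begin

lemma not_comparable:
  assumes "u \<in> V" "v \<in> V" "u \<noteq> v"
  obtains x where "x \<in> V" "E u x" "E x u" "\<not> E v x" "\<not> E x v"
  using incomparableD[OF incomp assms] sym by blast

lemma A_ne_c: "a \<in> A \<Longrightarrow> a \<noteq> c i"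
  using B_notin_C[of a i] by blast

text \<open>A maximal independent set through \<open>w\<close> misses the cycle and therefore
  contains the independent set \<open>W\<close>; only cycle vertices remain.\<close>

lemma recol_if_range_W:
  assumes "V \<subseteq> range c \<union> W"
  shows "recolorable_on V"
proof (cases "W = {}")
  case True
  then show ?thesis using recol_if_cycle assms by simp
next
  case False
  then obtain w where w: "w \<in> W" by blast
  then have wV: "w \<in> V" unfolding W_iff by blast
  show ?thesis
  proof (rule recol_if_good_vertex[OF finV IH not_3_colorable_if_W[OF w] wV])
    fix S assume S: "maxind V S" "w \<in> S"
    have "\<not> E s v" if "s \<in> S" "v \<in> W" for s v
    proof -
      have "s \<notin> range c" using maxindD(2)[OF S that(1)] w unfolding W_iff by blast
      then show ?thesis using assms maxindD(1)[OF S(1)] that W_indep by blast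
    qed
    then have "W \<subseteq> S" using maxindD(3)[OF S(1)] W_iff by (meson subsetI)
    then show "colorable (V - S) 3" using assms by (intro colorable_range_c) blast
  qed
qed

text \<open>Every vertex of \<open>A\<close> would be dominated by \<open>c 0\<close>, and every
  vertex of \<open>B2 i\<close> by its counterpart \<open>c i\<close>, against incomparability. Only
  the cycle and \<open>W\<close> remain.\<close>

lemma recol_H3_H4_free:
  assumes "H3_free V" "H4_free V"
  shows "recolorable_on V"
proof -
  have types: "v \<in> range c \<or> v \<in> A \<or> v \<in> W \<or> (\<exists>i. v \<in> B2 i)" if "v \<in> V" for v
    using neighbourhood_types[OF that] B3_empty[OF assms(1)] B4_empty[OF assms(2)] by blast
  have A: False if a: "a \<in> A" for a
  proof -
    have aV: "a \<in> V" "\<And>i. \<not> E a (c i)" using a unfolding A_iff by blast+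
    obtain x where x: "x \<in> V" "E a x" "\<not> E x (c 0)"
      using not_comparable[OF aV(1) cV A_ne_c[OF a], of 0] by metis
    from types[OF x(1)] show False
    proof (elim disjE exE)
      fix i assume "x \<in> B2 i"
      then show False
        using two_K2D[OF two_K2 aV(1) x(1) cV cV x(2) c_adj(3)[of i]] aV(2) unfolding B2_def by blast
    next
      assume "x \<in> range c" then show False using x aV by blast
    next
      assume "x \<in> A" then show False using x a A_indep by blast
    next
      assume "x \<in> W" then show False using x W_iff by blast
    qed
  qed
  have B: False if b: "b \<in> B2 i" for b i
  proof -
    note adj = c_adj[of i] and nonadj = c_nonadj[of i]
    have bV: "b \<in> V" "b \<noteq> c i" "\<not> E b (c i)" "E b (c (i + 1))" "\<not> E b (c (i + 2))"
      "\<not> E b (c (i + 3))" "E b (c (i + 4))" using b unfolding B2_def by blast+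
    note Eb = bV(3-7)[unfolded sym_iff[of b]]
    obtain x where x: "x \<in> V" "E b x" "E x b" "\<not> E x (c i)"
      using not_comparable[OF bV(1) cV bV(2)] by metis
    have B: "x \<notin> B2 k" for k
    proof
      assume "x \<in> B2 k"
      with B2_index[of k i] have "x \<in> B2 i \<or> x \<in> B2 (i + 1) \<or> x \<in> B2 (i + 2) \<or> x \<in> B2 (i + 3) \<or> x \<in> B2 (i + 4)"
        by blast
      then show False
      proof (elim disjE)
        assume "x \<in> B2 i"
        then show False
          using two_K2D[OF two_K2 bV(1) x(1) cV cV x(2) c_adj(3)[of i]] bV unfolding B2_def by blast
      next
        assume "x \<in> B2 (i + 1)"
        then show False using x unfolding B2_def c_wrap by blast
      next
        assume "x \<in> B2 (i + 4)"
        then show False using x unfolding B2_def c_wrap by blast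
      next
        \<comment> \<open>On the 5-cycle with \<open>b\<close> in place of \<open>c i\<close>, the
          vertex \<open>x\<close> sees \<open>b\<close>, \<open>c (i + 1)\<close> and
          \<open>c (i + 3)\<close>, which is an \<open>H3\<close>. The case \<open>i + 3\<close> is
          the mirror image.\<close>
        assume "x \<in> B2 (i + 2)"
        then show False
          using H3_freeD[OF assms(1), of "c (i + 3)" "c (i + 4)" b "c (i + 1)" "c (i + 2)" x]
            adj nonadj bV Eb x unfolding B2_def c_wrap by simp
      next
        assume "x \<in> B2 (i + 3)"
        then show False
          using H3_freeD[OF assms(1), of "c (i + 2)" "c (i + 3)" "c (i + 4)" b "c (i + 1)" x]
            adj nonadj bV Eb x unfolding B2_def c_wrap by simp
      qed
    qed
    from types[OF x(1)] have "x \<in> range c" using A B x(4) W_iff by blast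
    then show False using x bV(3,5,6) adj unfolding c_cases[of x i] by blast
  qed
  show ?thesis
    using types A B by (intro recol_if_range_W) blast
qed

section \<open>Only attachments of type \<open>H4\<close>\<close>

lemma K4_edge:
  assumes "u \<in> V" "v \<in> V" "E u (c i)" "E u (c (i + 1))" "E v (c i)" "E v (c (i + 1))"
  shows "\<not> E u v"
  using K4D[OF K4 assms(1,2) cV cV _ assms(3,4,5,6) c_adj(1)[of i]] by blast

text \<open>Any two vertices from \<open>W\<close> and the classes \<open>B4 i\<close> are complete
  to a common cycle edge, so \<open>K_4\<close>-freeness makes the union of these sets independent.
  By \<open>2K_2\<close>-freeness the nonempty classes occupy at most two consecutive indices. The
  good vertex is taken from \<open>W\<close>, or from a class \<open>B4 j\<close> if
  \<open>W\<close> is empty.\<close>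

lemma recol_H2_H3_free:
  assumes "H2_free V" "H3_free V"
  shows "recolorable_on V"
proof -
  have types: "v \<in> range c \<or> v \<in> A \<or> v \<in> W \<or> (\<exists>i. v \<in> B4 i)" if "v \<in> V" for v
    using neighbourhood_types[OF that] B2_empty[OF assms(1)] B3_empty[OF assms(2)] by blast
  have BV: "b \<in> V" if "b \<in> B4 i" for b i using that unfolding B4_def by blast
  have BB: "\<not> E b b'" if b: "b \<in> B4 i" and b': "b' \<in> B4 j" for b b' i j
    using B4_index[of j i]
  proof (elim disjE)
    assume "B4 j = B4 i"
    then show ?thesis using K4_edge[of b b' "i + 1"] b b' unfolding B4_def c_wrap by blast
  next
    assume j: "B4 j = B4 (i + 1)"
    show ?thesis using K4_edge[of b b' "i + 2"] b b' unfolding j unfolding B4_def c_wrap by blast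
  next
    assume j: "B4 j = B4 (i + 2)"
    show ?thesis using K4_edge[of b b' "i + 3"] b b' unfolding j unfolding B4_def c_wrap by blast
  next
    assume j: "B4 j = B4 (i + 3)"
    show ?thesis using K4_edge[of b b' "i + 1"] b b' unfolding j unfolding B4_def c_wrap by blast
  next
    assume j: "B4 j = B4 (i + 4)"
    show ?thesis using K4_edge[of b b' "i + 1"] b b' unfolding j unfolding B4_def c_wrap by blast
  qed
  have WB: "\<not> E b w" "\<not> E w b" if b: "b \<in> B4 i" and w: "w \<in> W" for b w i
    using K4_edge[of b w "i + 1"] b w sym_iff[of b w] unfolding B4_def W_iff c_wrap by blast+
  \<comment> \<open>The edges \<open>b c (i + 2)\<close> and \<open>b' c i\<close> would form a
    \<open>2K_2\<close>: each of \<open>b\<close>, \<open>b'\<close> misses the cycle vertex used by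
    the other.\<close>
  have far: False if b: "b \<in> B4 i" and b': "b' \<in> B4 (i + 2)" for b b' i
    using two_K2D[OF two_K2 BV[OF b] cV BV[OF b'] cV, of "i + 2" i] BB[OF b b']
      b b' c_nonadj(6)[of i] sym_iff[of "c (i + 2)"] unfolding B4_def c_wrap by blast
  have A: False if a: "a \<in> A" for a
  proof -
    have aV: "a \<in> V" "\<And>i. \<not> E a (c i)" using a unfolding A_iff by blast+
    \<comment> \<open>If \<open>B4 j\<close> is empty, every neighbour of \<open>a\<close> sees
      \<open>c j\<close>, so \<open>a\<close> would be dominated by \<open>c j\<close>.\<close>
    obtain j where j: "B4 j = {}" using far[of _ 0 _] by blast
    obtain x where x: "x \<in> V" "E a x" "\<not> E x (c j)"
      using not_comparable[OF aV(1) cV A_ne_c[OF a], of j] by metis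
    from types[OF x(1)] show False
    proof (elim disjE exE)
      fix k assume "x \<in> B4 k"
      with B4_index[of k j] j have "x \<in> B4 (j + 1) \<or> x \<in> B4 (j + 2) \<or> x \<in> B4 (j + 3) \<or> x \<in> B4 (j + 4)"
        by blast
      then show False using x(3) unfolding B4_def c_wrap by blast
    next
      assume "x \<in> range c" then show False using x aV by blast
    next
      assume "x \<in> A" then show False using x a A_indep by blast
    next
      assume "x \<in> W" then show False using x W_iff by blast
    qed
  qed
  show ?thesis
  proof (cases "W = {}")
    case False
    then obtain w where w: "w \<in> W" by blast
    then have wV: "w \<in> V" "\<And>i. E w (c i)" unfolding W_iff by blast+
    show ?thesis
    proof (rule recol_if_good_vertex[OF finV IH not_3_colorable_if_W[OF w] wV(1)])
      fix S assume S: "maxind V S" "w \<in> S"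
      have nc: "s \<notin> range c" if "s \<in> S" for s
        using maxindD(2)[OF S(1) S(2) that] wV by blast
      have sub: "s \<in> W \<or> (\<exists>i. s \<in> B4 i)" if "s \<in> S" for s
        using types[of s] maxindD(1)[OF S(1)] that nc[OF that] A by blast
      have "v \<in> S" if v: "v \<in> W \<or> (\<exists>i. v \<in> B4 i)" for v
      proof (rule maxindD(3)[OF S(1)])
        show "v \<in> V" using v BV unfolding W_iff by blast
        show "\<not> E s v" if "s \<in> S" for s
          using sub[OF that] v W_indep WB BB by metis
      qed
      then have "V - S \<subseteq> range c" using types A by blast
      then show "colorable (V - S) 3" by (rule colorable_range_c)
    qed
  next
    case W: True
    show ?thesis
    proof (cases "\<exists>i. B4 i \<noteq> {}")
      case False
      then show ?thesis using types W A by (intro recol_if_cycle) blast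
    next
      case True
      then obtain i b where b: "b \<in> B4 i" by blast
      \<comment> \<open>On the cycle \<open>b\<close> misses only \<open>c i\<close>, so the
        neighbour of \<open>c i\<close> that \<open>b\<close> lacks lies off the cycle. It sees
        \<open>c i\<close>, hence is in another class, and \<open>far\<close> leaves only the two
        indices next to \<open>i\<close>.\<close>
      have "B4 (i + 1) \<noteq> {} \<or> B4 (i + 4) \<noteq> {}"
      proof -
        have "c i \<noteq> b" using B_notin_C[of b i] b by blast
        then obtain x where x: "x \<in> V" "E x (c i)" "\<not> E x b" "\<not> E b x"
          using not_comparable[OF cV BV[OF b], of i] by metis
        have "x \<notin> range c"
          using x b c_nonadj[of i] irrefl unfolding c_cases[of x i] B4_def by blast
        then obtain k where "x \<in> B4 k" using types[OF x(1)] A W by blast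
        with B4_index[of k i] have "x \<in> B4 i \<or> x \<in> B4 (i + 1) \<or> x \<in> B4 (i + 2) \<or> x \<in> B4 (i + 3) \<or> x \<in> B4 (i + 4)"
          by blast
        moreover have "x \<notin> B4 i" using x unfolding B4_def by blast
        moreover have "x \<notin> B4 (i + 2)" using far[OF b] by blast
        moreover have "x \<notin> B4 (i + 3)" using far[of x "i + 3" b] b unfolding B4_wrap by blast
        ultimately show ?thesis by blast
      qed
      then obtain j b b' where b: "b \<in> B4 j" and b': "b' \<in> B4 (j + 1)"
      proof
        assume "B4 (i + 1) \<noteq> {}"
        with that[of b i] b show thesis by blast
      next
        assume "B4 (i + 4) \<noteq> {}"
        with that[of _ "i + 4" b] b show thesis unfolding B4_wrap by blast
      qed
      have e: "B4 (j + 2) = {}" "B4 (j + 3) = {}" "B4 (j + 4) = {}"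
        using far[OF b] far[OF b', unfolded B4_wrap] far[of _ "j + 4" b', unfolded B4_wrap] b' by blast+
      have cover: "v \<in> range c \<or> v \<in> B4 j \<or> v \<in> B4 (j + 1)" if "v \<in> V" for v
        using types[OF that] A W B4_index[of _ j] e by blast
      note bj = b[unfolded B4_def mem_Collect_eq] b'[unfolded B4_def mem_Collect_eq c_wrap]
      have n3: "\<not> colorable V 3"
      proof
        assume "colorable V 3"
        then obtain f where f: "proper V {..<3} f" unfolding colorable_def by blast
        have lt: "f v < 3" if "v \<in> V" for v using f that unfolding proper_def by auto
        have ne: "f u \<noteq> f v" if "u \<in> V" "v \<in> V" "E u v" for u v using f that unfolding proper_def by auto
        \<comment> \<open>A vertex seeing three consecutive cycle vertices forces the outer two to
          share a color. With \<open>b\<close> and \<open>b'\<close> this carries the color of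
          \<open>c (j + 1)\<close> over \<open>c (j + 3)\<close> to \<open>c j\<close>, which is
          adjacent to \<open>c (j + 1)\<close>.\<close>
        have eq: "f (c k) = f (c (k + 2))" if "y \<in> V" "E y (c k)" "E y (c (k + 1))" "E y (c (k + 2))" for k y
          using three_colors[of "f (c k)" "f (c (k + 1))" "f (c (k + 2))" "f y"] lt[OF cV] lt[OF that(1)]
            ne[OF that(1) cV that(2)] ne[OF that(1) cV that(3)] ne[OF that(1) cV that(4)]
            ne[OF cV cV c_adj(1)[of k]] ne[OF cV cV c_adj(2)[of k]] by blast
        have "f (c (j + 1)) = f (c (j + 3))" "f (c (j + 3)) = f (c j)"
          using eq[of b "j + 1"] eq[of b' "j + 3"] bj unfolding c_wrap by blast+
        then show False using ne[OF cV cV c_adj(1)[of j]] by simp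
      qed
      show ?thesis
      proof (rule recol_if_good_vertex[OF finV IH n3 BV[OF b]])
        fix S assume S: "maxind V S" "b \<in> S"
        have nc: "s \<notin> range c \<or> s = c j" if "s \<in> S" for s
          using maxindD(2)[OF S(1) S(2) that] bj unfolding c_cases[of s j] by blast
        \<comment> \<open>Only two sets are possible: both classes together, which leaves the cycle,
          or \<open>c j\<close> with \<open>B4 j\<close>, which leaves a path of four cycle vertices
          and the independent set \<open>B4 (j + 1)\<close>.\<close>
        show "colorable (V - S) 3"
        proof (cases "S \<inter> B4 (j + 1) = {}")
          case False
          then obtain y where y: "y \<in> S" "y \<in> B4 (j + 1)" by blast
          then have "c j \<notin> S" using maxindD(2)[OF S(1) y(1)] unfolding B4_def c_wrap by blast
          then have sub: "s \<in> B4 j \<or> s \<in> B4 (j + 1)" if "s \<in> S" for s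
            using nc[OF that] cover[of s] maxindD(1)[OF S(1)] that by blast
          have "v \<in> S" if v: "v \<in> B4 j \<or> v \<in> B4 (j + 1)" for v
            using maxindD(3)[OF S(1), of v] sub v BV BB by metis
          then have "V - S \<subseteq> range c" using cover by blast
          then show ?thesis by (rule colorable_range_c)
        next
          case True
          then have sub: "s = c j \<or> s \<in> B4 j" if "s \<in> S" for s
            using nc[OF that] cover[of s] maxindD(1)[OF S(1)] that by blast
          have cb: "\<not> E (c j) v" "\<not> E v (c j)" if "v \<in> B4 j" for v
            using that sym_iff[of v] unfolding B4_def by blast+
          have "v \<in> S" if v: "v = c j \<or> v \<in> B4 j" for v
            using maxindD(3)[OF S(1), of v] sub v BV BB cb irrefl cV by metis
          then have "V - S \<subseteq> {c (j + 1), c (j + 3)} \<union> {c (j + 2), c (j + 4)} \<union> B4 (j + 1)"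
            using cover unfolding c_cases[of _ j] by blast
          then show ?thesis
            by (rule colorable_3I) (use BB c_nonadj[of j] irrefl in \<open>unfold indep_def, blast+\<close>)
        qed
      qed
    qed
  qed
qed

end

section \<open>Only attachments of type \<open>H3\<close>\<close>

locale C5_H3_graph = C5_graph +
  assumes H2: "H2_free V" and H4: "H4_free V"
begin

lemma types: "v \<in> V \<Longrightarrow> v \<in> range c \<or> v \<in> A \<or> v \<in> W \<or> (\<exists>i. v \<in> B3 i)"
  using neighbourhood_types B2_empty[OF H2] B4_empty[OF H4] by blast

lemma B3_V: "b \<in> B3 i \<Longrightarrow> b \<in> V"
  unfolding B3_def by blast

lemma B3_indep: "b \<in> B3 i \<Longrightarrow> b' \<in> B3 i \<Longrightarrow> \<not> E b b'"
  using K4D[OF K4 _ _ cV cV, of b b' "i + 2" "i + 3"] c_adj(3)[of i] unfolding B3_def by blast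

lemma B3_W: "b \<in> B3 i \<Longrightarrow> w \<in> W \<Longrightarrow> \<not> E b w" "b \<in> B3 i \<Longrightarrow> w \<in> W \<Longrightarrow> \<not> E w b"
  using K4D[OF K4 _ _ cV cV, of b w "i + 2" "i + 3"] c_adj(3)[of i] sym_iff[of b w]
  unfolding B3_def W_iff by blast+

text \<open>Otherwise the edges \<open>b c (i + 2)\<close> and \<open>b' c (i + 4)\<close> form a
  \<open>2K_2\<close>.\<close>

lemma B3_next:
  assumes "b \<in> B3 i" "b' \<in> B3 (i + 1)"
  shows "E b b'"
  using two_K2D[OF two_K2 B3_V[OF assms(1)] cV B3_V[OF assms(2)] cV, of "i + 2" "i + 4"]
    assms c_nonadj(3)[of i] sym_iff[of "c (i + 2)" b'] unfolding B3_def c_wrap by blast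

text \<open>By \<open>B3_next\<close> also \<open>p\<close> and \<open>q\<close> are adjacent, and
  all three vertices see \<open>c i\<close>, which completes a \<open>K_4\<close>. Hence a vertex of
  \<open>B3 i\<close> has neighbours in at most one of the two opposite classes; the recolorings and
  3-colorings below rest on this.\<close>

lemma B3_triangle:
  assumes "b \<in> B3 i" "p \<in> B3 (i + 2)" "q \<in> B3 (i + 3)" "E b p" "E b q"
  shows False
  using K4D[OF K4 cV B3_V[OF assms(1)] B3_V[OF assms(2)] B3_V[OF assms(3)], of i]
    B3_next[of p "i + 2" q] assms sym_iff[of "c i"] unfolding B3_wrap B3_def c_wrap by blast

lemma B3_index5:
  "x \<in> B3 k \<Longrightarrow> x \<in> B3 i \<or> x \<in> B3 (i + 1) \<or> x \<in> B3 (i + 2) \<or> x \<in> B3 (i + 3) \<or> x \<in> B3 (i + 4)"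
  using B3_index[of k i] by blast

text \<open>Neither \<open>a\<close> nor \<open>b\<close> sees \<open>c (i + 4)\<close>, a neighbour
  of \<open>b'\<close>, so the edges \<open>a b\<close> and \<open>b' c (i + 4)\<close> can be
  joined only by \<open>a b'\<close>.\<close>

lemma A_spread:
  assumes "a \<in> A" "b \<in> B3 i" "E a b" "b' \<in> B3 (i + 2)" "\<not> E b b'"
  shows "E a b'"
  using two_K2D[OF two_K2 _ B3_V[OF assms(2)] B3_V[OF assms(4)] cV assms(3), of "i + 4"] assms
  unfolding A_iff B3_def c_wrap by blast

lemma A_spread':
  assumes "a \<in> A" "b \<in> B3 i" "E a b" "b' \<in> B3 (i + 3)" "\<not> E b b'"
  shows "E a b'"
  using two_K2D[OF two_K2 _ B3_V[OF assms(2)] B3_V[OF assms(4)] cV assms(3), of "i + 1"] assms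
  unfolding A_iff B3_def c_wrap by blast

lemma A_neighbour:
  assumes "a \<in> A"
  obtains i b where "b \<in> B3 i" "E a b"
proof -
  have aV: "a \<in> V" "\<And>i. \<not> E a (c i)" using assms unfolding A_iff by blast+
  obtain x where x: "x \<in> V" "E a x" "\<not> E x (c 0)"
    using not_comparable[OF aV(1) cV A_ne_c[OF assms], of 0] by metis
  from types[OF x(1)] show thesis
  proof (elim disjE exE)
    fix i assume "x \<in> B3 i" then show thesis using that x by blast
  next
    assume "x \<in> range c" then show thesis using x aV by blast
  next
    assume "x \<in> A" then show thesis using x assms A_indep by blast
  next
    assume "x \<in> W" then show thesis using x W_iff by blast
  qed
qed

text \<open>With \<open>w\<close> present, classes at distance two are anticomplete, while
  consecutive ones are complete. So a maximal independent set through \<open>w\<close> contains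
  \<open>W\<close> and two whole classes at distance two; the other three classes, \<open>A\<close>
  and the cycle split into three independent sets.\<close>

lemma recol_if_W:
  assumes w: "w \<in> W"
  shows "recolorable_on V"
proof -
  have wV: "w \<in> V" "\<And>i. E w (c i)" using w unfolding W_iff by blast+
  \<comment> \<open>An edge \<open>b b'\<close> and the edge \<open>w c (i + 1)\<close> would form a
    \<open>2K_2\<close>: \<open>K_4\<close>-freeness separates \<open>w\<close> from both classes,
    and neither class sees \<open>c (i + 1)\<close>.\<close>
  have anti: "\<not> E b b'" "\<not> E b' b" if b: "b \<in> B3 i" and b': "b' \<in> B3 (i + 2)" for b b' i
    using two_K2D[OF two_K2 B3_V[OF b] B3_V[OF b'] wV(1) cV, of "i + 1"] b b' B3_W[OF b w] B3_W[OF b' w]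
      wV(2) sym_iff[of b b'] unfolding B3_def c_wrap by blast+
  have AW: "E w' a" if a: "a \<in> A" and w': "w' \<in> W" for a w'
  proof -
    obtain i b where b: "b \<in> B3 i" "E a b" using A_neighbour[OF a] by blast
    show ?thesis
      using two_K2D[OF two_K2 _ B3_V[OF b(1)] _ cV b(2), of w' "i + 1"] a w' B3_W(1)[OF b(1) w'] b(1) sym_iff[of a w']
      unfolding A_iff W_iff B3_def by blast
  qed
  show ?thesis
  proof (rule recol_if_good_vertex[OF finV IH not_3_colorable_if_W[OF w] wV(1)])
    fix S assume S: "maxind V S" "w \<in> S"
    note max = maxindD[OF S(1)]
    have sub: "s \<in> W \<or> (\<exists>i. s \<in> B3 i)" if "s \<in> S" for s
      using types[of s] max(1) that max(2)[OF S(2) that] wV AW[OF _ w] by blast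
    have W: "W \<subseteq> S"
    proof
      fix v assume v: "v \<in> W"
      have "\<not> E s v" if "s \<in> S" for s
        using sub[OF that] W_indep v B3_W by blast
      then show "v \<in> S" using max(3)[of v] v W_iff by blast
    qed
    have pair: "B3 i \<subseteq> S \<and> B3 (i + 2) \<subseteq> S" if i: "\<And>s. s \<in> S \<Longrightarrow> s \<in> W \<or> s \<in> B3 i \<or> s \<in> B3 (i + 2)" for i
    proof -
      have "v \<in> S" if v: "v \<in> B3 i \<or> v \<in> B3 (i + 2)" for v
      proof (rule max(3))
        show "v \<in> V" using v B3_V by blast
        show "\<not> E s v" if "s \<in> S" for s
          using i[OF that] v anti[of _ i] B3_indep B3_W by blast
      qed
      then show ?thesis by blast
    qed
    \<comment> \<open>Consecutive classes are complete to each other, so \<open>S\<close> lies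
      within \<open>W\<close> and two classes at distance two; maximality then puts both into
      \<open>S\<close> entirely.\<close>
    have "\<exists>i. B3 i \<subseteq> S \<and> B3 (i + 2) \<subseteq> S"
    proof (cases "\<exists>s\<in>S. \<exists>i. s \<in> B3 i")
      case False
      then show ?thesis using pair[of 0] sub by blast
    next
      case True
      then obtain b i where b: "b \<in> S" "b \<in> B3 i" by blast
      have n: "s \<notin> B3 (i + 1)" "s \<notin> B3 (i + 4)" if "s \<in> S" for s
        using max(2)[OF b(1) that] max(2)[OF that b(1)] B3_next[OF b(2), of s] B3_next[of s "i + 4" b] b(2)
        unfolding B3_wrap by blast+
      show ?thesis
      proof (cases "\<exists>s\<in>S. s \<in> B3 (i + 3)")
        case False
        have "s \<in> W \<or> s \<in> B3 i \<or> s \<in> B3 (i + 2)" if "s \<in> S" for s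
          using sub[OF that] n[OF that] False that B3_index5[of s _ i] by blast
        then show ?thesis using pair by blast
      next
        case True
        then obtain b' where b': "b' \<in> S" "b' \<in> B3 (i + 3)" by blast
        have "s \<notin> B3 (i + 2)" if "s \<in> S" for s
          using max(2)[OF that b'(1)] B3_next[of s "i + 2" b'] b'(2) unfolding B3_wrap by blast
        then have "s \<in> W \<or> s \<in> B3 (i + 3) \<or> s \<in> B3 (i + 3 + 2)" if "s \<in> S" for s
          using sub[OF that] n[OF that] that B3_index5[of s _ i] unfolding B3_wrap by blast
        then show ?thesis using pair[of "i + 3"] by blast
      qed
    qed
    then obtain i where i: "B3 i \<subseteq> S" "B3 (i + 2) \<subseteq> S" by blast
    have "V - S \<subseteq> ({c i} \<union> B3 (i + 1) \<union> B3 (i + 4)) \<union> (A \<union> {c (i + 1), c (i + 3)}) \<union>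
        ({c (i + 2), c (i + 4)} \<union> B3 (i + 3))"
    proof
      fix v assume v: "v \<in> V - S"
      with types[of v] W have "v \<in> range c \<or> v \<in> A \<or> (\<exists>i. v \<in> B3 i)" by blast
      then show "v \<in> ({c i} \<union> B3 (i + 1) \<union> B3 (i + 4)) \<union> (A \<union> {c (i + 1), c (i + 3)}) \<union>
        ({c (i + 2), c (i + 4)} \<union> B3 (i + 3))"
        using i v B3_index5[of v _ i] unfolding c_cases[of v i] by blast
    qed
    then show "colorable (V - S) 3"
    proof (rule colorable_3I)
      have a: "\<not> E u v" "\<not> E v u" if "u \<in> B3 (i + 4)" "v \<in> B3 (i + 1)" for u v
        using anti[of u "i + 4" v] that unfolding B3_wrap by blast+
      have b: "\<not> E (c i) v" "\<not> E v (c i)" if "v \<in> B3 (i + 1) \<union> B3 (i + 4)" for v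
        using that sym_iff[of v "c i"] unfolding B3_def c_wrap by blast+
      show "indep ({c i} \<union> B3 (i + 1) \<union> B3 (i + 4))"
        using a b B3_indep irrefl unfolding indep_def by blast
      show "indep (A \<union> {c (i + 1), c (i + 3)})"
        using A_indep A_iff c_nonadj[of i] irrefl sym unfolding indep_def by blast
      have d: "\<not> E (c (i + 2)) v" "\<not> E v (c (i + 2))" "\<not> E (c (i + 4)) v" "\<not> E v (c (i + 4))"
        if "v \<in> B3 (i + 3)" for v
        using that sym_iff[of v "c (i + 2)"] sym_iff[of v "c (i + 4)"] unfolding B3_def c_wrap by blast+
      show "indep ({c (i + 2), c (i + 4)} \<union> B3 (i + 3))"
        using d B3_indep c_nonadj[of i] irrefl unfolding indep_def by blast
    qed
  qed
qed

end

section \<open>Type \<open>H3\<close> without a vertex complete to a 5-cycle\<close>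

context C5_H3_graph begin

text \<open>By \<open>B3_triangle\<close> no vertex of \<open>B3 (i + 1)\<close> has neighbours in
  both \<open>B3 (i + 3)\<close> and \<open>B3 (i + 4)\<close>, so each can join one of these
  classes. The third color takes \<open>B3 (i + 2)\<close>, and each color has room for one of the
  three remaining cycle vertices.\<close>

lemma colorable_rest:
  assumes V: "V \<subseteq> range c \<union> (\<Union>k. B3 k)"
    and S: "c (i + 4) \<in> S" "c (i + 1) \<in> S" "B3 i \<subseteq> S"
  shows "colorable (V - S) 3"
proof -
  let ?L = "{b \<in> B3 (i + 1). \<forall>x\<in>B3 (i + 3). \<not> E b x}"
  let ?U = "{b \<in> B3 (i + 1). \<forall>x\<in>B3 (i + 4). \<not> E b x}"
  have cov: "B3 (i + 1) \<subseteq> ?L \<union> ?U"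
    using B3_triangle[of _ "i + 1"] unfolding B3_wrap by blast
  have "V - S \<subseteq> ({c (i + 2)} \<union> B3 (i + 3) \<union> ?L) \<union> ({c i} \<union> B3 (i + 4) \<union> ?U) \<union> ({c (i + 3)} \<union> B3 (i + 2))"
  proof
    fix v assume v: "v \<in> V - S"
    show "v \<in> ({c (i + 2)} \<union> B3 (i + 3) \<union> ?L) \<union> ({c i} \<union> B3 (i + 4) \<union> ?U) \<union> ({c (i + 3)} \<union> B3 (i + 2))"
    proof (cases "v \<in> range c")
      case True
      then show ?thesis using v S(1,2) unfolding c_cases[of v i] by blast
    next
      case False
      then obtain k where "v \<in> B3 k" using V v by blast
      from B3_index5[OF this, of i] cov v S(3) show ?thesis by blast
    qed
  qed
  then show ?thesis
  proof (rule colorable_3I)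
    have n: "\<not> E (c (i + 2)) v" "\<not> E v (c (i + 2))" if "v \<in> B3 (i + 3) \<union> B3 (i + 1)" for v
      using that sym_iff[of v "c (i + 2)"] unfolding B3_def c_wrap by blast+
    show "indep ({c (i + 2)} \<union> B3 (i + 3) \<union> ?L)"
      using n B3_indep irrefl sym unfolding indep_def by blast
    have n: "\<not> E (c i) v" "\<not> E v (c i)" if "v \<in> B3 (i + 4) \<union> B3 (i + 1)" for v
      using that sym_iff[of v "c i"] unfolding B3_def c_wrap by blast+
    show "indep ({c i} \<union> B3 (i + 4) \<union> ?U)"
      using n B3_indep irrefl sym unfolding indep_def by blast
    have n: "\<not> E (c (i + 3)) v" "\<not> E v (c (i + 3))" if "v \<in> B3 (i + 2)" for v
      using that sym_iff[of v "c (i + 3)"] unfolding B3_def c_wrap by blast+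
    show "indep ({c (i + 3)} \<union> B3 (i + 2))"
      using n B3_indep irrefl unfolding indep_def by blast
  qed
qed

text \<open>
  If the cycle carries five different colors, each color class meets only \<open>c m\<close>, \<open>B3 (m + 1)\<close> and
  \<open>B3 (m + 4)\<close>.  Moving as much as possible of \<open>B3 (i + 2)\<close>, and then all of \<open>B3 i\<close>, to the other
  admissible color frees \<open>c (i + 2)\<close> to take the color of \<open>c (i + 4)\<close>.
\<close>

lemma merge_on_cycle:
  assumes V: "V \<subseteq> range c \<union> (\<Union>k. B3 k)" and f: "proper V K f"
  obtains g j where "reach V K f g" "g (c j) = g (c (j + 2))"
proof (cases "\<exists>j. f (c j) = f (c (j + 2))")
  case True
  then show thesis using that by blast
next
  case False
  have inK: "f v \<in> K" if "v \<in> V" for v using f that unfolding proper_def by blast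
  have ne: "f u \<noteq> f v" if "u \<in> V" "v \<in> V" "E u v" for u v using f that unfolding proper_def by blast
  have inj: "f (c m) \<noteq> f (c (m + 1))" "f (c m) \<noteq> f (c (m + 2))"
    "f (c m) \<noteq> f (c (m + 3))" "f (c m) \<noteq> f (c (m + 4))" for m
  proof -
    show "f (c m) \<noteq> f (c (m + 1))" "f (c m) \<noteq> f (c (m + 4))" using ne[OF cV cV] c_adj[of m] by blast+
    show "f (c m) \<noteq> f (c (m + 2))" using False by blast
    have "f (c (m + 3)) \<noteq> f (c (m + 3 + 2))" using False by blast
    then show "f (c m) \<noteq> f (c (m + 3))" unfolding c_wrap by metis
  qed
  have cls: "v = c m \<or> v \<in> B3 (m + 1) \<or> v \<in> B3 (m + 4)" if v: "v \<in> V" "f v = f (c m)" for v m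
  proof -
    have "\<not> E v (c m)" using ne[OF v(1) cV] v(2) by blast
    then have "v \<notin> B3 m" "v \<notin> B3 (m + 2)" "v \<notin> B3 (m + 3)" unfolding B3_def c_wrap by blast+
    moreover have "v = c m" if "v \<in> range c"
      using that inj[of m] v(2) unfolding c_cases[of v m] by metis
    ultimately show ?thesis using V v(1) B3_index5[of v _ m] by blast
  qed
  \<comment> \<open>Any index would do; naming it keeps \<open>i + k\<close> from being evaluated,
    so that the wrapping rules apply.\<close>
  define i :: nat where "i = 0"
  define X where "X = {b \<in> B3 (i + 2). \<forall>x\<in>B3 (i + 4). \<not> E b x}"
  let ?f1 = "\<lambda>v. if v \<in> X then f (c (i + 3)) else f v"
  let ?f2 = "\<lambda>v. if v \<in> B3 i then f (c (i + 1)) else ?f1 v"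
  have fin: "finite (B3 k)" for k using finite_subset[OF _ finV] B3_V by blast
  have r1: "reach V K f ?f1"
  proof (rule reach_recolor_set[OF _ f inK[OF cV]])
    show "finite X" using fin unfolding X_def by simp
    fix u v assume u: "u \<in> X" and v: "v \<in> V" "E u v"
    show "v \<notin> X \<and> f v \<noteq> f (c (i + 3))"
    proof
      show "v \<notin> X" using u v B3_indep unfolding X_def by blast
      show "f v \<noteq> f (c (i + 3))"
      proof
        assume "f v = f (c (i + 3))"
        with cls[OF v(1), of "i + 3"] have "v = c (i + 3) \<or> v \<in> B3 (i + 4) \<or> v \<in> B3 (i + 2)"
          unfolding B3_wrap by blast
        moreover have "\<not> E u (c (i + 3))" using u unfolding X_def B3_def c_wrap by blast
        ultimately show False using u v(2) B3_indep[of u "i + 2" v] unfolding X_def by blast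
      qed
    qed
  qed
  have r2: "reach V K ?f1 ?f2"
  proof (rule reach_recolor_set[OF fin reach_proper[OF r1 f] inK[OF cV]])
    fix u v assume u: "u \<in> B3 i" and v: "v \<in> V" "E u v"
    show "v \<notin> B3 i \<and> ?f1 v \<noteq> f (c (i + 1))"
    proof
      show "v \<notin> B3 i" using u v B3_indep by blast
      show "?f1 v \<noteq> f (c (i + 1))"
      proof (cases "v \<in> X")
        case True
        then show ?thesis using inj(2)[of "i + 1"] unfolding c_wrap by simp
      next
        case X: False
        have "f v \<noteq> f (c (i + 1))"
        proof
          assume "f v = f (c (i + 1))"
          with cls[OF v(1), of "i + 1"] have "v = c (i + 1) \<or> v \<in> B3 (i + 2) \<or> v \<in> B3 i"
            unfolding B3_wrap by blast
          moreover have "\<not> E u (c (i + 1))" using u unfolding B3_def by blast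
          ultimately have "v \<in> B3 (i + 2)" using u v(2) B3_indep[of u i v] by blast
          \<comment> \<open>Outside \<open>X\<close>, a vertex of \<open>B3 (i + 2)\<close> has a
            neighbour in \<open>B3 (i + 4)\<close>, so \<open>B3_triangle\<close> gives it none in
            \<open>B3 i\<close>, and it does not block the move.\<close>
          moreover from this X obtain x where "x \<in> B3 (i + 4)" "E v x" unfolding X_def by blast
          ultimately show False
            using B3_triangle[of v "i + 2" x u] u sym[OF v(2)] unfolding B3_wrap by blast
        qed
        with X show ?thesis by simp
      qed
    qed
  qed
  have f2: "proper V K ?f2" using reach_proper[OF r2 reach_proper[OF r1 f]] .
  have nB: "c m \<notin> B3 k" for m k using B_notin_C[of "c m" k] by blast
  have f2c: "?f2 (c m) = f (c m)" for m using nB unfolding X_def by simp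
  have "proper V K (?f2(c (i + 2) := f (c (i + 4))))"
  proof (rule proper_update[OF _ inK[OF cV]])
    show "proper (V - {c (i + 2)}) K ?f2" using proper_mono[OF f2] by blast
    fix v assume v: "v \<in> V" "E (c (i + 2)) v"
    show "?f2 v \<noteq> f (c (i + 4))"
    proof (cases "v \<in> B3 i \<or> v \<in> X")
      case True
      then show ?thesis using inj(3)[of "i + 1"] inj(1)[of "i + 3"] unfolding c_wrap by auto
    next
      case nX: False
      have "f v \<noteq> f (c (i + 4))"
      proof
        assume "f v = f (c (i + 4))"
        with cls[OF v(1), of "i + 4"] have "v = c (i + 4) \<or> v \<in> B3 i \<or> v \<in> B3 (i + 3)"
          unfolding B3_wrap by blast
        then have "v = c (i + 4) \<or> v \<in> B3 (i + 3)" using nX by blast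
        then show False using sym[OF v(2)] c_nonadj[of i] unfolding B3_def c_wrap by blast
      qed
      with nX show ?thesis by auto
    qed
  qed
  then have "step V K ?f2 (?f2(c (i + 2) := f (c (i + 4))))" using f2 unfolding step_def by auto
  then have "reach V K f (?f2(c (i + 2) := f (c (i + 4))))"
    using r1 r2 by (meson rtranclp.rtrancl_into_rtrancl rtranclp_trans)
  moreover have "(?f2(c (i + 2) := f (c (i + 4)))) (c (i + 2)) = (?f2(c (i + 2) := f (c (i + 4)))) (c (i + 2 + 2))"
    using f2c[of "i + 4"] unfolding c_wrap by simp
  ultimately show thesis using that by blast
qed

text \<open>The hypothesis concerns every 5-cycle and not just \<open>c\<close>, because
  \<open>A\<close> is shown to be empty by means of a cycle assembled from the classes
  \<open>B3 k\<close>. After that, either only the cycle is left or all classes are nonempty and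
  four colors are needed.\<close>

lemma recol_if_no_W5:
  assumes noW: "\<And>d w. C5 V d \<Longrightarrow> w \<in> V \<Longrightarrow> \<exists>i. \<not> E w (d i)"
  shows "recolorable_on V"
proof -
  have W: "W = {}" using noW[OF C5] W_iff by (metis ex_in_conv)
  \<comment> \<open>If \<open>b\<close> were complete to \<open>B3 (j + 2)\<close>, it would
    dominate \<open>c (j + 4)\<close>; with \<open>B3 (j + 3)\<close> it would dominate
    \<open>c (j + 1)\<close>.\<close>
  have non2: "\<exists>x\<in>B3 (j + 2). \<not> E b x" and non3: "\<exists>x\<in>B3 (j + 3). \<not> E b x" if b: "b \<in> B3 j" for b j
  proof -
    have nb: "c m \<noteq> b" for m using B_notin_C[of b j] b by blast
    have *: "x \<in> B3 (j + 2) \<or> x \<in> B3 (j + 3)" if x: "x \<in> V" "\<not> E b x" "\<not> E x b" "E x (c (j + 1)) \<or> E x (c (j + 4))" for x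
    proof -
      have "x \<notin> range c"
        using x b c_nonadj[of j] irrefl sym[of b] unfolding B3_def c_cases[of x j] by blast
      then obtain k where "x \<in> B3 k" using types[OF x(1)] W x(4) unfolding A_iff by blast
      then have "x \<in> B3 j \<or> x \<in> B3 (j + 1) \<or> x \<in> B3 (j + 2) \<or> x \<in> B3 (j + 3) \<or> x \<in> B3 (j + 4)"
        by (rule B3_index5)
      moreover have "x \<notin> B3 j" using x(4) unfolding B3_def by blast
      moreover have "x \<notin> B3 (j + 1)" using B3_next[OF b] x by blast
      moreover have "x \<notin> B3 (j + 4)" using B3_next[of x "j + 4" b] b x unfolding B3_wrap by blast
      ultimately show ?thesis by blast
    qed
    obtain x where x: "x \<in> V" "E x (c (j + 4))" "\<not> E b x" "\<not> E x b"
      using not_comparable[OF cV B3_V[OF b] nb, of "j + 4"] by metis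
    then have "x \<in> B3 (j + 2)" using *[of x] unfolding B3_def c_wrap by blast
    with x show "\<exists>x\<in>B3 (j + 2). \<not> E b x" by blast
    obtain x where x: "x \<in> V" "E x (c (j + 1))" "\<not> E b x" "\<not> E x b"
      using not_comparable[OF cV B3_V[OF b] nb, of "j + 1"] by metis
    then have "x \<in> B3 (j + 3)" using *[of x] unfolding B3_def c_wrap by blast
    with x show "\<exists>x\<in>B3 (j + 3). \<not> E b x" by blast
  qed
  \<comment> \<open>Steps of length two visit all five indices.\<close>
  have nonempty: "B3 k \<noteq> {}" if b: "B3 i \<noteq> {}" for i k
  proof -
    have s: "B3 (j + 2) \<noteq> {}" if "B3 j \<noteq> {}" for j using non2 that by blast
    have "B3 (i + 2) \<noteq> {}" using s b by blast
    moreover from this have "B3 (i + 4) \<noteq> {}" using s[of "i + 2"] unfolding B3_wrap by blast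
    moreover from this have "B3 (i + 1) \<noteq> {}" using s[of "i + 4"] unfolding B3_wrap by blast
    moreover from this have "B3 (i + 3) \<noteq> {}" using s[of "i + 1"] unfolding B3_wrap by blast
    ultimately show ?thesis using B3_index[of k i] b by metis
  qed
  \<comment> \<open>By \<open>2K_2\<close>-freeness the sets \<open>N y\<close> are nested, and by
    \<open>non3\<close> every vertex of \<open>B3 (j + 2)\<close> lies in one of them. A maximal one
    is therefore all of \<open>B3 (j + 2)\<close>.\<close>
  have extremal: "\<exists>y\<in>B3 j. \<forall>x\<in>B3 (j + 2). \<not> E y x" if ne: "B3 j \<noteq> {}" for j
  proof -
    define N where "N y = {x \<in> B3 (j + 2). \<not> E y x}" for y
    have "finite (N ` B3 j)" "N ` B3 j \<noteq> {}"
      using finite_subset[OF _ finV, of "B3 j"] B3_V ne by auto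
    from finite_has_maximal[OF this] obtain y where y: "y \<in> B3 j" and max: "\<And>b. b \<in> B3 j \<Longrightarrow> N y \<subseteq> N b \<Longrightarrow> N y = N b"
      by blast
    have False if x: "x \<in> B3 (j + 2)" "E y x" for x
    proof -
      obtain b where b: "b \<in> B3 j" "\<not> E x b" using non3[OF x(1)] unfolding B3_wrap by blast
      have "x \<in> N b" "x \<notin> N y" using x b sym unfolding N_def by blast+
      then obtain d where d: "d \<in> N y" "d \<notin> N b" using max[OF b(1)] by blast
      then have d: "d \<in> B3 (j + 2)" "\<not> E y d" "E b d" unfolding N_def by blast+
      show False
        using two_K2D[OF two_K2 B3_V[OF y] B3_V[OF x(1)] B3_V[OF b(1)] B3_V[OF d(1)] x(2) d(3)]
          b d B3_indep[OF y b(1)] B3_indep[OF x(1) d(1)] by blast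
    qed
    with y show ?thesis by blast
  qed
  have A: False if a: "a \<in> A" for a
  proof -
    obtain i b where b: "b \<in> B3 i" "E a b" using A_neighbour[OF a] by blast
    \<comment> \<open>One extremal vertex per class gives an induced 5-cycle, to which
      \<open>a\<close> turns out to be complete since its adjacency spreads in steps of two. The
      choice depends only on the sets \<open>B3 k\<close> and \<open>B3 (k + 2)\<close>, which makes
      \<open>y\<close> periodic.\<close>
    define y where "y k = (SOME y. y \<in> B3 k \<and> (\<forall>x\<in>B3 (k + 2). \<not> E y x))" for k
    have y: "y k \<in> B3 k" "x \<in> B3 (k + 2) \<Longrightarrow> \<not> E (y k) x" for k x
    proof -
      have "\<exists>z. z \<in> B3 k \<and> (\<forall>x\<in>B3 (k + 2). \<not> E z x)" using extremal[OF nonempty, of i k] b(1) by blast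
      from someI_ex[OF this] show "y k \<in> B3 k" "x \<in> B3 (k + 2) \<Longrightarrow> \<not> E (y k) x"
        unfolding y_def by blast+
    qed
    have per: "y (k + 5) = y k" for k
    proof -
      have "k + 5 + 2 = k + 2 + 5" by simp
      then have "B3 (k + 5 + 2) = B3 (k + 2)" using B_period(2)[of "k + 2"] by metis
      then show ?thesis unfolding y_def B_period(2) by simp
    qed
    have "C5 V y" unfolding C5_def
      using y B3_V per B3_next by blast
    moreover have "E a (y k)" for k
    proof -
      have s: "E a (y (k + 2))" if "E a (y k)" for k
        using A_spread[OF a y(1) that y(1) y(2)[OF y(1)]] .
      have "\<not> E b (y (i + 3))" using y(2)[of b "i + 3"] b(1) sym unfolding B3_wrap by blast
      then have 3: "E a (y (i + 3))" using A_spread'[OF a b(1) b(2) y(1)] by blast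
      note w = period5_wrap[of y, OF per]
      have 0: "E a (y i)" using s[OF 3] unfolding w .
      have 2: "E a (y (i + 2))" using s[OF 0] .
      have 4: "E a (y (i + 4))" using s[OF 2] unfolding w .
      have 1: "E a (y (i + 1))" using s[OF 4] unfolding w .
      show ?thesis using period5_index[of y k i, OF per] 0 1 2 3 4 by metis
    qed
    moreover have "a \<in> V" using a unfolding A_iff by blast
    ultimately show False using noW by blast
  qed
  have V: "V \<subseteq> range c \<union> (\<Union>k. B3 k)"
  proof
    fix v assume "v \<in> V"
    from types[OF this] A[of v] W show "v \<in> range c \<union> (\<Union>k. B3 k)" by blast
  qed
  show ?thesis
  proof (cases "\<exists>i. B3 i \<noteq> {}")
    case False
    then show ?thesis using V by (intro recol_if_cycle) blast
  next
    case True
    then have "\<forall>k. \<exists>b. b \<in> B3 k" using nonempty by blast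
    then obtain b where b: "\<And>k. b k \<in> B3 k" by metis
    have n3: "\<not> colorable V 3"
    proof
      assume "colorable V 3"
      then obtain f where f: "proper V {..<3} f" unfolding colorable_def by blast
      have lt: "f v < 3" if "v \<in> V" for v using f that unfolding proper_def by auto
      have ne: "f u \<noteq> f v" if "u \<in> V" "v \<in> V" "E u v" for u v using f that unfolding proper_def by auto
      \<comment> \<open>The vertex \<open>b k\<close> and the edge opposite to \<open>c k\<close>
        use up all three colors, so \<open>c k\<close> repeats a color of that edge. But a
        3-coloring of a 5-cycle uses some color only once.\<close>
      have eq: "f (c k) = f (c (k + 2)) \<or> f (c k) = f (c (k + 3))" for k
      proof -
        have "E (b k) (c k)" "E (b k) (c (k + 2))" "E (b k) (c (k + 3))"
          using b[of k] unfolding B3_def by blast+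
        then have "f (b k) \<noteq> f (c k)" "f (b k) \<noteq> f (c (k + 2))" "f (b k) \<noteq> f (c (k + 3))"
          using ne[OF B3_V[OF b] cV] by blast+
        moreover have "f (c (k + 2)) \<noteq> f (c (k + 3))" using ne[OF cV cV] c_adj[of k] by blast
        ultimately show ?thesis
          using lt[OF B3_V[OF b[of k]]] lt[OF cV, of k] lt[OF cV, of "k + 2"] lt[OF cV, of "k + 3"] by linarith
      qed
      have n: "f (c k) \<noteq> f (c (k + 1))" for k using ne[OF cV cV] c_adj[of k] by blast
      note e = eq[of 0] eq[of "0 + 1"] eq[of "0 + 2"] eq[of "0 + 3"] eq[of "0 + 4"]
      note n = n[of 0] n[of "0 + 1"] n[of "0 + 2"] n[of "0 + 3"] n[of "0 + 4"]
      show False using e[unfolded c_wrap, unfolded add_0] n[unfolded c_wrap, unfolded add_0] by argo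
    qed
    show ?thesis
    proof (rule recol_if_good_class[OF finV IH n3])
      fix K :: "nat set" and f assume K: "finite K" "3 + 2 \<le> card K" and f: "proper V K f"
      obtain g j where g: "reach V K f g" "g (c j) = g (c (j + 2))"
        using merge_on_cycle[OF V f] by blast
      obtain h S where h: "reach V K g h" "maxind V S" "{u \<in> V. g u = g (c j)} \<subseteq> S"
          "\<And>s. s \<in> S \<Longrightarrow> h s = g (c j)"
        using extend_class[OF finV reach_proper[OF g(1) f] cV] by metis
      note max = maxindD[OF h(2)]
      have cS: "c j \<in> S" "c (j + 2) \<in> S" using h(3) g(2) cV by auto
      have sub: "s = c j \<or> s = c (j + 2) \<or> s \<in> B3 (j + 1)" if s: "s \<in> S" for s
      proof -
        have n: "\<not> E s (c j)" "\<not> E s (c (j + 2))" using max(2) s cS by blast+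
        show ?thesis
        proof (cases "s \<in> range c")
          case True
          then show ?thesis using n c_adj[of j] unfolding c_cases[of s j] by blast
        next
          case False
          then obtain k where "s \<in> B3 k" using V max(1) s by blast
          then have "s \<in> B3 j \<or> s \<in> B3 (j + 1) \<or> s \<in> B3 (j + 2) \<or> s \<in> B3 (j + 3) \<or> s \<in> B3 (j + 4)"
            by (rule B3_index5)
          then show ?thesis using n unfolding B3_def c_wrap by blast
        qed
      qed
      have "B3 (j + 1) \<subseteq> S"
      proof
        fix v assume v: "v \<in> B3 (j + 1)"
        then have n: "\<not> E (c j) v" "\<not> E (c (j + 2)) v"
          using sym_iff[of v "c j"] sym_iff[of v "c (j + 2)"] unfolding B3_def c_wrap by blast+
        show "v \<in> S"
        proof (rule max(3)[OF B3_V[OF v]])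
          fix s assume "s \<in> S"
          from sub[OF this] show "\<not> E s v" using n B3_indep v by blast
        qed
      qed
      \<comment> \<open>For \<open>i = j + 1\<close> the vertices \<open>c (i + 4)\<close> and
        \<open>c (i + 1)\<close> of \<open>colorable_rest\<close> are \<open>c j\<close> and
        \<open>c (j + 2)\<close>.\<close>
      then have "colorable (V - S) 3"
        using colorable_rest[OF V, of "j + 1" S] cS unfolding c_wrap by blast
      then have "colorable (V - S) (card K - 2)"
        using K(2) colorable_mono[of "V - S" 3 "V - S" "card K - 2"] by auto
      moreover have "reach V K f h" using g(1) h(1) by (meson rtranclp_trans)
      ultimately show "\<exists>g S x. reach V K f g \<and> maxind V S \<and> S \<noteq> {} \<and> (\<forall>s\<in>S. g s = x) \<and>
          colorable (V - S) (card K - 2)"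
        using h(2,4) cS by blast
    qed
  qed
qed

end

context C5_graph begin

text \<open>If some vertex is complete to an induced 5-cycle, that cycle takes the place of
  \<open>c\<close>; otherwise \<open>recol_if_no_W5\<close> applies to \<open>c\<close>
  itself.\<close>

lemma recol_H2_H4_free:
  assumes "H2_free V" "H4_free V"
  shows "recolorable_on V"
proof (cases "\<exists>d w. C5 V d \<and> w \<in> V \<and> (\<forall>i. E w (d i))")
  case True
  then obtain d w where d: "C5 V d" "w \<in> V" "\<And>i. E w (d i)" by blast
  interpret D: C5_H3_graph E V d
    by unfold_locales (use finV two_K2 K4 d(1) incomp IH assms in auto)
  show ?thesis using D.recol_if_W[of w] d unfolding D.W_iff by blast
next
  case False
  interpret D: C5_H3_graph E V c
    by unfold_locales (use assms in auto)
  show ?thesis using D.recol_if_no_W5 False by blast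
qed

end

section \<open>Graphs without an induced 5-cycle\<close>

context sgraph begin

text \<open>For \<open>n = 6\<close> and \<open>n = 7\<close> this says that \<open>q\<close> runs through an induced \<open>n\<close>-cycle of the complement.\<close>

definition antihole :: "nat \<Rightarrow> 'a set \<Rightarrow> (nat \<Rightarrow> 'a) \<Rightarrow> bool" where
  "antihole n V q \<longleftrightarrow> (\<forall>i. q i \<in> V \<and> q (i + n) = q i \<and> \<not> E (q i) (q (i + 1)) \<and>
     E (q i) (q (i + 2)) \<and> E (q i) (q (i + 3)))"

lemma antihole6I:
  assumes "{a, b, c, d, e, f} \<subseteq> V" "\<not> E a b" "\<not> E b c" "\<not> E c d" "\<not> E d e" "\<not> E e f" "\<not> E f a"
    and "E a c" "E a d" "E b d" "E b e" "E c e" "E c f" "E d f" "E e a" "E f b"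
  obtains q where "antihole 6 V q"
proof
  let ?q = "\<lambda>n::nat. if n mod 6 = 0 then a else if n mod 6 = 1 then b else if n mod 6 = 2 then c else if n mod 6 = 3 then d else if n mod 6 = 4 then e else f"
  have s: "E d a" "E e b" "E f c" using assms sym by blast+
  show "antihole 6 V ?q" unfolding antihole_def
  proof
    fix i :: nat
    have *: "(i + k) mod 6 = (i mod 6 + k) mod 6" for k by (simp only: mod_add_left_eq)
    have "i mod 6 < 6" by simp
    then have "i mod 6 = 0 \<or> i mod 6 = 1 \<or> i mod 6 = 2 \<or> i mod 6 = 3 \<or> i mod 6 = 4 \<or> i mod 6 = 5" by linarith
    then show "?q i \<in> V \<and> ?q (i + 6) = ?q i \<and> \<not> E (?q i) (?q (i + 1)) \<and>
        E (?q i) (?q (i + 2)) \<and> E (?q i) (?q (i + 3))"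
      unfolding *[of 1] *[of 2] *[of 3] *[of 6] using assms s by (elim disjE) simp_all
  qed
qed

lemma antihole7I:
  assumes "{a, b, c, d, e, f, g} \<subseteq> V" "\<not> E a b" "\<not> E b c" "\<not> E c d" "\<not> E d e" "\<not> E e f" "\<not> E f g" "\<not> E g a"
    and "E a c" "E a d" "E b d" "E b e" "E c e" "E c f" "E d f" "E d g" "E e g" "E e a" "E f a" "E f b" "E g b" "E g c"
  obtains q where "antihole 7 V q"
proof
  let ?q = "\<lambda>n::nat. if n mod 7 = 0 then a else if n mod 7 = 1 then b else if n mod 7 = 2 then c else if n mod 7 = 3 then d else if n mod 7 = 4 then e else if n mod 7 = 5 then f else g"
  have s: "True" using assms sym by blast+
  show "antihole 7 V ?q" unfolding antihole_def
  proof
    fix i :: nat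
    have *: "(i + k) mod 7 = (i mod 7 + k) mod 7" for k by (simp only: mod_add_left_eq)
    have "i mod 7 < 7" by simp
    then have "i mod 7 = 0 \<or> i mod 7 = 1 \<or> i mod 7 = 2 \<or> i mod 7 = 3 \<or> i mod 7 = 4 \<or> i mod 7 = 5 \<or> i mod 7 = 6" by linarith
    then show "?q i \<in> V \<and> ?q (i + 7) = ?q i \<and> \<not> E (?q i) (?q (i + 1)) \<and>
        E (?q i) (?q (i + 2)) \<and> E (?q i) (?q (i + 3))"
      unfolding *[of 1] *[of 2] *[of 3] *[of 7] using assms s by (elim disjE) simp_all
  qed
qed

end

section \<open>Growing an induced path in the complement\<close>

locale C5_free_graph = sgraph +
  fixes V :: "'a set"
  assumes finV: "finite V" and two_K2: "two_K2_free V" and K4: "K4_free V" and noC5: "\<And>c. \<not> C5 V c"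
begin

text \<open>The complement of the 4-cycle \<open>a b c d\<close> is a \<open>2K_2\<close> with edges
  \<open>a c\<close> and \<open>b d\<close>.\<close>

lemma no_co_C4:
  assumes "{a, b, c, d} \<subseteq> V" "\<not> E a b" "\<not> E b c" "\<not> E c d" "\<not> E d a" "E a c" "E b d"
  shows False
  using two_K2D[OF two_K2, of a c b d] assms sym by blast

text \<open>The 5-cycle is self-complementary: in the order \<open>a c e b d\<close> the vertices
  form an induced 5-cycle of the graph itself.\<close>

lemma no_co_C5:
  assumes "{a, b, c, d, e} \<subseteq> V" "\<not> E a b" "\<not> E b c" "\<not> E c d" "\<not> E d e" "\<not> E e a"
    and "E a c" "E b d" "E c e" "E d a" "E e b"
  shows False
proof -
  have "\<not> E a e" "\<not> E c b" "\<not> E e d" "\<not> E b a" "\<not> E d c" using assms(2-6) sym by blast+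
  then show False using C5I[of a c e b d V] assms noC5 by auto
qed

text \<open>By incomparability there is always a next vertex, adjacent to the last but one vertex of
  the path and not to the last. The two preceding lemmas prevent the path from closing up at length
  four or five. If it does not close at length six, \<open>K_4\<close>-freeness closes it at length
  seven.\<close>

lemma antihole_if_incomparable:
  assumes incomp: "incomparable V" and uv: "u \<in> V" "v \<in> V" "u \<noteq> v" "\<not> E u v"
  obtains q where "antihole 6 V q" | q where "antihole 7 V q"
proof -
  have ext: "\<exists>x\<in>V. E p x \<and> \<not> E h x" if "p \<in> V" "h \<in> V" "h \<noteq> p" for p h
    using incomparableD[OF incomp] that by blast
  obtain w where w: "w \<in> V" "E u w" "\<not> E v w" using ext[of u v] uv by blast
  obtain x where x: "x \<in> V" "E v x" "\<not> E w x" using ext[of v w] uv w by blast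
  have ux: "E u x" using no_co_C4[of u v w x] uv w x sym by blast
  obtain y where y: "y \<in> V" "E w y" "\<not> E x y" using ext[of w x] w x uv by blast
  have vy: "E v y" using no_co_C4[of v w x y] uv w x y sym by blast
  have uy: "E u y" using no_co_C5[of u v w x y] uv w x y ux vy sym by blast
  obtain z where z: "z \<in> V" "E x z" "\<not> E y z" using ext[of x y] x y w by blast
  have wz: "E w z" using no_co_C4[of w x y z] w x y z sym by blast
  have vz: "E v z" using no_co_C5[of v w x y z] uv w x y z vy wz sym by blast
  show thesis
  proof (cases "E z u")
    case False
    then show thesis
      using antihole6I[of u v w x y z V] that(1) uv w x y z ux vy uy wz vz sym by auto
  next
    case zu: True
    obtain t where t: "t \<in> V" "E y t" "\<not> E z t" using ext[of y z] x y z by blast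
    have xt: "E x t" using no_co_C4[of x y z t] x y z t sym by blast
    have wt: "E w t" using no_co_C5[of w x y z t] w x y z t wz xt sym by blast
    show thesis
    proof (cases "E t v")
      case False
      then show thesis
        using antihole6I[of v w x y z t V] that(1) uv w x y z t vy wz vz xt wt sym by auto
    next
      case tv: True
      \<comment> \<open>\<open>u\<close>, \<open>w\<close>, \<open>y\<close> form a triangle and
        \<open>t\<close> sees \<open>w\<close> and \<open>y\<close>.\<close>
      have "\<not> E u t"
        using K4D[OF K4, of u w y t] uv w x y t uy wt sym by blast
      then show thesis
        using antihole7I[of u v w x y z t V] that(2) uv w x y z t ux vy uy wz vz xt wt zu tv sym by auto
    qed
  qed
qed

end

section \<open>Attachments to induced 6-cycles and 7-cycles of the complement\<close>

locale antihole6 = C5_free_graph +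
  fixes q :: "nat \<Rightarrow> 'a"
  assumes hole: "antihole 6 V q" and incomp: "incomparable V" and no7: "\<And>r. \<not> antihole 7 V r"
begin

lemma qV [simp]: "q i \<in> V" and q_period: "q (i + 6) = q i"
  using hole unfolding antihole_def by blast+

lemmas q_wrap = period6_wrap[of q, OF q_period]
lemmas q_index = period6_index[of q, OF q_period]

lemma q_adj:
  "E (q i) (q (i + 2))" "E (q i) (q (i + 3))" "E (q i) (q (i + 4))" "E (q (i + 1)) (q (i + 3))"
  "E (q (i + 1)) (q (i + 4))" "E (q (i + 1)) (q (i + 5))" "E (q (i + 2)) (q i)"
  "E (q (i + 2)) (q (i + 4))" "E (q (i + 2)) (q (i + 5))" "E (q (i + 3)) (q i)"
  "E (q (i + 3)) (q (i + 1))" "E (q (i + 3)) (q (i + 5))" "E (q (i + 4)) (q i)"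
  "E (q (i + 4)) (q (i + 1))" "E (q (i + 4)) (q (i + 2))" "E (q (i + 5)) (q (i + 1))"
  "E (q (i + 5)) (q (i + 2))" "E (q (i + 5)) (q (i + 3))"
  and q_nonadj:
  "\<not> E (q i) (q (i + 1))" "\<not> E (q i) (q (i + 5))" "\<not> E (q (i + 1)) (q i)"
  "\<not> E (q (i + 1)) (q (i + 2))" "\<not> E (q (i + 2)) (q (i + 1))"
  "\<not> E (q (i + 2)) (q (i + 3))" "\<not> E (q (i + 3)) (q (i + 2))"
  "\<not> E (q (i + 3)) (q (i + 4))" "\<not> E (q (i + 4)) (q (i + 3))"
  "\<not> E (q (i + 4)) (q (i + 5))" "\<not> E (q (i + 5)) (q i)"
  "\<not> E (q (i + 5)) (q (i + 4))"
proof -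
  have "E (q j) (q (j + 2))" "E (q j) (q (j + 3))" "\<not> E (q j) (q (j + 1))" for j
    using hole unfolding antihole_def by blast+
  note * = this[of i] this[of "i + 1"] this[of "i + 2"] this[of "i + 3"] this[of "i + 4"] this[of "i + 5"]
  show
  "E (q i) (q (i + 2))" "E (q i) (q (i + 3))" "E (q i) (q (i + 4))" "E (q (i + 1)) (q (i + 3))"
  "E (q (i + 1)) (q (i + 4))" "E (q (i + 1)) (q (i + 5))" "E (q (i + 2)) (q i)"
  "E (q (i + 2)) (q (i + 4))" "E (q (i + 2)) (q (i + 5))" "E (q (i + 3)) (q i)"
  "E (q (i + 3)) (q (i + 1))" "E (q (i + 3)) (q (i + 5))" "E (q (i + 4)) (q i)"
  "E (q (i + 4)) (q (i + 1))" "E (q (i + 4)) (q (i + 2))" "E (q (i + 5)) (q (i + 1))"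
  "E (q (i + 5)) (q (i + 2))" "E (q (i + 5)) (q (i + 3))"
  "\<not> E (q i) (q (i + 1))" "\<not> E (q i) (q (i + 5))" "\<not> E (q (i + 1)) (q i)"
  "\<not> E (q (i + 1)) (q (i + 2))" "\<not> E (q (i + 2)) (q (i + 1))"
  "\<not> E (q (i + 2)) (q (i + 3))" "\<not> E (q (i + 3)) (q (i + 2))"
  "\<not> E (q (i + 3)) (q (i + 4))" "\<not> E (q (i + 4)) (q (i + 3))"
  "\<not> E (q (i + 4)) (q (i + 5))" "\<not> E (q (i + 5)) (q i)"
  "\<not> E (q (i + 5)) (q (i + 4))"
    using *[unfolded q_wrap] by (blast intro: sym dest: sym)+
qed

end

locale antihole7 = C5_free_graph +
  fixes q :: "nat \<Rightarrow> 'a"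
  assumes hole: "antihole 7 V q"
begin

lemma qV [simp]: "q i \<in> V" and q_period: "q (i + 7) = q i"
  using hole unfolding antihole_def by blast+

lemmas q_wrap = period7_wrap[of q, OF q_period]
lemmas q_index = period7_index[of q, OF q_period]

lemma q_adj:
  "E (q i) (q (i + 2))" "E (q i) (q (i + 3))" "E (q i) (q (i + 4))" "E (q i) (q (i + 5))"
  "E (q (i + 1)) (q (i + 3))" "E (q (i + 1)) (q (i + 4))" "E (q (i + 1)) (q (i + 5))"
  "E (q (i + 1)) (q (i + 6))" "E (q (i + 2)) (q i)" "E (q (i + 2)) (q (i + 4))"
  "E (q (i + 2)) (q (i + 5))" "E (q (i + 2)) (q (i + 6))" "E (q (i + 3)) (q i)"
  "E (q (i + 3)) (q (i + 1))" "E (q (i + 3)) (q (i + 5))" "E (q (i + 3)) (q (i + 6))"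
  "E (q (i + 4)) (q i)" "E (q (i + 4)) (q (i + 1))" "E (q (i + 4)) (q (i + 2))"
  "E (q (i + 4)) (q (i + 6))" "E (q (i + 5)) (q i)" "E (q (i + 5)) (q (i + 1))"
  "E (q (i + 5)) (q (i + 2))" "E (q (i + 5)) (q (i + 3))" "E (q (i + 6)) (q (i + 1))"
  "E (q (i + 6)) (q (i + 2))" "E (q (i + 6)) (q (i + 3))" "E (q (i + 6)) (q (i + 4))"
  and q_nonadj:
  "\<not> E (q i) (q (i + 1))" "\<not> E (q i) (q (i + 6))" "\<not> E (q (i + 1)) (q i)"
  "\<not> E (q (i + 1)) (q (i + 2))" "\<not> E (q (i + 2)) (q (i + 1))"
  "\<not> E (q (i + 2)) (q (i + 3))" "\<not> E (q (i + 3)) (q (i + 2))"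
  "\<not> E (q (i + 3)) (q (i + 4))" "\<not> E (q (i + 4)) (q (i + 3))"
  "\<not> E (q (i + 4)) (q (i + 5))" "\<not> E (q (i + 5)) (q (i + 4))"
  "\<not> E (q (i + 5)) (q (i + 6))" "\<not> E (q (i + 6)) (q i)"
  "\<not> E (q (i + 6)) (q (i + 5))"
proof -
  have "E (q j) (q (j + 2))" "E (q j) (q (j + 3))" "\<not> E (q j) (q (j + 1))" for j
    using hole unfolding antihole_def by blast+
  note * = this[of i] this[of "i + 1"] this[of "i + 2"] this[of "i + 3"] this[of "i + 4"] this[of "i + 5"] this[of "i + 6"]
  show
  "E (q i) (q (i + 2))" "E (q i) (q (i + 3))" "E (q i) (q (i + 4))" "E (q i) (q (i + 5))"
  "E (q (i + 1)) (q (i + 3))" "E (q (i + 1)) (q (i + 4))" "E (q (i + 1)) (q (i + 5))"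
  "E (q (i + 1)) (q (i + 6))" "E (q (i + 2)) (q i)" "E (q (i + 2)) (q (i + 4))"
  "E (q (i + 2)) (q (i + 5))" "E (q (i + 2)) (q (i + 6))" "E (q (i + 3)) (q i)"
  "E (q (i + 3)) (q (i + 1))" "E (q (i + 3)) (q (i + 5))" "E (q (i + 3)) (q (i + 6))"
  "E (q (i + 4)) (q i)" "E (q (i + 4)) (q (i + 1))" "E (q (i + 4)) (q (i + 2))"
  "E (q (i + 4)) (q (i + 6))" "E (q (i + 5)) (q i)" "E (q (i + 5)) (q (i + 1))"
  "E (q (i + 5)) (q (i + 2))" "E (q (i + 5)) (q (i + 3))" "E (q (i + 6)) (q (i + 1))"
  "E (q (i + 6)) (q (i + 2))" "E (q (i + 6)) (q (i + 3))" "E (q (i + 6)) (q (i + 4))"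
  "\<not> E (q i) (q (i + 1))" "\<not> E (q i) (q (i + 6))" "\<not> E (q (i + 1)) (q i)"
  "\<not> E (q (i + 1)) (q (i + 2))" "\<not> E (q (i + 2)) (q (i + 1))"
  "\<not> E (q (i + 2)) (q (i + 3))" "\<not> E (q (i + 3)) (q (i + 2))"
  "\<not> E (q (i + 3)) (q (i + 4))" "\<not> E (q (i + 4)) (q (i + 3))"
  "\<not> E (q (i + 4)) (q (i + 5))" "\<not> E (q (i + 5)) (q (i + 4))"
  "\<not> E (q (i + 5)) (q (i + 6))" "\<not> E (q (i + 6)) (q i)"
  "\<not> E (q (i + 6)) (q (i + 5))"
    using *[unfolded q_wrap] by (blast intro: sym dest: sym)+
qed

end

context antihole6 begin

text \<open>A single neighbour of \<open>v\<close> between two non-neighbours closes a 4-cycle of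
  the complement, and in \<open>gap3\<close> two of them close a 5-cycle. So a run of neighbours
  enclosed by distinct non-neighbours has length at least three.\<close>

lemma gap2: "v \<in> V \<Longrightarrow> \<not> E v (q i) \<Longrightarrow> \<not> E v (q (i + 2)) \<Longrightarrow> \<not> E v (q (i + 1))"
  using no_co_C4[of v "q i" "q (i + 1)" "q (i + 2)"] q_adj[of i] q_nonadj[of i] sym by auto

lemma gap3:
  "v \<in> V \<Longrightarrow> \<not> E v (q i) \<Longrightarrow> \<not> E v (q (i + 3)) \<Longrightarrow> E v (q (i + 1)) \<Longrightarrow> \<not> E v (q (i + 2))"
  using no_co_C5[of v "q i" "q (i + 1)" "q (i + 2)" "q (i + 3)"] q_adj[of i] q_nonadj[of i] sym by auto

lemma no_triple: "v \<in> V \<Longrightarrow> \<not> (E v (q i) \<and> E v (q (i + 2)) \<and> E v (q (i + 4)))"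
  using K4D[OF K4, of v "q i" "q (i + 2)" "q (i + 4)"] q_adj[of i] by auto

text \<open>The vertices attached like \<open>q (i + 1)\<close>, which itself belongs to
  \<open>T i\<close>.\<close>

definition T :: "nat \<Rightarrow> 'a set" where
  "T i = {v \<in> V. \<not> E v (q i) \<and> \<not> E v (q (i + 1)) \<and> \<not> E v (q (i + 2)) \<and> E v (q (i + 3)) \<and> E v (q (i + 4)) \<and> E v (q (i + 5))}"

definition P :: "nat \<Rightarrow> 'a set" where
  "P i = {v \<in> V. \<not> E v (q i) \<and> \<not> E v (q (i + 1)) \<and> E v (q (i + 2)) \<and> E v (q (i + 3)) \<and> E v (q (i + 4)) \<and> E v (q (i + 5))}"

definition U :: "'a set" where
  "U = {v \<in> V. \<not> E v (q 0) \<and> \<not> E v (q 1) \<and> \<not> E v (q 2) \<and> \<not> E v (q 3) \<and> \<not> E v (q 4) \<and> \<not> E v (q 5)}"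

lemma U_nonadj: "v \<in> U \<Longrightarrow> \<not> E v (q i)"
  using q_index[of i 0] unfolding U_def add_0 by (elim disjE) auto

lemma T_period: "T (i + 6) = T i"
proof -
  have "q (i + 6 + k) = q (i + k)" for k
  proof -
    have "i + 6 + k = i + k + 6" by simp
    then show ?thesis using q_period[of "i + k"] by metis
  qed
  then show ?thesis unfolding T_def by (simp_all only: q_period)
qed

lemmas T_wrap = period6_wrap[of T, OF T_period]

lemma T_index:
  "v \<in> T k \<Longrightarrow> v \<in> T i \<or> v \<in> T (i + 1) \<or> v \<in> T (i + 2) \<or> v \<in> T (i + 3) \<or> v \<in> T (i + 4) \<or> v \<in> T (i + 5)"
  using period6_index[of T k i, OF T_period] by blast

lemma T_V: "v \<in> T i \<Longrightarrow> v \<in> V"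
  unfolding T_def by blast

lemma P_period: "P (i + 6) = P i"
proof -
  have "q (i + 6 + k) = q (i + k)" for k
  proof -
    have "i + 6 + k = i + k + 6" by simp
    then show ?thesis using q_period[of "i + k"] by metis
  qed
  then show ?thesis unfolding P_def by (simp_all only: q_period)
qed

lemmas P_wrap = period6_wrap[of P, OF P_period]

text \<open>Enclosed runs of neighbours have length at least three, and \<open>no_triple\<close>
  excludes five or six neighbours. On six positions this leaves no neighbour, one run of three
  (\<open>T\<close>) or one run of four (\<open>P\<close>).\<close>

lemma types:
  assumes "v \<in> V"
  shows "v \<in> U \<or> (\<exists>i. v \<in> T i) \<or> (\<exists>i. v \<in> P i)"
proof -
  have g2: "\<not> E v (q i) \<longrightarrow> \<not> E v (q (i + 2)) \<longrightarrow> \<not> E v (q (i + 1))" for i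
    using gap2[OF assms] by blast
  have g3: "\<not> E v (q i) \<longrightarrow> \<not> E v (q (i + 3)) \<longrightarrow> E v (q (i + 1)) \<longrightarrow> \<not> E v (q (i + 2))" for i
    using gap3[OF assms] by blast
  note g2 = g2[of 0] g2[of "0 + 1"] g2[of "0 + 2"] g2[of "0 + 3"] g2[of "0 + 4"] g2[of "0 + 5"]
  note g3 = g3[of 0] g3[of "0 + 1"] g3[of "0 + 2"] g3[of "0 + 3"] g3[of "0 + 4"] g3[of "0 + 5"]
  note t = no_triple[OF assms]
  note t = t[of 0] t[of "0 + 1"] t[of "0 + 2"] t[of "0 + 3"] t[of "0 + 4"] t[of "0 + 5"]
  note defs = T_def[of 0] T_def[of "0 + 1"] T_def[of "0 + 2"] T_def[of "0 + 3"] T_def[of "0 + 4"] T_def[of "0 + 5"] P_def[of 0] P_def[of "0 + 1"] P_def[of "0 + 2"] P_def[of "0 + 3"] P_def[of "0 + 4"] P_def[of "0 + 5"]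
  have "v \<in> U \<or> v \<in> T 0 \<or> v \<in> T 1 \<or> v \<in> T 2 \<or> v \<in> T 3 \<or> v \<in> T 4 \<or> v \<in> T 5 \<or> v \<in> P 0 \<or> v \<in> P 1 \<or> v \<in> P 2 \<or> v \<in> P 3 \<or> v \<in> P 4 \<or> v \<in> P 5"
    unfolding U_def defs[unfolded q_wrap, unfolded add_0] mem_Collect_eq
    using g2[unfolded q_wrap, unfolded add_0] g3[unfolded q_wrap, unfolded add_0]
      t[unfolded q_wrap, unfolded add_0] assms by argo
  then show ?thesis by blast
qed

end

context antihole7 begin

lemma gap2: "v \<in> V \<Longrightarrow> \<not> E v (q i) \<Longrightarrow> \<not> E v (q (i + 2)) \<Longrightarrow> \<not> E v (q (i + 1))"
  using no_co_C4[of v "q i" "q (i + 1)" "q (i + 2)"] q_adj[of i] q_nonadj[of i] sym by auto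

lemma gap3:
  "v \<in> V \<Longrightarrow> \<not> E v (q i) \<Longrightarrow> \<not> E v (q (i + 3)) \<Longrightarrow> E v (q (i + 1)) \<Longrightarrow> \<not> E v (q (i + 2))"
  using no_co_C5[of v "q i" "q (i + 1)" "q (i + 2)" "q (i + 3)"] q_adj[of i] q_nonadj[of i] sym by auto

lemma no_triple: "v \<in> V \<Longrightarrow> \<not> (E v (q i) \<and> E v (q (i + 2)) \<and> E v (q (i + 4)))"
  using K4D[OF K4, of v "q i" "q (i + 2)" "q (i + 4)"] q_adj[of i] by auto

definition T :: "nat \<Rightarrow> 'a set" where
  "T i = {v \<in> V. \<not> E v (q i) \<and> \<not> E v (q (i + 1)) \<and> \<not> E v (q (i + 2)) \<and> E v (q (i + 3)) \<and> E v (q (i + 4)) \<and> E v (q (i + 5)) \<and> E v (q (i + 6))}"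

definition F :: "nat \<Rightarrow> 'a set" where
  "F i = {v \<in> V. \<not> E v (q i) \<and> \<not> E v (q (i + 1)) \<and> \<not> E v (q (i + 2)) \<and> \<not> E v (q (i + 3)) \<and> E v (q (i + 4)) \<and> E v (q (i + 5)) \<and> E v (q (i + 6))}"

definition U :: "'a set" where
  "U = {v \<in> V. \<not> E v (q 0) \<and> \<not> E v (q 1) \<and> \<not> E v (q 2) \<and> \<not> E v (q 3) \<and> \<not> E v (q 4) \<and> \<not> E v (q 5) \<and> \<not> E v (q 6)}"

lemma U_nonadj: "v \<in> U \<Longrightarrow> \<not> E v (q i)"
  using q_index[of i 0] unfolding U_def add_0 by (elim disjE) auto

lemma T_period: "T (i + 7) = T i"
proof -
  have "q (i + 7 + k) = q (i + k)" for k
  proof -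
    have "i + 7 + k = i + k + 7" by simp
    then show ?thesis using q_period[of "i + k"] by metis
  qed
  then show ?thesis unfolding T_def by (simp_all only: q_period)
qed

lemmas T_wrap = period7_wrap[of T, OF T_period]

lemma T_index:
  "v \<in> T k \<Longrightarrow> v \<in> T i \<or> v \<in> T (i + 1) \<or> v \<in> T (i + 2) \<or> v \<in> T (i + 3) \<or> v \<in> T (i + 4) \<or> v \<in> T (i + 5) \<or> v \<in> T (i + 6)"
  using period7_index[of T k i, OF T_period] by blast

lemma T_V: "v \<in> T i \<Longrightarrow> v \<in> V"
  unfolding T_def by blast

lemma F_period: "F (i + 7) = F i"
proof -
  have "q (i + 7 + k) = q (i + k)" for k
  proof -
    have "i + 7 + k = i + k + 7" by simp
    then show ?thesis using q_period[of "i + k"] by metis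
  qed
  then show ?thesis unfolding F_def by (simp_all only: q_period)
qed

lemma F_index:
  "v \<in> F k \<Longrightarrow> v \<in> F i \<or> v \<in> F (i + 1) \<or> v \<in> F (i + 2) \<or> v \<in> F (i + 3) \<or> v \<in> F (i + 4) \<or> v \<in> F (i + 5) \<or> v \<in> F (i + 6)"
  using period7_index[of F k i, OF F_period] by blast

text \<open>On seven positions \<open>no_triple\<close> bounds a run of neighbours by four, and two
  runs of at least three do not fit with gaps between them. So a vertex with neighbours on the cycle
  has one run of three (\<open>F\<close>) or four (\<open>T\<close>).\<close>

lemma types:
  assumes "v \<in> V"
  shows "v \<in> U \<or> (\<exists>i. v \<in> T i) \<or> (\<exists>i. v \<in> F i)"
proof -
  have g2: "\<not> E v (q i) \<longrightarrow> \<not> E v (q (i + 2)) \<longrightarrow> \<not> E v (q (i + 1))" for i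
    using gap2[OF assms] by blast
  have g3: "\<not> E v (q i) \<longrightarrow> \<not> E v (q (i + 3)) \<longrightarrow> E v (q (i + 1)) \<longrightarrow> \<not> E v (q (i + 2))" for i
    using gap3[OF assms] by blast
  note g2 = g2[of 0] g2[of "0 + 1"] g2[of "0 + 2"] g2[of "0 + 3"] g2[of "0 + 4"] g2[of "0 + 5"] g2[of "0 + 6"]
  note g3 = g3[of 0] g3[of "0 + 1"] g3[of "0 + 2"] g3[of "0 + 3"] g3[of "0 + 4"] g3[of "0 + 5"] g3[of "0 + 6"]
  note t = no_triple[OF assms]
  note t = t[of 0] t[of "0 + 1"] t[of "0 + 2"] t[of "0 + 3"] t[of "0 + 4"] t[of "0 + 5"] t[of "0 + 6"]
  note defs = T_def[of 0] T_def[of "0 + 1"] T_def[of "0 + 2"] T_def[of "0 + 3"] T_def[of "0 + 4"] T_def[of "0 + 5"] T_def[of "0 + 6"] F_def[of 0] F_def[of "0 + 1"] F_def[of "0 + 2"] F_def[of "0 + 3"] F_def[of "0 + 4"] F_def[of "0 + 5"] F_def[of "0 + 6"]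
  have "v \<in> U \<or> v \<in> T 0 \<or> v \<in> T 1 \<or> v \<in> T 2 \<or> v \<in> T 3 \<or> v \<in> T 4 \<or> v \<in> T 5 \<or> v \<in> T 6 \<or> v \<in> F 0 \<or> v \<in> F 1 \<or> v \<in> F 2 \<or> v \<in> F 3 \<or> v \<in> F 4 \<or> v \<in> F 5 \<or> v \<in> F 6"
    unfolding U_def defs[unfolded q_wrap, unfolded add_0] mem_Collect_eq
    using g2[unfolded q_wrap, unfolded add_0] g3[unfolded q_wrap, unfolded add_0]
      t[unfolded q_wrap, unfolded add_0] assms by argo
  then show ?thesis by blast
qed

end

section \<open>No 7-cycle in the complement: the graph is the complement of a 6-cycle\<close>

context antihole6 begin

text \<open>If \<open>e\<close> and \<open>x\<close> are adjacent, they form a \<open>K_4\<close>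
  with \<open>q (i + 3)\<close> and \<open>q (i + 5)\<close>. Otherwise replacing
  \<open>q (i + 1)\<close> by \<open>e, x\<close> lengthens the 6-cycle of the complement to a
  7-cycle.\<close>

lemma no_consecutive_P:
  assumes e: "e \<in> P i" and x: "x \<in> P (i + 1)"
  shows False
proof -
  note e' = e[unfolded P_def mem_Collect_eq] and x' = x[unfolded P_def mem_Collect_eq q_wrap]
  note es = e'[unfolded sym_iff[of e]] and xs = x'[unfolded sym_iff[of x]]
  show False
  proof (cases "E e x")
    case True
    then show False
      using K4D[OF K4, of e x "q (i + 3)" "q (i + 5)"] e' x' q_adj[of i] by simp
  next
    case False
    then have "\<not> E x e" using sym by blast
    then show False
      using antihole7I[of "q i" e x "q (i + 2)" "q (i + 3)" "q (i + 4)" "q (i + 5)" V] no7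
        False e' x' es xs q_adj[of i] q_nonadj[of i] by auto
  qed
qed

text \<open>Incomparability with \<open>q (i + 1)\<close> and with \<open>q i\<close> gives
  \<open>x\<close> and \<open>y\<close> not seen by \<open>e\<close>, and their attachments are
  forced: \<open>x\<close> sees exactly \<open>q (i + 1)\<close>, \<open>q (i + 2)\<close>,
  \<open>q (i + 3)\<close>, and \<open>y\<close> exactly the other three. Then \<open>x\<close> and
  \<open>y\<close> can be neither adjacent nor non-adjacent.\<close>

lemma P_empty: "e \<notin> P i"
proof
  assume e: "e \<in> P i"
  note e' = e[unfolded P_def mem_Collect_eq]
  note es = e'[unfolded sym_iff[of e]]
  note adj = q_adj[of i] and nonadj = q_nonadj[of i]
  have "q (i + 1) \<noteq> e" "q i \<noteq> e" using e' nonadj by metis+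
  then obtain x y where x: "x \<in> V" "E (q (i + 1)) x" "\<not> E e x"
    and y: "y \<in> V" "E (q i) y" "\<not> E e y"
    using incomparableD[OF incomp, of "q (i + 1)" e] incomparableD[OF incomp, of "q i" e] e' by auto
  note x0 = x(2)[THEN sym] x(3)[unfolded sym_iff[of e]]
  note y0 = y(2)[THEN sym] y(3)[unfolded sym_iff[of e]]
  have x2: "E x (q (i + 2))" "E (q (i + 2)) x"
    using no_co_C4[of e "q (i + 1)" "q (i + 2)" x] e' es x x0 adj nonadj sym_iff[of x "q (i + 2)"] by auto
  have x3: "E x (q (i + 3))" "E (q (i + 3)) x"
    using no_co_C5[of e "q (i + 1)" "q (i + 2)" "q (i + 3)" x] e' es x x0 x2 adj nonadj
      sym_iff[of x "q (i + 3)"] by auto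
  have x5: "\<not> E x (q (i + 5))"
    using no_triple[OF x(1), of "i + 1"] x0 x3 unfolding q_wrap by blast
  have x6: "\<not> E x (q i)"
    using no_co_C4[of e x "q (i + 5)" "q i"] e' es x x0 x5 adj nonadj by auto
  have x4: "\<not> E x (q (i + 4))"
  proof
    assume "E x (q (i + 4))"
    then have "x \<in> P (i + 5)" using x x0 x2 x3 x5 x6 unfolding P_def q_wrap by blast
    then show False using no_consecutive_P[of x "i + 5" e] e unfolding P_wrap by blast
  qed
  have y5: "E y (q (i + 5))" "E (q (i + 5)) y"
    using no_co_C4[of e "q i" "q (i + 5)" y] e' es y y0 adj nonadj sym_iff[of y "q (i + 5)"] by auto
  have y4: "E y (q (i + 4))" "E (q (i + 4)) y"
    using no_co_C5[of e "q i" "q (i + 5)" "q (i + 4)" y] e' es y y0 y5 adj nonadj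
      sym_iff[of y "q (i + 4)"] by auto
  have y2: "\<not> E y (q (i + 2))"
    using no_triple[OF y(1), of i] y0 y4 by blast
  have y1: "\<not> E y (q (i + 1))"
    using no_co_C4[of e y "q (i + 2)" "q (i + 1)"] e' es y y0 y2 adj nonadj by auto
  have y3: "\<not> E y (q (i + 3))"
  proof
    assume "E y (q (i + 3))"
    then have "y \<in> P (i + 1)" using y y0 y1 y2 y4 y5 unfolding P_def q_wrap by blast
    then show False using no_consecutive_P[of e i y] e by blast
  qed
  show False
  proof (cases "E x y")
    case True
    then show False
      using no_co_C5[of e x "q (i + 4)" "q (i + 3)" y] e' es x x0 y y0 x3 x4 y3 y4 adj nonadj
        sym_iff[of x y] sym_iff[of y "q (i + 3)"] by auto
  next
    case False
    then show False
      using no_co_C4[of x "q (i + 4)" "q (i + 3)" y] x y x3 x4 y3 y4 nonadj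
        sym_iff[of x y] sym_iff[of y "q (i + 3)"] by auto
  qed
qed

text \<open>For a second vertex \<open>t\<close> attached like \<open>q (i + 1)\<close>,
  incomparability gives a neighbour \<open>x\<close> of \<open>q (i + 1)\<close> not seen by
  \<open>t\<close>. Every attachment open to \<open>x\<close> closes a 4-cycle or 5-cycle of the
  complement.\<close>

lemma T_trivial:
  assumes t: "t \<in> T i"
  shows "t = q (i + 1)"
proof (rule ccontr)
  assume "t \<noteq> q (i + 1)"
  note t' = t[unfolded T_def mem_Collect_eq]
  note ts = t'[unfolded sym_iff[of t]]
  note adj = q_adj[of i] and nonadj = q_nonadj[of i]
  obtain x where x: "x \<in> V" "E (q (i + 1)) x" "\<not> E t x"
    using incomparableD[OF incomp, of "q (i + 1)" t] t' \<open>t \<noteq> _\<close> by auto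
  note x0 = x(2)[THEN sym] x(3)[unfolded sym_iff[of t]]
  have "x \<notin> U" using U_nonadj x0 by blast
  then obtain k where "x \<in> T k" using types[OF x(1)] P_empty by blast
  then have "x \<in> T i \<or> x \<in> T (i + 1) \<or> x \<in> T (i + 2) \<or> x \<in> T (i + 3) \<or> x \<in> T (i + 4) \<or> x \<in> T (i + 5)"
    by (rule T_index)
  moreover have "x \<notin> T i" "x \<notin> T (i + 1)" "x \<notin> T (i + 5)" using x0 unfolding T_def q_wrap by blast+
  moreover have "x \<notin> T (i + 2)"
  proof
    assume x': "x \<in> T (i + 2)"
    note x' = x'[unfolded T_def mem_Collect_eq q_wrap]
    note xs = x'[unfolded sym_iff[of x]]
    show False
      using no_co_C5[of t x "q (i + 4)" "q (i + 5)" "q i"] t' ts x x0 x' xs adj nonadj by auto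
  qed
  moreover have "x \<notin> T (i + 3)"
  proof
    assume x': "x \<in> T (i + 3)"
    note x' = x'[unfolded T_def mem_Collect_eq q_wrap]
    note xs = x'[unfolded sym_iff[of x]]
    show False
      using no_co_C4[of t "q (i + 2)" "q (i + 3)" x] t' ts x x0 x' xs adj nonadj by auto
  qed
  moreover have "x \<notin> T (i + 4)"
  proof
    assume x': "x \<in> T (i + 4)"
    note x' = x'[unfolded T_def mem_Collect_eq q_wrap]
    note xs = x'[unfolded sym_iff[of x]]
    show False
      using no_co_C5[of t x "q (i + 4)" "q (i + 3)" "q (i + 2)"] t' ts x x0 x' xs adj nonadj by auto
  qed
  ultimately show False by blast
qed

lemma V_eq: "V \<subseteq> range q"
proof
  fix v assume v: "v \<in> V"
  have "v \<notin> U"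
  proof
    assume vU: "v \<in> U"
    then have "v \<noteq> q 0" using U_nonadj[of v 2] q_adj[of 0] unfolding add_0 by blast
    \<comment> \<open>Incomparability with \<open>q 0\<close> gives \<open>v\<close> a neighbour,
      which turns out to lie in \<open>U\<close> as well; then \<open>v x\<close> and
      \<open>q 0 q 2\<close> form a \<open>2K_2\<close>.\<close>
    then obtain x where x: "x \<in> V" "E v x" using incomparableD[OF incomp v qV, of 0] by blast
    have "x \<noteq> q k" for k using U_nonadj[OF vU] x by blast
    then have "x \<in> U" using types[OF x(1)] P_empty T_trivial by blast
    then have "\<not> E v (q 0)" "\<not> E (q 0) x" "\<not> E x (q 2)" "\<not> E (q 2) v"
      using U_nonadj vU sym by blast+
    moreover have "E (q 0) (q 2)" using q_adj[of 0] unfolding add_0 by blast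
    ultimately show False using no_co_C4[of v "q 0" x "q 2"] x v by auto
  qed
  then show "v \<in> range q" using types[OF v] P_empty T_trivial by blast
qed

lemma q_cases: "v \<in> V \<Longrightarrow> v = q 0 \<or> v = q 1 \<or> v = q 2 \<or> v = q 3 \<or> v = q 4 \<or> v = q 5"
  using V_eq q_index[of _ 0] unfolding add_0 by blast

lemma colorable_3: "colorable V 3"
proof (rule colorable_3I)
  show "V \<subseteq> {q 0, q 1} \<union> {q 2, q 3} \<union> {q 4, q 5}" using q_cases by blast
qed (use irrefl q_nonadj[of 0, unfolded add_0] in \<open>auto simp: indep_def\<close>)

text \<open>The triangle \<open>q 0, q 2, q 4\<close> needs three colors. A maximal independent set
  is a pair of consecutive vertices, and its removal leaves two such pairs.\<close>

lemma recol_antihole6: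
  assumes IH: "\<And>U. U \<subset> V \<Longrightarrow> recolorable_on U"
  shows "recolorable_on V"
proof (rule recol_if_good_vertex[OF finV IH _ qV[of 0]])
  note adj = q_adj[of 0, unfolded add_0] and nonadj = q_nonadj[of 0, unfolded add_0]
  show "\<not> colorable V 2"
  proof
    assume "colorable V 2"
    then obtain f where f: "proper V {..<2} f" unfolding colorable_def by blast
    have lt: "f v < 2" if "v \<in> V" for v using f that unfolding proper_def by auto
    have ne: "f u \<noteq> f v" if "u \<in> V" "v \<in> V" "E u v" for u v using f that unfolding proper_def by auto
    have "f (q 0) \<noteq> f (q 2)" "f (q 2) \<noteq> f (q 4)" "f (q 0) \<noteq> f (q 4)"
      using ne[OF qV qV] adj by blast+
    then show False using lt[OF qV, of 0] lt[OF qV, of 2] lt[OF qV, of 4] by linarith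
  qed
  fix S assume S: "maxind V S" "q 0 \<in> S"
  have *: "s = q 0 \<or> s = q 1 \<or> s = q 5" if "s \<in> S" for s
  proof -
    have "\<not> E (q 0) s" "s \<in> V" using S that unfolding maxind_def by blast+
    then show ?thesis using q_cases[of s] adj by blast
  qed
  have "q 1 \<in> S \<or> q 5 \<in> S"
  proof (rule ccontr)
    assume n: "\<not> (q 1 \<in> S \<or> q 5 \<in> S)"
    then have "\<not> E s (q 1)" if "s \<in> S" for s using *[OF that] that nonadj by blast
    then show False using S n qV[of 1] unfolding maxind_def by blast
  qed
  then show "colorable (V - S) 2"
  proof
    assume "q 1 \<in> S"
    then have "V - S \<subseteq> {q 2, q 3} \<union> {q 4, q 5}" using q_cases S(2) by blast
    then show ?thesis by (rule colorable_2I) (use nonadj irrefl in \<open>simp_all add: indep_def\<close>)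
  next
    assume "q 5 \<in> S"
    then have "V - S \<subseteq> {q 1, q 2} \<union> {q 3, q 4}" using q_cases S(2) by blast
    then show ?thesis by (rule colorable_2I) (use nonadj irrefl in \<open>simp_all add: indep_def\<close>)
  qed
qed

end

section \<open>A 7-cycle in the complement and the maximal independent sets\<close>

context antihole7 begin

text \<open>\<open>q i\<close> and \<open>q (i + 6)\<close> are both complete to the edge
  \<open>q (i + 2) q (i + 4)\<close>, so with three colors consecutive vertices would agree all
  around, although \<open>q 0\<close> and \<open>q 5\<close> are adjacent.\<close>

lemma not_3_colorable: "\<not> colorable V 3"
proof
  assume "colorable V 3"
  then obtain f where f: "proper V {..<3} f" unfolding colorable_def by blast
  have lt: "f v < 3" if "v \<in> V" for v using f that unfolding proper_def by auto
  have ne: "f u \<noteq> f v" if "u \<in> V" "v \<in> V" "E u v" for u v using f that unfolding proper_def by auto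
  have eq: "f (q i) = f (q (i + 6))" for i
  proof -
    have "f (q i) \<noteq> f (q (i + 2))" "f (q i) \<noteq> f (q (i + 4))" "f (q (i + 2)) \<noteq> f (q (i + 4))"
      "f (q (i + 6)) \<noteq> f (q (i + 2))" "f (q (i + 6)) \<noteq> f (q (i + 4))"
      using ne[OF qV qV] q_adj[of i] by blast+
    then show ?thesis
      using lt[OF qV, of i] lt[OF qV, of "i + 2"] lt[OF qV, of "i + 4"] lt[OF qV, of "i + 6"] by linarith
  qed
  have "f (q 0) = f (q 5)" using eq[of "0 + 6"] eq[of 0] unfolding q_wrap unfolding add_0 by argo
  then show False using ne[OF qV qV] q_adj[of 0] unfolding add_0 by blast
qed

text \<open>For every other attachment that sees \<open>q (i + 1)\<close>, the non-edge
  \<open>s x\<close> closes a 4-cycle or 5-cycle of the complement. The surviving positions are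
  those at distance two from the position of \<open>s\<close>.\<close>

lemma T_partner:
  assumes s: "s \<in> T i" and x: "x \<in> V" "\<not> E s x" "E x (q (i + 1))"
  shows "x \<in> T (i + 2) \<or> x \<in> T (i + 5)"
proof -
  note s' = s[unfolded T_def mem_Collect_eq]
  note ss = s'[unfolded sym_iff[of s]]
  note adj = q_adj[of i] and nonadj = q_nonadj[of i]
  note x0 = x(2)[unfolded sym_iff[of s]]
  have "x \<notin> U" using U_nonadj x(3) by blast
  moreover have "x \<in> T (i + 2) \<or> x \<in> T (i + 5)" if "x \<in> T k" for k
  proof -
    have "x \<notin> T i" "x \<notin> T (i + 1)" "x \<notin> T (i + 6)" using x(3) unfolding T_def q_wrap by blast+
    moreover have "x \<notin> T (i + 3)"
    proof
      assume x': "x \<in> T (i + 3)"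
      note x' = x'[unfolded T_def mem_Collect_eq q_wrap]
      note xs = x'[unfolded sym_iff[of x]]
      show False
        using no_co_C4[of s "q (i + 2)" "q (i + 3)" x] s' ss x x0 x' xs adj nonadj by auto
    qed
    moreover have "x \<notin> T (i + 4)"
    proof
      assume x': "x \<in> T (i + 4)"
      note x' = x'[unfolded T_def mem_Collect_eq q_wrap]
      note xs = x'[unfolded sym_iff[of x]]
      show False
        using no_co_C4[of s "q i" "q (i + 6)" x] s' ss x x0 x' xs adj nonadj by auto
    qed
    ultimately show ?thesis using T_index[OF that, of i] by blast
  qed
  moreover have "x \<notin> F k" for k
  proof
    assume "x \<in> F k"
    moreover have "x \<notin> F i" "x \<notin> F (i + 1)" "x \<notin> F (i + 5)" "x \<notin> F (i + 6)"
      using x(3) unfolding F_def q_wrap by blast+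
    moreover have "x \<notin> F (i + 2)"
    proof
      assume x': "x \<in> F (i + 2)"
      note x' = x'[unfolded F_def mem_Collect_eq q_wrap]
      note xs = x'[unfolded sym_iff[of x]]
      show False
        using no_co_C5[of s x "q (i + 5)" "q (i + 6)" "q i"] s' ss x x0 x' xs adj nonadj by auto
    qed
    moreover have "x \<notin> F (i + 3)"
    proof
      assume x': "x \<in> F (i + 3)"
      note x' = x'[unfolded F_def mem_Collect_eq q_wrap]
      note xs = x'[unfolded sym_iff[of x]]
      show False
        using no_co_C4[of s "q (i + 2)" "q (i + 3)" x] s' ss x x0 x' xs adj nonadj by auto
    qed
    moreover have "x \<notin> F (i + 4)"
    proof
      assume x': "x \<in> F (i + 4)"
      note x' = x'[unfolded F_def mem_Collect_eq q_wrap]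
      note xs = x'[unfolded sym_iff[of x]]
      show False
        using no_co_C5[of s x "q (i + 4)" "q (i + 3)" "q (i + 2)"] s' ss x x0 x' xs adj nonadj by auto
    qed
    ultimately show False using F_index[of x k i] by blast
  qed
  ultimately show ?thesis using types[OF x(1)] by blast
qed

text \<open>The vertex \<open>q (i + 2)\<close> lies between the positions of \<open>s\<close> and
  \<open>t\<close>. If \<open>x\<close> saw it, \<open>T_partner\<close> applied to \<open>s\<close>
  and to \<open>t\<close> would keep \<open>x\<close> from seeing \<open>q (i + 1)\<close> or
  \<open>q (i + 3)\<close>, against \<open>gap2\<close>.\<close>

lemma T_pair:
  assumes s: "s \<in> T i" and t: "t \<in> T (i + 2)" and x: "x \<in> V" "\<not> E s x" "\<not> E t x"
  shows "\<not> E x (q (i + 2))"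
proof
  assume x2: "E x (q (i + 2))"
  have x3: "x \<in> T (i + 4) \<or> x \<in> T i" if "E x (q (i + 3))"
    using T_partner[OF t x(1,3)] that unfolding q_wrap T_wrap by blast
  have "\<not> E x (q (i + 1))"
  proof
    assume "E x (q (i + 1))"
    from T_partner[OF s x(1,2) this] x2 have "x \<in> T (i + 5)" unfolding T_def q_wrap by blast
    then have "E x (q (i + 3))" "E x (q (i + 1))" "E x (q (i + 4))" unfolding T_def q_wrap by blast+
    then show False using x3 unfolding T_def q_wrap by blast
  qed
  moreover from this have "\<not> E x (q (i + 3))"
    using x3 x2 unfolding T_def q_wrap by blast
  ultimately show False using gap2[OF x(1), of "i + 1"] x2 unfolding q_wrap by blast
qed

lemma F_pair:
  assumes s: "s \<in> F i" and x: "x \<in> F k" "\<not> E s x"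
  shows "\<not> E x (q (i + 1))"
proof
  assume x1: "E x (q (i + 1))"
  note s' = s[unfolded F_def mem_Collect_eq]
  note ss = s'[unfolded sym_iff[of s]]
  note adj = q_adj[of i] and nonadj = q_nonadj[of i]
  note x0 = x(2)[unfolded sym_iff[of s]]
  have "x \<notin> F i" "x \<notin> F (i + 1)" "x \<notin> F (i + 5)" "x \<notin> F (i + 6)"
    using x1 unfolding F_def q_wrap by blast+
  moreover have "x \<notin> F (i + 2)"
  proof
    assume x': "x \<in> F (i + 2)"
    note x' = x'[unfolded F_def mem_Collect_eq q_wrap]
    note xs = x'[unfolded sym_iff[of x]]
    show False
      using no_co_C5[of s x "q (i + 5)" "q (i + 6)" "q i"] s' ss x(2) x0 x' xs adj nonadj by auto
  qed
  moreover have "x \<notin> F (i + 3)"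
  proof
    assume x': "x \<in> F (i + 3)"
    note x' = x'[unfolded F_def mem_Collect_eq q_wrap]
    note xs = x'[unfolded sym_iff[of x]]
    show False
      using no_co_C4[of s x "q (i + 6)" "q i"] s' ss x(2) x0 x' xs adj nonadj by auto
  qed
  moreover have "x \<notin> F (i + 4)"
  proof
    assume x': "x \<in> F (i + 4)"
    note x' = x'[unfolded F_def mem_Collect_eq q_wrap]
    note xs = x'[unfolded sym_iff[of x]]
    show False
      using no_co_C4[of s "q (i + 3)" "q (i + 4)" x] s' ss x(2) x0 x' xs adj nonadj by auto
  qed
  ultimately show False using F_index[OF x(1), of i] by blast
qed

text \<open>If \<open>S\<close> missed the cycle, every \<open>q k\<close> would be seen from
  \<open>S\<close>. A member in \<open>T i\<close> forces, through \<open>q (i + 1)\<close>, a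
  member at distance two, and by \<open>T_pair\<close> nobody in \<open>S\<close> sees the vertex
  between them. So all members that see the cycle have type \<open>F\<close>, and for one in
  \<open>F i\<close> nobody sees \<open>q (i + 1)\<close> by \<open>F_pair\<close>.\<close>

lemma maxind_meets_antihole:
  assumes S: "maxind V S"
  shows "S \<inter> range q \<noteq> {}"
proof
  assume "S \<inter> range q = {}"
  then have hit: "\<exists>s\<in>S. E s (q k)" for k using S qV unfolding maxind_def by blast
  have SV: "s \<in> V" if "s \<in> S" for s using S that unfolding maxind_def by blast
  have nS: "\<not> E s t" if "s \<in> S" "t \<in> S" for s t using S that unfolding maxind_def by blast
  have noT: "s \<notin> T i" if s: "s \<in> S" for s i
  proof
    assume sT: "s \<in> T i"
    obtain t where t: "t \<in> S" "E t (q (i + 1))" using hit by blast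
    from T_partner[OF sT SV[OF t(1)] nS[OF s t(1)] t(2)] show False
    proof
      assume "t \<in> T (i + 2)"
      then show False using T_pair[OF sT] hit[of "i + 2"] nS s t(1) SV by blast
    next
      assume t5: "t \<in> T (i + 5)"
      have "s \<in> T (i + 5 + 2)" using sT unfolding T_wrap .
      then show False using T_pair[OF t5] hit[of "i + 5 + 2"] nS s t(1) SV by blast
    qed
  qed
  obtain s where s: "s \<in> S" "E s (q 0)" using hit by blast
  then obtain i where "s \<in> F i" using types[OF SV] noT U_nonadj by blast
  moreover obtain t where t: "t \<in> S" "E t (q (i + 1))" using hit by blast
  moreover from t obtain k where "t \<in> F k" using types[OF SV] noT U_nonadj by blast
  ultimately show False using F_pair nS s(1) by blast
qed

end

section \<open>Recolorability without an induced 5-cycle\<close>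

lemma (in sgraph) C5_free_graph_subset:
  assumes "C5_free_graph E V" "U \<subseteq> V"
  shows "C5_free_graph E U"
proof -
  interpret C5_free_graph E V by fact
  show ?thesis
  proof
    show "finite U" using finV assms(2) finite_subset by blast
    show "two_K2_free U" "K4_free U"
      using two_K2 K4 assms(2) unfolding two_K2_free_def K4_free_def by (meson subsetD)+
    show "\<not> C5 U c" for c using noC5[of c] assms(2) unfolding C5_def by blast
  qed
qed

context C5_free_graph begin

lemma complete_small:
  assumes "\<And>u v. u \<in> V \<Longrightarrow> v \<in> V \<Longrightarrow> u \<noteq> v \<Longrightarrow> E u v"
  obtains a b c where "V \<subseteq> {a, b, c}"
proof -
  have "False" if n: "\<And>a b c. \<not> V \<subseteq> {a, b, c}"
  proof -
    obtain a where a: "a \<in> V" using n by blast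
    obtain b where b: "b \<in> V" "b \<noteq> a" using n[of a a a] by blast
    obtain c where c: "c \<in> V" "c \<noteq> a" "c \<noteq> b" using n[of a b b] by blast
    obtain d where d: "d \<in> V" "d \<noteq> a" "d \<noteq> b" "d \<noteq> c" using n[of a b c] by blast
    show False using K4D[OF K4 a b(1) c(1) d(1)] assms a b c d by metis
  qed
  then show thesis using that by blast
qed

lemma antihole6_intro:
  assumes "incomparable V" "\<And>r. \<not> antihole 7 V r" "antihole 6 V q"
  shows "antihole6 E V q"
  by unfold_locales (use assms in auto)

end

text \<open>A dominated vertex copies the color of the vertex dominating it. An incomparable graph
  is either complete, with at most three vertices, or the complement of a 6-cycle.\<close>

lemma (in sgraph) colorable_3_if_no_antihole7:
  assumes "C5_free_graph E V" "\<And>r. \<not> antihole 7 V r"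
  shows "colorable V 3"
proof -
  have "finite V" using assms(1) C5_free_graph.finV by blast
  then show ?thesis using assms
  proof (induction V rule: finite_psubset_induct)
    case (psubset V)
    interpret C5_free_graph E V by fact
    show ?case
    proof (cases "incomparable V")
      case False
      then obtain u v where uv: "u \<in> V" "v \<in> V" "u \<noteq> v" "\<And>x. x \<in> V \<Longrightarrow> E u x \<Longrightarrow> E v x"
        unfolding incomparable_def by blast
      have "\<not> antihole 7 (V - {u}) r" for r using psubset.prems(2)[of r] unfolding antihole_def by blast
      then have "colorable (V - {u}) 3"
        using psubset.IH[of "V - {u}"] C5_free_graph_subset[OF psubset.prems(1), of "V - {u}"] uv(1) by blast
      then show ?thesis using proper_comparable[OF uv] unfolding colorable_def by blast
    next
      case inc: True
      show ?thesis
      proof (cases "\<exists>u\<in>V. \<exists>v\<in>V. u \<noteq> v \<and> \<not> E u v")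
        case False
        then obtain a b c where "V \<subseteq> {a, b, c}" using complete_small by blast
        then have "V \<subseteq> {a} \<union> {b} \<union> {c}" by blast
        then show ?thesis by (rule colorable_3I) (simp_all add: indep_def irrefl)
      next
        case True
        then obtain q where "antihole 6 V q"
          using antihole_if_incomparable[OF inc] psubset.prems(2) by metis
        then show ?thesis
          using antihole6.colorable_3 antihole6_intro[OF inc psubset.prems(2)] by blast
      qed
    qed
  qed
qed

context C5_free_graph begin

lemma recol_complete:
  assumes "\<And>u v. u \<in> V \<Longrightarrow> v \<in> V \<Longrightarrow> u \<noteq> v \<Longrightarrow> E u v" "\<And>U. U \<subset> V \<Longrightarrow> recolorable_on U"
  shows "recolorable_on V"
proof (cases "V = {}")
  case True
  have "step {} K f g" for K f g unfolding step_def proper_def by simp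
  then show ?thesis unfolding True recolorable_on_def mixing_def by blast
next
  case False
  then obtain v where v: "v \<in> V" by blast
  obtain a b c where "V \<subseteq> {a, b, c}" using complete_small[OF assms(1)] by blast
  then have "V \<subseteq> {a} \<union> {b} \<union> {c}" by blast
  then have c3: "colorable V 3" by (rule colorable_3I) (simp_all add: indep_def irrefl)
  \<comment> \<open>\<open>m\<close> is the chromatic number. In a complete graph the color
    \<open>f v\<close> does not occur outside a maximal independent set through \<open>v\<close>, so
    one color is saved.\<close>
  define m where "m = (LEAST m. colorable V m)"
  have m: "colorable V m" unfolding m_def using c3 by (rule LeastI)
  then obtain f where f: "proper V {..<m} f" unfolding colorable_def by blast
  have m0: "0 < m" using f v unfolding proper_def by fastforce
  have nm: "\<not> colorable V (m - 1)"
    using not_less_Least[of "m - 1" "colorable V"] m0 unfolding m_def[symmetric] by simp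
  show ?thesis
  proof (rule recol_if_good_vertex[OF finV assms(2) nm v])
    fix S assume S: "maxind V S" "v \<in> S"
    have "proper (V - S) ({..<m} - {f v}) f"
      using f v S(2) assms(1)[OF v] unfolding proper_def by (metis DiffD1 DiffD2 DiffI singletonD)
    moreover have "f v < m" using f v unfolding proper_def by blast
    ultimately show "colorable (V - S) (m - 1)"
      by (intro proper_colorable[of "V - S" "{..<m} - {f v}" f]) simp_all
  qed
qed

lemma recol_C5_free:
  assumes inc: "incomparable V" and IH: "\<And>U. U \<subset> V \<Longrightarrow> recolorable_on U"
  shows "recolorable_on V"
proof (cases "\<exists>q. antihole 7 V q")
  case True
  then obtain q where q: "antihole 7 V q" by blast
  interpret antihole7 E V q by unfold_locales (fact q)
  show ?thesis
  proof (rule recol_if_good_vertex[OF finV IH not_3_colorable qV[of 0]])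
    fix S assume S: "maxind V S"
    have sub: "C5_free_graph E (V - S)"
      using C5_free_graph_subset[of V "V - S"] C5_free_graph_axioms by blast
    have "\<not> antihole 7 (V - S) r" for r
    proof
      assume r: "antihole 7 (V - S) r"
      then have rV: "antihole 7 V r" unfolding antihole_def by blast
      interpret R: antihole7 E V r by unfold_locales (fact rV)
      show False using R.maxind_meets_antihole[OF S] r unfolding antihole_def by blast
    qed
    then show "colorable (V - S) 3" by (rule colorable_3_if_no_antihole7[OF sub])
  qed
next
  case no7: False
  show ?thesis
  proof (cases "\<exists>u\<in>V. \<exists>v\<in>V. u \<noteq> v \<and> \<not> E u v")
    case False
    then show ?thesis using recol_complete IH by blast
  next
    case True
    then obtain q where q: "antihole 6 V q"
      using antihole_if_incomparable[OF inc] no7 by metis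
    interpret antihole6 E V q by (rule antihole6_intro[OF inc _ q]) (use no7 in blast)
    show ?thesis using recol_antihole6 IH by blast
  qed
qed

end

section \<open>The minimal counterexample\<close>

context sgraph begin

theorem recol_if_two_H_free:
  assumes "finite V" "two_K2_free V" "K4_free V"
    and "H2_free V \<and> H3_free V \<or> H2_free V \<and> H4_free V \<or> H3_free V \<and> H4_free V"
  shows "recolorable_on V"
  using assms
proof (induction V rule: finite_psubset_induct)
  case (psubset V)
  have IH: "recolorable_on U" if U: "U \<subset> V" for U
  proof (rule psubset.IH[OF U])
    have C5: "C5 V c" if "C5 U c" for c using that U unfolding C5_def by blast
    show "two_K2_free U" "K4_free U"
      using psubset.prems(1,2) U unfolding two_K2_free_def K4_free_def by (meson psubsetD)+
    have "H2_free V \<Longrightarrow> H2_free U" "H3_free V \<Longrightarrow> H3_free U" "H4_free V \<Longrightarrow> H4_free U"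
      using C5 U unfolding H2_free_def H3_free_def H4_free_def by blast+
    then show "H2_free U \<and> H3_free U \<or> H2_free U \<and> H4_free U \<or> H3_free U \<and> H4_free U"
      using psubset.prems(3) by blast
  qed
  show ?case
  proof (cases "incomparable V")
    case False
    then obtain u v where uv: "u \<in> V" "v \<in> V" "u \<noteq> v" "\<And>x. x \<in> V \<Longrightarrow> E u x \<Longrightarrow> E v x"
      unfolding incomparable_def by blast
    then show ?thesis using recol_comparable[OF uv] IH by blast
  next
    case inc: True
    show ?thesis
    proof (cases "\<exists>c. C5 V c")
      case True
      then obtain c where c: "C5 V c" by blast
      interpret C5_graph E V c
        by unfold_locales (use psubset.hyps psubset.prems c inc IH in auto)
      show ?thesis
        using psubset.prems(3) recol_H2_H3_free recol_H2_H4_free recol_H3_H4_free by blast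
    next
      case False
      interpret C5_free_graph E V
        by unfold_locales (use psubset.hyps psubset.prems False in auto)
      show ?thesis using recol_C5_free[OF inc IH] .
    qed
  qed
qed

end

section \<open>The theorem\<close>

text \<open>The image of an injection that preserves and reflects adjacency is an induced subgraph,
  and the inverse map is the isomorphism onto the pattern that \<open>free_of\<close>
  forbids.\<close>

lemma embedding_not_free:
  fixes G :: "'a pair_pre_digraph" and F :: "'b pair_pre_digraph" and f :: "'b \<Rightarrow> 'a"
  assumes G: "pair_graph G" and F: "F \<in> Fs" "pair_graph F"
    and f: "inj_on f (pverts F)" "f ` pverts F \<subseteq> pverts G"
    and adj: "\<And>i j. i \<in> pverts F \<Longrightarrow> j \<in> pverts F \<Longrightarrow> (f i, f j) \<in> parcs G \<longleftrightarrow> (i, j) \<in> parcs F"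
  shows "\<not> free_of Fs G"
proof -
  interpret G: pair_graph G by fact
  interpret F: pair_graph F by fact
  let ?H = "\<lparr> pverts = f ` pverts F,
    parcs = {e \<in> parcs G. fst e \<in> f ` pverts F \<and> snd e \<in> f ` pverts F} \<rparr>"
  have wf: "wf_digraph (with_proj ?H)"
    by unfold_locales auto
  have "subgraph (with_proj ?H) (with_proj G)"
    using wf G.wf_digraph_axioms f(2) unfolding subgraph_def compatible_def by auto
  then have ind: "induced_subgraph (with_proj ?H) (with_proj G)"
    by (rule induced_subgraphI) simp
  define g where "g = the_inv_into (pverts F) f"
  have gf: "g (f i) = i" if "i \<in> pverts F" for i
    unfolding g_def using f(1) that by (rule the_inv_into_f_f)
  let ?h = "\<lparr> iso_verts = g, iso_arcs = map_prod g g, iso_head = snd, iso_tail = fst \<rparr>"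
  have inj: "inj_on g (f ` pverts F)" using gf by (auto intro: inj_onI)
  have "inj_on (map_prod g g) (parcs ?H)"
    using inj by (auto simp: inj_on_def)
  then have iso: "pre_digraph.digraph_isomorphism (with_proj ?H) ?h"
    using wf inj unfolding pre_digraph.digraph_isomorphism_def by auto
  have V: "g ` f ` pverts F = pverts F" using gf by force
  have "map_prod g g ` parcs ?H = parcs F"
  proof (intro equalityI subsetI)
    fix e assume "e \<in> map_prod g g ` parcs ?H"
    then obtain i j where "i \<in> pverts F" "j \<in> pverts F" "(f i, f j) \<in> parcs G" "e = (g (f i), g (f j))"
      by auto
    then show "e \<in> parcs F" using adj gf by simp
  next
    fix e assume e: "e \<in> parcs F"
    obtain i j where ij: "e = (i, j)" by fastforce
    then have "i \<in> pverts F" "j \<in> pverts F" using e F.in_arcsD1 F.in_arcsD2 by blast+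
    then have "(f i, f j) \<in> parcs ?H" "e = map_prod g g (f i, f j)" using e ij adj gf by auto
    then show "e \<in> map_prod g g ` parcs ?H" by (rule rev_image_eqI)
  qed
  with V have "with_proj F = app_iso ?h (with_proj ?H)"
    unfolding app_iso_def with_proj_def by simp
  with iso have "digraph_iso (with_proj ?H) (with_proj F)" unfolding digraph_iso_def by blast
  with ind F(1) show ?thesis unfolding free_of_def by blast
qed

locale free_pair_graph = pair_graph G for G :: "'a pair_pre_digraph" +
  fixes Fs :: "nat pair_pre_digraph set"
  assumes free: "free_of Fs G"
begin

abbreviation adj :: "'a \<Rightarrow> 'a \<Rightarrow> bool" where
  "adj u v \<equiv> (u, v) \<in> parcs G"

sublocale sgraph adj
proof
  show "adj u v \<Longrightarrow> adj v u" for u v by (rule arcs_symmetric)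
  show "\<not> adj u u" for u using no_loops' by blast
qed

lemma two_K2_free_pverts:
  assumes "two_K2 \<in> Fs"
  shows "two_K2_free (pverts G)"
  unfolding two_K2_free_def
proof (intro ballI impI, rule ccontr)
  fix a b c d assume V: "a \<in> pverts G" "b \<in> pverts G" "c \<in> pverts G" "d \<in> pverts G"
    and E: "adj a b" "adj c d" and n: "\<not> (adj a c \<or> adj a d \<or> adj b c \<or> adj b d)"
  let ?f = "\<lambda>k::nat. if k = 1 then a else if k = 2 then b else if k = 3 then c else d"
  have n': "\<not> adj c a" "\<not> adj d a" "\<not> adj c b" "\<not> adj d b" using n sym by blast+
  have E': "adj b a" "adj d c" using E sym by blast+
  have ne: "a \<noteq> b" "a \<noteq> c" "a \<noteq> d" "b \<noteq> c" "b \<noteq> d" "c \<noteq> d" using E E' n n' irrefl by blast+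
  have p: "pverts two_K2 = {1, 2, 3, 4}" unfolding two_K2_def graph_of_def by auto
  have "\<not> free_of Fs G"
  proof (rule embedding_not_free[OF pair_graph_axioms assms pair_graph_patterns(1), of ?f])
    show "inj_on ?f (pverts two_K2)" unfolding p using ne by (simp add: inj_on_def)
    show "?f ` pverts two_K2 \<subseteq> pverts G" using V by auto
    fix i j assume "i \<in> pverts two_K2" "j \<in> pverts two_K2"
    then show "adj (?f i) (?f j) \<longleftrightarrow> (i, j) \<in> parcs two_K2"
      unfolding p two_K2_def graph_of_def using E E' n n' irrefl by auto
  qed
  with free show False by blast
qed

lemma K4_free_pverts:
  assumes "K4 \<in> Fs"
  shows "K4_free (pverts G)"
  unfolding K4_free_def
proof (intro ballI notI)
  fix a b c d assume V: "a \<in> pverts G" "b \<in> pverts G" "c \<in> pverts G" "d \<in> pverts G"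
    and E: "adj a b \<and> adj a c \<and> adj a d \<and> adj b c \<and> adj b d \<and> adj c d"
  let ?f = "\<lambda>k::nat. if k = 1 then a else if k = 2 then b else if k = 3 then c else d"
  have E': "adj b a" "adj c a" "adj d a" "adj c b" "adj d b" "adj d c" using E sym by blast+
  have ne: "a \<noteq> b" "a \<noteq> c" "a \<noteq> d" "b \<noteq> c" "b \<noteq> d" "c \<noteq> d" using E irrefl by blast+
  have p: "pverts K4 = {1, 2, 3, 4}" unfolding K4_def graph_of_def by auto
  have "\<not> free_of Fs G"
  proof (rule embedding_not_free[OF pair_graph_axioms assms pair_graph_patterns(2), of ?f])
    show "inj_on ?f (pverts K4)" unfolding p using ne by (simp add: inj_on_def)
    show "?f ` pverts K4 \<subseteq> pverts G" using V by auto
    fix i j assume "i \<in> pverts K4" "j \<in> pverts K4"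
    then show "adj (?f i) (?f j) \<longleftrightarrow> (i, j) \<in> parcs K4"
      unfolding p K4_def graph_of_def using E E' irrefl by auto
  qed
  with free show False by blast
qed

text \<open>Pattern vertices are numbered from 1 and cycle vertices from 0: vertex
  \<open>k + 1\<close> goes to \<open>c k\<close> for \<open>k < 5\<close>, and 6 goes to
  \<open>u\<close>.\<close>

lemma no_C5_plus:
  assumes "C5_plus S \<in> Fs" "pair_graph (C5_plus S)" "C5 (pverts G) c" "u \<in> pverts G" "u \<notin> range c"
    and u: "adj u (c 0) \<longleftrightarrow> 1 \<in> S" "adj u (c 1) \<longleftrightarrow> 2 \<in> S" "adj u (c 2) \<longleftrightarrow> 3 \<in> S"
      "adj u (c 3) \<longleftrightarrow> 4 \<in> S" "adj u (c 4) \<longleftrightarrow> 5 \<in> S" "6 \<notin> S"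
  shows False
proof -
  interpret induced_C5 adj "pverts G" c by unfold_locales fact
  let ?f = "\<lambda>k::nat. if k = 1 then c 0 else if k = 2 then c 1 else if k = 3 then c 2 else
    if k = 4 then c 3 else if k = 5 then c 4 else u"
  note a = c_adj[of 0, unfolded add_0] and n = c_nonadj[of 0, unfolded add_0]
  have u': "adj (c 0) u \<longleftrightarrow> 1 \<in> S" "adj (c 1) u \<longleftrightarrow> 2 \<in> S" "adj (c 2) u \<longleftrightarrow> 3 \<in> S"
      "adj (c 3) u \<longleftrightarrow> 4 \<in> S" "adj (c 4) u \<longleftrightarrow> 5 \<in> S"
    using u sym by blast+
  have ne: "c 0 \<noteq> c 1" "c 0 \<noteq> c 2" "c 0 \<noteq> c 3" "c 0 \<noteq> c 4" "c 1 \<noteq> c 2" "c 1 \<noteq> c 3" "c 1 \<noteq> c 4"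
    "c 2 \<noteq> c 3" "c 2 \<noteq> c 4" "c 3 \<noteq> c 4"
    using a n irrefl by metis+
  have un: "c k \<noteq> u" for k using assms(5) by blast
  have p: "pverts (C5_plus S) = {1, 2, 3, 4, 5, 6}" unfolding C5_plus_def graph_of_def by auto
  have "\<not> free_of Fs G"
  proof (rule embedding_not_free[OF pair_graph_axioms assms(1,2), of ?f])
    show "inj_on ?f (pverts (C5_plus S))"
      unfolding p using ne un ne[symmetric] un[symmetric] by (simp add: inj_on_def)
    show "?f ` pverts (C5_plus S) \<subseteq> pverts G" using assms(4) by auto
    fix i j assume "i \<in> pverts (C5_plus S)" "j \<in> pverts (C5_plus S)"
    then have "(i = 1 \<or> i = 2 \<or> i = 3 \<or> i = 4 \<or> i = 5 \<or> i = 6) \<and> (j = 1 \<or> j = 2 \<or> j = 3 \<or> j = 4 \<or> j = 5 \<or> j = 6)"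
      unfolding p by blast
    then show "adj (?f i) (?f j) \<longleftrightarrow> (i, j) \<in> parcs (C5_plus S)"
      unfolding C5_plus_def graph_of_def using a n irrefl u u' by (elim conjE disjE) simp_all
  qed
  with free show False by blast
qed

text \<open>Supplies the condition \<open>u \<notin> range c\<close> of \<open>no_C5_plus\<close>
  for \<open>H3\<close> and \<open>H4\<close>: no vertex of the cycle sees both ends of its edge
  \<open>c 2 c 3\<close>.\<close>

lemma three_neighbours_off_C5:
  assumes "C5 (pverts G) c" "adj u (c 2)" "adj u (c 3)" "adj u (c 0) \<or> adj u (c 1) \<and> adj u (c 4)"
  shows "u \<notin> range c"
proof -
  interpret induced_C5 adj "pverts G" c by unfold_locales fact
  show ?thesis
    using assms(2-4) c_nonadj[of 0] irrefl unfolding c_cases[of u 0] unfolding add_0 by metis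
qed

lemma H2_free_pverts: "H2 \<in> Fs \<Longrightarrow> H2_free (pverts G)"
  using no_C5_plus[of "{5, 2}"] pair_graph_patterns(3) unfolding H2_def H2_free_def by auto

lemma H3_free_pverts: "H3 \<in> Fs \<Longrightarrow> H3_free (pverts G)"
  using no_C5_plus[of "{1, 4, 3}"] pair_graph_patterns(4) three_neighbours_off_C5
  unfolding H3_def H3_free_def by auto

lemma H4_free_pverts: "H4 \<in> Fs \<Longrightarrow> H4_free (pverts G)"
  using no_C5_plus[of "{2, 3, 4, 5}"] pair_graph_patterns(5) three_neighbours_off_C5
  unfolding H4_def H4_free_def by auto

section \<open>Transfer to the reconfiguration graph\<close>

lemma colorings_iff: "f \<in> colorings G l \<longleftrightarrow> f \<in> extensional (pverts G) \<and> proper (pverts G) {1..l} f"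
proof -
  have "(\<forall>(u, v)\<in>parcs G. f u \<noteq> f v) \<longleftrightarrow> (\<forall>u\<in>pverts G. \<forall>v\<in>pverts G. adj u v \<longrightarrow> f u \<noteq> f v)"
    using in_arcsD1 in_arcsD2 by blast
  then show ?thesis unfolding colorings_def proper_def PiE_def Pi_def by auto
qed

lemma restrict_colorings: "proper (pverts G) {1..l} f \<Longrightarrow> restrict f (pverts G) \<in> colorings G l"
  unfolding colorings_iff by (auto intro: proper_cong)

text \<open>A \<open>step\<close> may leave all vertices of \<open>G\<close> unchanged, which
  accounts for the first alternative; otherwise the restrictions differ at exactly one
  vertex.\<close>

lemma reconf_step:
  assumes "step (pverts G) {1..l} f g"
  shows "restrict f (pverts G) = restrict g (pverts G) \<or>
    (restrict f (pverts G), restrict g (pverts G)) \<in> parcs (reconf_graph G l)"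
proof (cases "restrict f (pverts G) = restrict g (pverts G)")
  case False
  from assms obtain v where v: "\<forall>u\<in>pverts G - {v}. f u = g u"
    and p: "proper (pverts G) {1..l} f" "proper (pverts G) {1..l} g" unfolding step_def by blast
  from False obtain w where w: "w \<in> pverts G" "f w \<noteq> g w" by (metis restrict_ext)
  have "\<exists>!x. x \<in> pverts G \<and> restrict f (pverts G) x \<noteq> restrict g (pverts G) x"
  proof (rule ex1I[of _ w])
    show "w \<in> pverts G \<and> restrict f (pverts G) w \<noteq> restrict g (pverts G) w" using w by simp
    show "x = w" if "x \<in> pverts G \<and> restrict f (pverts G) x \<noteq> restrict g (pverts G) x" for x
      using that v w by (metis DiffI restrict_apply' singletonD)
  qed
  then show ?thesis using restrict_colorings p unfolding reconf_graph_def by simp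
qed simp

text \<open>Stated for \<open>mk_symmetric\<close> because connectedness of a digraph is defined as
  strong connectedness of its symmetric closure.\<close>

lemma reconf_reachable:
  assumes "reach (pverts G) {1..l} f g" "proper (pverts G) {1..l} f"
  shows "restrict f (pverts G) \<rightarrow>\<^sup>*\<^bsub>with_proj (mk_symmetric (with_proj (reconf_graph G l)))\<^esub> restrict g (pverts G)"
  using assms(1)
proof (induction rule: rtranclp_induct)
  case base
  show ?case
    using restrict_colorings[OF assms(2)] unfolding reachable_def by (simp add: reconf_graph_def)
next
  case (step g h)
  let ?r = "\<lambda>f. restrict f (pverts G)"
  from reconf_step[OF step.hyps(2)] show ?case
  proof
    assume e: "(?r g, ?r h) \<in> parcs (reconf_graph G l)"
    then have "(?r g, ?r h) \<in> parcs (mk_symmetric (with_proj (reconf_graph G l)))"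
      unfolding parcs_mk_symmetric by force
    moreover have "?r h \<in> pverts (reconf_graph G l)" using e unfolding reconf_graph_def by auto
    ultimately show ?thesis
      using step.IH unfolding reachable_def by (auto intro: rtrancl_on_into_rtrancl_on)
  qed (use step.IH in simp)
qed

lemma recolorable_if:
  assumes "recolorable_on (pverts G)"
  shows "recolorable G"
  unfolding recolorable_def
proof (intro allI impI)
  fix l assume l: "chromatic_number G < l"
  obtain f where f: "proper (pverts G) {1..chromatic_number G} f"
    using chromatic_number_attained[OF pair_graph_axioms] colorings_iff by blast
  then have "colorable (pverts G) (chromatic_number G)" by (rule proper_colorable) simp_all
  then have mix: "mixing (pverts G) {1..l}" using assms l unfolding recolorable_on_def by simp
  have "proper (pverts G) {1..l} f" using proper_mono[OF f] l by simp
  then have ne: "pverts (reconf_graph G l) \<noteq> {}"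
    using restrict_colorings unfolding reconf_graph_def by auto
  have "f \<rightarrow>\<^sup>*\<^bsub>with_proj (mk_symmetric (with_proj (reconf_graph G l)))\<^esub> g"
    if "f \<in> pverts (reconf_graph G l)" "g \<in> pverts (reconf_graph G l)" for f g
  proof -
    have fg: "proper (pverts G) {1..l} f" "proper (pverts G) {1..l} g"
      "restrict f (pverts G) = f" "restrict g (pverts G) = g"
      using that colorings_iff extensional_restrict unfolding reconf_graph_def by fastforce+
    then have "reach (pverts G) {1..l} f g" using mix unfolding mixing_def by blast
    from reconf_reachable[OF this fg(1)] show ?thesis unfolding fg(3,4) .
  qed
  with ne show "Digraph_Component.connected (with_proj (reconf_graph G l))"
    unfolding Digraph_Component.connected_def strongly_connected_def by simp
qed

end

theorem theorem1p6:
  fixes G :: "'a pair_pre_digraph"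
    and Ha Hb :: "nat pair_pre_digraph"
  assumes "Ha \<in> {H2, H3, H4}" and "Hb \<in> {H2, H3, H4}" and "Ha \<noteq> Hb"
    and "pair_graph G"
    and "free_of {two_K2, K4, Ha, Hb} G"
  shows "recolorable G"
proof -
  interpret pair_graph G by fact
  interpret free_pair_graph G "{two_K2, K4, Ha, Hb}" by unfold_locales fact
  have "finite (pverts G)" using finite_verts by simp
  moreover have "two_K2_free (pverts G)" "K4_free (pverts G)"
    using two_K2_free_pverts K4_free_pverts by simp_all
  moreover have "H2_free (pverts G) \<and> H3_free (pverts G) \<or> H2_free (pverts G) \<and> H4_free (pverts G) \<or>
      H3_free (pverts G) \<and> H4_free (pverts G)"
    using assms(1-3) H2_free_pverts H3_free_pverts H4_free_pverts by auto
  ultimately show ?thesis using recolorable_if recol_if_two_H_free by blast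
qed

end
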